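(* Let $\Omega\subset\mathbb{R}^n$, $n\ge 2$, be open and bounded, and let $s,t,p,q,\Lambda,K_{sp},K_{tq},a$ satisfy the structural assumptions (A1)–(A5) listed in the context. Assume moreover that $$tq\le sp+\alpha\ \text{ if } s\le t,\qquad tq\le sp\ \text{ if } s>t.$$ Let $B_R(x_0)\Subset\Omega$ with $0<R\le1$, and let $u\in\mathcal{A}(\Omega)\cap L^{p-1}_{sp}(\mathbb{R}^n)\cap L^{q-1}_{a,tq}(\Omega,\mathbb{R}^n)$ be a (local) minimizer in $\Omega$ of $$\mathcal{F}(u;\Omega)=\iint_{\mathcal{C}_\Omega}\left(|u(x)-u(y)|^pK_{sp}(x,y)+a(x,y)|u(x)-u(y)|^qK_{tq}(x,y)\right)dx\,dy .$$ Then there exist constants $C\ge1$ and $\kappa>0$, depending only on $\mathfrak{D}_u(B_R(x_0))$, such that for all $\rho,r$ with $\frac R2\le\rho<r\le R$, $$\sup_{B_\rho(x_0)}u_+\le C\left(\frac{R}{r-\rho}\right)^\kappa\left[(H_R)^{-1}\left(\frac{1}{|B_r(x_0)|}\int_{B_r(x_0)}H_R(u_+)\,dx\right)+(h_R)^{-1}\bigl(\mathcal{T}_{R/2,R}(u_+;x_0)\bigr)\right].$$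
   Context: Structural assumptions. (A1) $0<s,t<1$ and $1<p\le q<\infty$. (A2) $K_{sp},K_{tq}:\mathbb{R}^n\times\mathbb{R}^n\to\mathbb{R}$ are symmetric measurable kernels with, for some $\Lambda\ge1$, $\Lambda^{-1}|x-y|^{-n-sp}\le K_{sp}(x,y)\le\Lambda|x-y|^{-n-sp}$ and $\Lambda^{-1}|x-y|^{-n-tq}\le K_{tq}(x,y)\le\Lambda|x-y|^{-n-tq}$. (A3) $a:\mathbb{R}^n\times\mathbb{R}^n\to[0,\infty)$ is measurable, $a\in L^\infty_{\rm loc}(\Omega\times\Omega)$, and $a(x,y)=a(y,x)$ for a.e. $(x,y)$. (A4) If $s\le t$: there are $\alpha\in(0,1]$ and $[a]_\alpha<\infty$ with $|a(x_1,y_1)-a(x_2,y_2)|\le[a]_\alpha(|x_1-x_2|+|y_1-y_2|)^\alpha$ on $\mathbb{R}^n\times\mathbb{R}^n$. If $s>t$: $|a(x,y)|\le\|a\|_{L^\infty}<\infty$ on $\mathbb{R}^n\times\mathbb{R}^n$. (A5) $q\le\frac{np}{n-sp}$ if $sp<n$; $p\le q<\infty$ if $sp\ge n$. Domain of integration: $\mathcal{C}_\Omega=(\mathbb{R}^n\times\mathbb{R}^n)\setminus\bigl((\mathbb{R}^n\setminus\Omega)\times(\mathbb{R}^n\setminus\Omega)\bigr)$. Function spaces. $\mathcal{A}(\Omega)$ is the set of $u:\mathbb{R}^n\to\mathbb{R}$ with $u|_\Omega\in L^p(\Omega)$ and $\iint_{\mathcal{C}_\Omega}\left(\frac{|u(x)-u(y)|^p}{|x-y|^{n+sp}}+a(x,y)\frac{|u(x)-u(y)|^q}{|x-y|^{n+tq}}\right)dx\,dy<\infty$.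 $L^{p-1}_{sp}(\mathbb{R}^n)$ is the set of $u:\mathbb{R}^n\to\mathbb{R}$ with $\int_{\mathbb{R}^n}\frac{|u(x)|^{p-1}}{(1+|x|)^{n+sp}}dx<\infty$. $L^{q-1}_{a,tq}(\Omega,\mathbb{R}^n)$ is the set of $u:\mathbb{R}^n\to\mathbb{R}$ with $\sup_{x\in\Omega}\int_{\mathbb{R}^n}a(x,y)\frac{|u(y)|^{q-1}}{(1+|y|)^{n+tq}}dy<\infty$. Minimizer: $u\in\mathcal{A}(\Omega)$ is a (local) minimizer of $\mathcal{F}$ in $\Omega$ if $\mathcal{F}(u;\Omega)\le\mathcal{F}(v;\Omega)$ for every $v\in\mathcal{A}(\Omega)$ with $v=u$ a.e. in $\mathbb{R}^n\setminus\Omega$. Notation. $u_+=\max\{u,0\}$; $\sup$ of $u_+$ on a set is essential. For a fixed center $x_0$ and $r>0$, $a_r^-:=\inf_{B_r(x_0)\times B_r(x_0)}a(x,y)$ and, for $\tau\ge0$, $h_r(\tau):=\frac{\tau^{p-1}}{r^{sp}}+a_r^-\frac{\tau^{q-1}}{r^{tq}}$ and $H_r(\tau):=\frac{\tau^{p}}{r^{sp}}+a_r^-\frac{\tau^{q}}{r^{tq}}$; $(h_r)^{-1}$ and $(H_r)^{-1}$ are their inverses on $[0,\infty)$. The two-radius tail is $$\mathcal{T}_{r,R}(v;x_0):=\int_{\mathbb{R}^n\setminus B_r(x_0)}\frac{|v(y)|^{p-1}}{|y-x_0|^{n+sp}}dy+\sup_{x\in B_R(x_0)}\int_{\mathbb{R}^n\setminus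 B_r(x_0)}a(x,y)\frac{|v(y)|^{q-1}}{|y-x_0|^{n+tq}}dy.$$ Data. For $E\subset\Omega$, $\mathfrak{D}_u(E)$ is the list consisting of: $n,p,q,s,t,\Lambda$; together with $\alpha,[a]_\alpha$ if $s\le t$, or $\|a\|_{L^\infty}$ if $s>t$; together with $\|u\|_{L^\infty(E)}$ if $sp\le n$, or $[u]_{W^{s,p}(E)}:=\left(\int_E\int_E\frac{|u(x)-u(y)|^p}{|x-y|^{n+sp}}dx\,dy\right)^{1/p}$ if $sp>n$. Under the assumptions $u$ is known to be locally bounded in $\Omega$. *)

theory Defs
  imports "HOL-Analysis.Analysis" "HOL-Probability.Essential_Supremum"
begin

text \<open>
  Points live in \<open>real^'n\<close>, so the dimension is \<open>CARD('n)\<close>.  "Measurable" means Lebesgue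
  measurable, and double integrals are taken with respect to Lebesgue measure on the product
  space \<open>real^'n \<times> real^'n\<close>.  All integrands are nonnegative, so integrals, suprema of
  integrals and essential suprema are \<open>ennreal\<close>-valued and may be infinite.
\<close>

definition sym_kernel :: "real \<Rightarrow> real \<Rightarrow> (real^'n \<Rightarrow> real^'n \<Rightarrow> real) \<Rightarrow> bool" where
  \<comment> \<open>Kernel of order \<open>\<sigma> = s p\<close> or \<open>t q\<close>.  The diagonal is excluded, since there the
    bounds \<open>|x - y|^(- n - \<sigma>)\<close> are infinite.\<close>
  "sym_kernel \<Lambda> \<sigma> K \<longleftrightarrow>
     (\<lambda>z. K (fst z) (snd z)) \<in> borel_measurable lebesgue \<and>
     (\<forall>x y. K x y = K y x) \<and>
     (\<forall>x y. x \<noteq> y \<longrightarrow>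
        inverse \<Lambda> * norm (x - y) powr (- real CARD('n) - \<sigma>) \<le> K x y \<and>
        K x y \<le> \<Lambda> * norm (x - y) powr (- real CARD('n) - \<sigma>))"

definition modulating_coeff :: "(real^'n) set \<Rightarrow> (real^'n \<Rightarrow> real^'n \<Rightarrow> real) \<Rightarrow> bool" where
  \<comment> \<open>The condition on compact sets \<open>S\<close> says that \<open>a \<in> L\<^sup>\<infinity>_loc(\<Omega> \<times> \<Omega>)\<close>.\<close>
  "modulating_coeff \<Omega> a \<longleftrightarrow>
     (\<lambda>z. a (fst z) (snd z)) \<in> borel_measurable lebesgue \<and> (\<forall>x y. 0 \<le> a x y) \<and>
     (\<forall>S. compact S \<and> S \<subseteq> \<Omega> \<times> \<Omega> \<longrightarrow> (\<exists>c. AE z in lebesgue. z \<in> S \<longrightarrow> \<bar>a (fst z) (snd z)\<bar> \<le> c)) \<and>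
     (AE z in lebesgue. a (fst z) (snd z) = a (snd z) (fst z))"

definition Linf_norm :: "('b::euclidean_space) set \<Rightarrow> ('b \<Rightarrow> real) \<Rightarrow> ennreal" where
  "Linf_norm E f = esssup (lebesgue_on E) (\<lambda>x. ennreal \<bar>f x\<bar>)"

definition coeff_data ::
  "real \<Rightarrow> real \<Rightarrow> real \<Rightarrow> real \<Rightarrow> (real^'n \<Rightarrow> real^'n \<Rightarrow> real) \<Rightarrow> bool" where
  \<comment> \<open>\<open>A\<close> stands for \<open>[a]\<^sub>\<alpha>\<close> if \<open>s \<le> t\<close>, and for the \<open>L\<^sup>\<infinity>\<close> norm of \<open>a\<close> if \<open>s > t\<close>, in
    which case \<open>\<alpha>\<close> plays no role.\<close>
  "coeff_data s t \<alpha> A a \<longleftrightarrow>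
     (if s \<le> t
      then \<forall>x1 y1 x2 y2. \<bar>a x1 y1 - a x2 y2\<bar> \<le> A * (norm (x1 - x2) + norm (y1 - y2)) powr \<alpha>
      else Linf_norm UNIV (\<lambda>z. a (fst z) (snd z)) = ennreal A \<and> (\<forall>x y. \<bar>a x y\<bar> \<le> A))"

definition cross_dom :: "(real^'n) set \<Rightarrow> ((real^'n) \<times> (real^'n)) set" where
  "cross_dom \<Omega> = UNIV - (UNIV - \<Omega>) \<times> (UNIV - \<Omega>)"

definition space_A ::
  "real \<Rightarrow> real \<Rightarrow> real \<Rightarrow> real \<Rightarrow> (real^'n \<Rightarrow> real^'n \<Rightarrow> real) \<Rightarrow> (real^'n) set \<Rightarrow> (real^'n \<Rightarrow> real) set"
where
  "space_A s t p q a \<Omega> = {u.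
     u \<in> borel_measurable lebesgue \<and>
     (\<integral>\<^sup>+x\<in>\<Omega>. ennreal (\<bar>u x\<bar> powr p) \<partial>lebesgue) < \<infinity> \<and>
     (\<integral>\<^sup>+z\<in>cross_dom \<Omega>. (case z of (x, y) \<Rightarrow> ennreal (
          \<bar>u x - u y\<bar> powr p / norm (x - y) powr (real CARD('n) + s * p)
        + a x y * (\<bar>u x - u y\<bar> powr q / norm (x - y) powr (real CARD('n) + t * q)))) \<partial>lebesgue) < \<infinity>}"

definition tail_space_p :: "real \<Rightarrow> real \<Rightarrow> (real^'n \<Rightarrow> real) set" where
  "tail_space_p s p = {u. u \<in> borel_measurable lebesgue \<and>
     (\<integral>\<^sup>+x. ennreal (\<bar>u x\<bar> powr (p - 1) / (1 + norm x) powr (real CARD('n) + s * p)) \<partial>lebesgue) < \<infinity>}"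

definition tail_space_q ::
  "real \<Rightarrow> real \<Rightarrow> (real^'n \<Rightarrow> real^'n \<Rightarrow> real) \<Rightarrow> (real^'n) set \<Rightarrow> (real^'n \<Rightarrow> real) set" where
  "tail_space_q t q a \<Omega> = {u. u \<in> borel_measurable lebesgue \<and>
     (SUP x\<in>\<Omega>. \<integral>\<^sup>+y. ennreal (a x y * (\<bar>u y\<bar> powr (q - 1) / (1 + norm y) powr (real CARD('n) + t * q)))
        \<partial>lebesgue) < \<infinity>}"

definition energy ::
  "real \<Rightarrow> real \<Rightarrow> (real^'n \<Rightarrow> real^'n \<Rightarrow> real) \<Rightarrow> (real^'n \<Rightarrow> real^'n \<Rightarrow> real) \<Rightarrow>
   (real^'n \<Rightarrow> real^'n \<Rightarrow> real) \<Rightarrow> (real^'n) set \<Rightarrow> (real^'n \<Rightarrow> real) \<Rightarrow> ennreal" where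
  "energy p q Ksp Ktq a \<Omega> u =
     (\<integral>\<^sup>+z\<in>cross_dom \<Omega>. (case z of (x, y) \<Rightarrow> ennreal (
          \<bar>u x - u y\<bar> powr p * Ksp x y + a x y * \<bar>u x - u y\<bar> powr q * Ktq x y)) \<partial>lebesgue)"

definition minimizer ::
  "real \<Rightarrow> real \<Rightarrow> real \<Rightarrow> real \<Rightarrow> (real^'n \<Rightarrow> real^'n \<Rightarrow> real) \<Rightarrow> (real^'n \<Rightarrow> real^'n \<Rightarrow> real) \<Rightarrow>
   (real^'n \<Rightarrow> real^'n \<Rightarrow> real) \<Rightarrow> (real^'n) set \<Rightarrow> (real^'n \<Rightarrow> real) \<Rightarrow> bool" where
  "minimizer s t p q Ksp Ktq a \<Omega> u \<longleftrightarrow>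
     u \<in> space_A s t p q a \<Omega> \<and>
     (\<forall>v \<in> space_A s t p q a \<Omega>. (AE x in lebesgue. x \<notin> \<Omega> \<longrightarrow> v x = u x) \<longrightarrow>
        energy p q Ksp Ktq a \<Omega> u \<le> energy p q Ksp Ktq a \<Omega> v)"

definition Wsp_seminorm :: "real \<Rightarrow> real \<Rightarrow> (real^'n) set \<Rightarrow> (real^'n \<Rightarrow> real) \<Rightarrow> ennreal" where
  "Wsp_seminorm s p E u =
     (let I = \<integral>\<^sup>+z\<in>E \<times> E. (case z of (x, y) \<Rightarrow> ennreal (
                \<bar>u x - u y\<bar> powr p / norm (x - y) powr (real CARD('n) + s * p))) \<partial>lebesgue
      in if I = \<infinity> then \<infinity> else ennreal (enn2real I powr (1 / p)))"

definition data_norm :: "real \<Rightarrow> real \<Rightarrow> (real^'n) set \<Rightarrow> (real^'n \<Rightarrow> real) \<Rightarrow> ennreal" where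
  "data_norm s p E u = (if s * p \<le> real CARD('n) then Linf_norm E u else Wsp_seminorm s p E u)"

definition pos_part :: "('b \<Rightarrow> real) \<Rightarrow> 'b \<Rightarrow> real" where
  "pos_part u x = max (u x) 0"

definition a_inf :: "(real^'n \<Rightarrow> real^'n \<Rightarrow> real) \<Rightarrow> real^'n \<Rightarrow> real \<Rightarrow> real" where
  "a_inf a x0 r = (INF z \<in> ball x0 r \<times> ball x0 r. a (fst z) (snd z))"

definition h_fun ::
  "real \<Rightarrow> real \<Rightarrow> real \<Rightarrow> real \<Rightarrow> (real^'n \<Rightarrow> real^'n \<Rightarrow> real) \<Rightarrow> real^'n \<Rightarrow> real \<Rightarrow> real \<Rightarrow> real" where
  "h_fun s t p q a x0 r \<tau> =
     \<tau> powr (p - 1) / r powr (s * p) + a_inf a x0 r * (\<tau> powr (q - 1) / r powr (t * q))"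

definition H_fun ::
  "real \<Rightarrow> real \<Rightarrow> real \<Rightarrow> real \<Rightarrow> (real^'n \<Rightarrow> real^'n \<Rightarrow> real) \<Rightarrow> real^'n \<Rightarrow> real \<Rightarrow> real \<Rightarrow> real" where
  "H_fun s t p q a x0 r \<tau> =
     \<tau> powr p / r powr (s * p) + a_inf a x0 r * (\<tau> powr q / r powr (t * q))"

definition inv_nonneg :: "(real \<Rightarrow> real) \<Rightarrow> ennreal \<Rightarrow> ennreal" where
  \<comment> \<open>Inverse of a bijection \<open>f\<close> of \<open>[0, \<infinity>)\<close>, extended by \<open>\<infinity> \<mapsto> \<infinity>\<close>.\<close>
  "inv_nonneg f y = (if y = \<infinity> then \<infinity> else ennreal (inv_into {0..} f (enn2real y)))"

definition tail ::
  "real \<Rightarrow> real \<Rightarrow> real \<Rightarrow> real \<Rightarrow> (real^'n \<Rightarrow> real^'n \<Rightarrow> real) \<Rightarrow> real \<Rightarrow> real \<Rightarrow>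
   (real^'n \<Rightarrow> real) \<Rightarrow> real^'n \<Rightarrow> ennreal" where
  "tail s t p q a r R v x0 =
     (\<integral>\<^sup>+y\<in>UNIV - ball x0 r.
        ennreal (\<bar>v y\<bar> powr (p - 1) / norm (y - x0) powr (real CARD('n) + s * p)) \<partial>lebesgue)
   + (SUP x\<in>ball x0 R. \<integral>\<^sup>+y\<in>UNIV - ball x0 r.
        ennreal (a x y * (\<bar>v y\<bar> powr (q - 1) / norm (y - x0) powr (real CARD('n) + t * q))) \<partial>lebesgue)"

definition average :: "(real^'n) set \<Rightarrow> (real^'n \<Rightarrow> real) \<Rightarrow> ennreal" where
  \<comment> \<open>Mean value of a nonnegative function.\<close>
  "average B f = (\<integral>\<^sup>+x\<in>B. ennreal (f x) \<partial>lebesgue) / emeasure lebesgue B"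

end

theory Submission
  imports Defs
begin

text \<open>
  Minimality is tested only against \<open>v = u - \<eta>\<^sup>q (u - k)\<^sub>+\<close> with a Lipschitz cutoff \<open>\<eta>\<close>. Convexity of
  \<open>\<tau> \<mapsto> \<tau>\<^sup>m\<close>, for \<open>m = p\<close> and \<open>m = q\<close>, compares the integrands of \<open>v\<close> and \<open>u\<close> pointwise, which yields a
  Caccioppoli inequality without hole filling or an Euler--Lagrange equation. On the ball \<open>B\<^sub>R\<close> the
  coefficient \<open>a\<close> exceeds its infimum by at most a multiple of \<open>R powr (t q - s p)\<close>; since \<open>(u - k)\<^sub>+\<close> is bounded there in
  terms of the data, the excess \<open>q\<close>-energy is absorbed by the \<open>p\<close>-energy and everything is controlled
  by \<open>H\<^sub>R\<close>. The gain of integrability needed for De Giorgi's iteration comes from an elementary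
  inequality for functions of small support instead of a Sobolev embedding; the same inequality,
  iterated on its own, bounds \<open>(u - k)\<^sub>+\<close> when \<open>s p > n\<close>.
\<close>

section \<open>Lebesgue measure on product spaces\<close>

text \<open>What has to be avoided is a term with the energy of \<open>u\<close> on the right-hand
  side. The pointwise comparison of \<open>v\<close> with \<open>u\<close> leaves, besides the
  density of \<open>u\<close>, only errors made of powers of \<open>w = (u - k)_+\<close>;
  minimality cancels the energies, and the increments of \<open>w\<close> on the smaller ball remain
  as a net gain. The constants may depend only on the data, and for s p > n these contain merely a
  seminorm, which controls \<open>u\<close> only up to an additive constant. A bound on the excess
  is therefore asked only above levels whose superlevel set fills at most half of the ball. By
  Chebyshev's inequality for \<open>H\<close>, twice the value of the inverse of \<open>H\<close> at
  the mean is such a level, and the right-hand side of the estimate can pay for it. The exponent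
  \<kappa> = (n + q) / (\<delta> p) has three sources: the power n + q of the ratio of radii in the
  Caccioppoli inequality, a division by \<delta> from the smallness condition of geometric
  convergence, and a division by p from H (c x) >= c^p H x for c >= 1.\<close>

lemma AE_lebesgue_pairD:
  fixes P :: "'a::euclidean_space \<times> 'b::euclidean_space \<Rightarrow> bool"
  assumes "AE z in lebesgue. P z"
  shows "AE x in lebesgue. AE y in lebesgue. P (x, y)"
    and "AE y in lebesgue. AE x in lebesgue. P (x, y)"
proof -
  have *: "AE z in lborel \<Otimes>\<^sub>M lborel. P z"
    using assms unfolding AE_completion_iff lborel_prod .
  show "AE x in lebesgue. AE y in lebesgue. P (x, y)"
    using lborel_pair.AE_pair[OF *] by (simp add: AE_completion_iff)
  obtain N where N: "N \<in> null_sets (lborel \<Otimes>\<^sub>M lborel)" "{z \<in> space (lborel \<Otimes>\<^sub>M lborel). \<not> P z} \<subseteq> N"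
    using * by (auto elim!: AE_E simp: null_sets_def)
  have Nm: "N \<in> sets (lborel \<Otimes>\<^sub>M lborel)" using N by auto
  have "AE x in lborel. AE y in lborel. (x, y) \<notin> N"
    using lborel_pair.AE_pair[OF AE_not_in[OF N(1)]] .
  moreover have "{x \<in> space (lborel \<Otimes>\<^sub>M lborel). (fst x, snd x) \<notin> N} \<in> sets (lborel \<Otimes>\<^sub>M lborel)"
    using sets.compl_sets[OF Nm] by (simp add: set_diff_eq)
  ultimately have "AE y in lborel. AE x in lborel. (x, y) \<notin> N"
    using lborel_pair.AE_commute[of "\<lambda>x y. (x, y) \<notin> N"] by (simp add: case_prod_beta')
  moreover have "(x, y) \<notin> N \<Longrightarrow> P (x, y)" for x y
    using N(2) by (auto simp: space_pair_measure)
  ultimately have "AE y in lborel. AE x in lborel. P (x, y)"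
    by (auto elim!: eventually_mono)
  then show "AE y in lebesgue. AE x in lebesgue. P (x, y)"
    by (simp add: AE_completion_iff)
qed

text \<open>Completeness of the measure: preimages under \<open>f\<close> and under its Borel
  representative \<open>g\<close> differ by a null set. The transfers to sections, projections and
  swapped arguments rely on this.\<close>

lemma borel_measurable_lebesgue_AE_eq:
  fixes f g :: "'a::euclidean_space \<Rightarrow> 'b::topological_space"
  assumes "g \<in> borel_measurable lborel" "AE x in lborel. f x = g x"
  shows "f \<in> borel_measurable lebesgue"
proof (rule measurableI)
  fix S :: "'b set" assume "S \<in> sets borel"
  then have g: "g -` S \<in> sets (lebesgue :: 'a measure)"
    using measurable_sets[OF measurable_completion[OF assms(1)]] by simp
  show "f -` S \<inter> space (lebesgue :: 'a measure) \<in> sets lebesgue"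
    by (rule complete_measure.in_sets_AE[OF completion.complete_measure_axioms _ g])
      (use assms(2) in \<open>auto simp: AE_completion_iff elim!: eventually_mono\<close>)
qed auto

text \<open>\<open>lebesgue\<close> on a product space is the completion of the product Borel
  measure, which is larger than the product of the two completions. Tonelli's theorem is therefore
  applied to a Borel representative, whose sections agree almost everywhere with those of
  \<open>f\<close> for almost every value of the other variable.\<close>

lemma nn_integral_lebesgue_iterated:
  fixes f :: "'a::euclidean_space \<times> 'b::euclidean_space \<Rightarrow> ennreal"
  assumes "f \<in> borel_measurable lebesgue"
  shows "(\<integral>\<^sup>+z. f z \<partial>lebesgue) = (\<integral>\<^sup>+x. \<integral>\<^sup>+y. f (x, y) \<partial>lebesgue \<partial>lebesgue)"
    and "(\<integral>\<^sup>+z. f z \<partial>lebesgue) = (\<integral>\<^sup>+y. \<integral>\<^sup>+x. f (x, y) \<partial>lebesgue \<partial>lebesgue)"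
proof -
  obtain g where g: "g \<in> borel_measurable (lborel \<Otimes>\<^sub>M lborel)" "AE z in lborel. f z = g z"
    using completion_ex_borel_measurable[OF assms] by (auto simp: lborel_prod)
  have *: "AE x in lebesgue. AE y in lebesgue. f (x, y) = g (x, y)"
          "AE y in lebesgue. AE x in lebesgue. f (x, y) = g (x, y)"
    using AE_lebesgue_pairD[of "\<lambda>z. f z = g z"] g(2) by (auto simp: AE_completion_iff)
  have "(\<integral>\<^sup>+z. f z \<partial>lebesgue) = (\<integral>\<^sup>+z. g z \<partial>(lborel \<Otimes>\<^sub>M lborel))"
    using g(2) by (auto simp: nn_integral_completion lborel_prod intro: nn_integral_cong_AE)
  then have eq: "(\<integral>\<^sup>+z. f z \<partial>lebesgue) = (\<integral>\<^sup>+x. \<integral>\<^sup>+y. g (x, y) \<partial>lebesgue \<partial>lebesgue)"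
         "(\<integral>\<^sup>+z. f z \<partial>lebesgue) = (\<integral>\<^sup>+y. \<integral>\<^sup>+x. g (x, y) \<partial>lebesgue \<partial>lebesgue)"
    using lborel.nn_integral_fst[OF g(1)] lborel_pair.nn_integral_snd[of g] g(1)
    by (auto simp: nn_integral_completion)
  show "(\<integral>\<^sup>+z. f z \<partial>lebesgue) = (\<integral>\<^sup>+x. \<integral>\<^sup>+y. f (x, y) \<partial>lebesgue \<partial>lebesgue)"
    unfolding eq(1) using *(1)
    by (intro nn_integral_cong_AE) (auto elim!: eventually_mono intro!: nn_integral_cong_AE)
  show "(\<integral>\<^sup>+z. f z \<partial>lebesgue) = (\<integral>\<^sup>+y. \<integral>\<^sup>+x. f (x, y) \<partial>lebesgue \<partial>lebesgue)"
    unfolding eq(2) using *(2)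
    by (intro nn_integral_cong_AE) (auto elim!: eventually_mono intro!: nn_integral_cong_AE)
qed

text \<open>Only almost every section can be expected to be measurable: over a null set of
  \<open>x\<close> the function is arbitrary.\<close>

lemma AE_borel_measurable_section:
  fixes f :: "'a::euclidean_space \<times> 'b::euclidean_space \<Rightarrow> real"
  assumes "f \<in> borel_measurable lebesgue"
  shows "AE x in lebesgue. (\<lambda>y. f (x, y)) \<in> borel_measurable lebesgue"
proof -
  obtain g where g: "g \<in> borel_measurable (lborel \<Otimes>\<^sub>M lborel)" "AE z in lborel. f z = g z"
    using completion_ex_borel_measurable_real[OF assms] by (auto simp: lborel_prod)
  have "AE x in lebesgue. AE y in lebesgue. f (x, y) = g (x, y)"
    using AE_lebesgue_pairD(1)[of "\<lambda>z. f z = g z"] g(2) by (auto simp: AE_completion_iff)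
  then show ?thesis
  proof eventually_elim
    case (elim x)
    have "(\<lambda>y. g (x, y)) \<in> borel_measurable lborel"
      using g(1) by measurable
    then show ?case
      by (rule borel_measurable_lebesgue_AE_eq) (use elim in \<open>simp add: AE_completion_iff\<close>)
  qed
qed

text \<open>A cylinder over a null set is null although the other factor has infinite measure, since
  0 times \<infinity> is 0 in \<open>ennreal\<close>.\<close>

lemma AE_lebesgue_fstI:
  assumes "AE x in lebesgue. P x"
  shows "AE z in (lebesgue :: ('a::euclidean_space \<times> 'b::euclidean_space) measure). P (fst z)"
    and "AE z in (lebesgue :: ('b::euclidean_space \<times> 'a::euclidean_space) measure). P (snd z)"
proof -
  obtain N where N: "N \<in> null_sets lborel" "{x. \<not> P x} \<subseteq> N"
    using assms by (auto simp: AE_completion_iff elim!: AE_E simp: null_sets_def)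
  then have [measurable]: "N \<in> sets borel" and e: "emeasure lborel N = 0" by auto
  have "emeasure (lborel :: ('a \<times> 'b) measure) (N \<times> UNIV) = 0"
    using lborel.emeasure_pair_measure_Times[of N lborel "UNIV :: 'b set"] e by (simp add: lborel_prod)
  then have "N \<times> UNIV \<in> null_sets (lborel :: ('a \<times> 'b) measure)"
    by (auto simp: null_sets_def borel_prod[symmetric])
  then show "AE z in (lebesgue :: ('a \<times> 'b) measure). P (fst z)"
    unfolding AE_completion_iff by (rule AE_I') (use N(2) in auto)
  have "emeasure (lborel :: ('b \<times> 'a) measure) (UNIV \<times> N) = 0"
    using lborel.emeasure_pair_measure_Times[of "UNIV :: 'b set" lborel N] e by (simp add: lborel_prod)
  then have "UNIV \<times> N \<in> null_sets (lborel :: ('b \<times> 'a) measure)"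
    by (auto simp: null_sets_def borel_prod[symmetric])
  then show "AE z in (lebesgue :: ('b \<times> 'a) measure). P (snd z)"
    unfolding AE_completion_iff by (rule AE_I') (use N(2) in auto)
qed

lemma borel_measurable_lebesgue_fst_snd [measurable (raw)]:
  fixes f :: "'a::euclidean_space \<Rightarrow> real"
  assumes "f \<in> borel_measurable lebesgue"
  shows "(\<lambda>z. f (fst z)) \<in> borel_measurable (lebesgue :: ('a \<times> 'b::euclidean_space) measure)"
    and "(\<lambda>z. f (snd z)) \<in> borel_measurable (lebesgue :: ('b \<times> 'a) measure)"
proof -
  obtain g where g: "g \<in> borel_measurable lborel" "AE z in lborel. f z = g z"
    using completion_ex_borel_measurable_real[OF assms] by auto
  then have g'[measurable]: "g \<in> borel_measurable borel" by simp
  show "(\<lambda>z. f (fst z)) \<in> borel_measurable (lebesgue :: ('a \<times> 'b) measure)"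
    by (rule borel_measurable_lebesgue_AE_eq[of "\<lambda>z. g (fst z)"])
      (use AE_lebesgue_fstI(1)[of "\<lambda>x. f x = g x"] g(2) in \<open>auto simp: AE_completion_iff borel_prod[symmetric]\<close>)
  show "(\<lambda>z. f (snd z)) \<in> borel_measurable (lebesgue :: ('b \<times> 'a) measure)"
    by (rule borel_measurable_lebesgue_AE_eq[of "\<lambda>z. g (snd z)"])
      (use AE_lebesgue_fstI(2)[of "\<lambda>x. f x = g x"] g(2) in \<open>auto simp: AE_completion_iff borel_prod[symmetric]\<close>)
qed

lemma borel_measurable_lebesgue_ident [measurable]:
  "(\<lambda>x. x) \<in> (lebesgue :: 'a::euclidean_space measure) \<rightarrow>\<^sub>M borel"
  "fst \<in> (lebesgue :: ('a::euclidean_space \<times> 'b::euclidean_space) measure) \<rightarrow>\<^sub>M borel"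
  "snd \<in> (lebesgue :: ('a::euclidean_space \<times> 'b::euclidean_space) measure) \<rightarrow>\<^sub>M borel"
  by (auto intro!: measurable_completion borel_measurable_continuous_onI continuous_intros)

lemma pred_ball_borel [measurable (raw)]:
  "f \<in> borel_measurable M \<Longrightarrow> Measurable.pred M (\<lambda>x. f x \<in> ball c r)"
  by (rule pred_sets2[of _ borel]) auto

lemma pred_compl_ball_borel [measurable (raw)]:
  "f \<in> borel_measurable M \<Longrightarrow> Measurable.pred M (\<lambda>x. f x \<in> - ball c r)"
  unfolding Compl_iff by (intro pred_intros_logic pred_ball_borel)

lemma superlevel_in_ball_sets:
  fixes f :: "'a::euclidean_space \<Rightarrow> real"
  assumes [measurable]: "f \<in> borel_measurable lebesgue"
  shows "{x \<in> ball c r. k < f x} \<in> sets lebesgue"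
proof -
  have "{x \<in> space lebesgue. x \<in> ball c r \<and> k < f x} \<in> sets lebesgue" by measurable
  then show ?thesis by simp
qed

text \<open>The swap preserves the Borel product measure, hence its null sets and those of the
  completion.\<close>

lemma AE_lebesgue_swap:
  fixes P :: "'a::euclidean_space \<Rightarrow> 'a \<Rightarrow> bool"
  assumes "AE z in lebesgue. P (fst z) (snd z)"
  shows "AE z in lebesgue. P (snd z) (fst z)"
proof -
  obtain N where N: "N \<in> null_sets (lborel \<Otimes>\<^sub>M lborel)" "{z. \<not> P (fst z) (snd z)} \<subseteq> N"
    using assms by (auto simp: AE_completion_iff lborel_prod elim!: AE_E simp: null_sets_def)
  let ?sw = "\<lambda>z :: 'a \<times> 'a. (snd z, fst z)"
  have Nm[measurable]: "N \<in> sets (lborel \<Otimes>\<^sub>M lborel)" using N(1) by (rule null_setsD2)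
  have sw: "?sw \<in> lborel \<Otimes>\<^sub>M lborel \<rightarrow>\<^sub>M lborel \<Otimes>\<^sub>M lborel"
    using measurable_pair_swap' by (simp add: case_prod_beta')
  have "distr (lborel \<Otimes>\<^sub>M lborel) (lborel \<Otimes>\<^sub>M lborel) ?sw = (lborel \<Otimes>\<^sub>M lborel :: ('a \<times> 'a) measure)"
    using pair_sigma_finite.distr_pair_swap[of "lborel :: 'a measure" "lborel :: 'a measure"]
    by (simp add: case_prod_beta' lborel_pair.pair_sigma_finite_axioms)
  then have "emeasure (lborel \<Otimes>\<^sub>M lborel) N = emeasure (lborel \<Otimes>\<^sub>M lborel) (?sw -` N)"
    using emeasure_distr[OF sw Nm] by (simp add: space_pair_measure)
  moreover have "?sw -` N \<inter> space (lborel \<Otimes>\<^sub>M lborel) \<in> sets (lborel \<Otimes>\<^sub>M lborel)"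
    by (rule measurable_sets[OF sw Nm])
  ultimately have "?sw -` N \<in> null_sets (lborel \<Otimes>\<^sub>M lborel)"
    using N(1) by (simp add: null_sets_def space_pair_measure)
  then have "?sw -` N \<in> null_sets lborel" unfolding lborel_prod .
  then show ?thesis
    unfolding AE_completion_iff by (rule AE_I') (use N(2) in \<open>auto simp: subset_iff\<close>)
qed

lemma borel_measurable_lebesgue_swap:
  fixes f :: "'a::euclidean_space \<times> 'a \<Rightarrow> real"
  assumes "f \<in> borel_measurable lebesgue"
  shows "(\<lambda>z. f (snd z, fst z)) \<in> borel_measurable lebesgue"
proof -
  obtain g where g: "g \<in> borel_measurable (lborel \<Otimes>\<^sub>M lborel)" "AE z in lborel. f z = g z"
    using completion_ex_borel_measurable_real[OF assms] by (auto simp: lborel_prod)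
  have "(\<lambda>z. g (snd z, fst z)) \<in> borel_measurable (lborel \<Otimes>\<^sub>M lborel)"
    using g(1) by measurable
  then show ?thesis
    using AE_lebesgue_swap[of "\<lambda>x y. f (x, y) = g (x, y)"] g(2)
    by (intro borel_measurable_lebesgue_AE_eq[of "\<lambda>z. g (snd z, fst z)"]) (auto simp: AE_completion_iff lborel_prod)
qed

lemma nn_integral_lebesgue_swap:
  fixes f :: "'a::euclidean_space \<times> 'a \<Rightarrow> real"
  assumes "f \<in> borel_measurable lebesgue"
  shows "(\<integral>\<^sup>+z. ennreal (f (snd z, fst z)) \<partial>lebesgue) = (\<integral>\<^sup>+z. ennreal (f z) \<partial>lebesgue)"
  using nn_integral_lebesgue_iterated(1)[of "\<lambda>z. ennreal (f z)"] assms
    nn_integral_lebesgue_iterated(2)[of "\<lambda>z. ennreal (f (snd z, fst z))"] borel_measurable_lebesgue_swap[OF assms]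
  by simp

section \<open>Fast geometric convergence and a weakly singular integral\<close>

text \<open>The threshold \<theta> for \<open>y 0\<close> is the value at which the bound y_i <=
  \<theta> D^(-i/\<delta>) reproduces itself: the superlinear power cancels the growth D^i, and K
  \<theta>^\<delta> = D^(-1/\<delta>) supplies the decay of the next step.\<close>

lemma fast_geometric_convergence:
  fixes y :: "nat \<Rightarrow> real"
  assumes "0 < \<delta>" "1 < D" "0 < K" and nonneg: "\<And>i. 0 \<le> y i"
    and step: "\<And>i. y (Suc i) \<le> K * D ^ i * y i powr (1 + \<delta>)"
    and init: "y 0 \<le> K powr (- 1 / \<delta>) * D powr (- 1 / \<delta>\<^sup>2)"
  shows "y \<longlonglongrightarrow> 0"
proof -
  define \<theta> where "\<theta> = K powr (- 1 / \<delta>) * D powr (- 1 / \<delta>\<^sup>2)"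
  have \<theta>: "0 < \<theta>" using assms by (simp add: \<theta>_def)
  have \<theta>\<delta>: "K * \<theta> powr \<delta> = D powr (- 1 / \<delta>)"
  proof -
    have "\<theta> powr \<delta> = K powr (- 1) * D powr (- 1 / \<delta>)"
      using assms by (simp add: \<theta>_def powr_mult powr_powr power2_eq_square)
    then show ?thesis using assms by (simp add: powr_minus)
  qed
  have bound: "y i \<le> \<theta> * D powr (- real i / \<delta>)" for i
  proof (induction i)
    case 0
    then show ?case using init assms(2) by (simp add: \<theta>_def)
  next
    case (Suc i)
    have "y (Suc i) \<le> K * D ^ i * (\<theta> * D powr (- real i / \<delta>)) powr (1 + \<delta>)"
      using assms Suc nonneg[of i]
      by (intro order_trans[OF step] mult_left_mono powr_mono2) auto
    also have "\<dots> = K * \<theta> powr (1 + \<delta>) * (D powr real i * D powr (- real i / \<delta> * (1 + \<delta>)))"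
      using assms \<theta> by (simp add: powr_mult powr_powr powr_realpow)
    also have "D powr real i * D powr (- real i / \<delta> * (1 + \<delta>)) = D powr (- real i / \<delta>)"
      unfolding powr_add[symmetric] using assms(1) by (intro arg_cong[where f = "(powr) D"]) (simp add: field_simps)
    also have "K * \<theta> powr (1 + \<delta>) = \<theta> * D powr (- 1 / \<delta>)"
      using \<theta> \<theta>\<delta> by (simp add: powr_add)
    also have "\<theta> * D powr (- 1 / \<delta>) * D powr (- real i / \<delta>) = \<theta> * D powr (- real (Suc i) / \<delta>)"
      unfolding mult.assoc powr_add[symmetric] using assms(1)
      by (intro arg_cong[where f = "\<lambda>z. \<theta> * D powr z"]) (simp add: field_simps)
    finally show ?case .
  qed
  have q: "D powr (- 1 / \<delta>) < 1"
    using assms(1,2) by (intro powr_less_one) auto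
  have "(\<lambda>i. \<theta> * (D powr (- 1 / \<delta>)) ^ i) \<longlonglongrightarrow> \<theta> * 0"
    by (rule tendsto_mult[OF tendsto_const LIMSEQ_power_zero]) (simp only: real_norm_def abs_of_nonneg powr_ge_zero q)
  moreover have "(D powr (- 1 / \<delta>)) ^ i = D powr (- real i / \<delta>)" for i
    using assms(2) by (subst powr_realpow[symmetric]) (auto simp: powr_powr)
  ultimately have lim: "(\<lambda>i. \<theta> * D powr (- real i / \<delta>)) \<longlonglongrightarrow> 0" by simp
  show ?thesis
    by (rule tendsto_sandwich[OF _ _ tendsto_const lim]) (use nonneg bound in auto)
qed

text \<open>Dyadic shells take the place of polar coordinates. On the shell of outer radius r 2^(-j)
  and half that inner radius the kernel is at most 2^|\<beta> - n| times its value at the outer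
  radius, whatever the sign of \<beta> - n; multiplied by the volume of the ball this gives a
  geometric series of ratio 2^(-\<beta>).\<close>

lemma nn_integral_norm_powr_ball_le:
  fixes x :: "'a::euclidean_space"
  assumes "0 < \<beta>" "0 < r"
  shows "(\<integral>\<^sup>+y. indicator {y. norm (x - y) < r} y * ennreal (norm (x - y) powr (\<beta> - real DIM('a))) \<partial>lebesgue)
    \<le> ennreal (unit_ball_vol (real DIM('a)) * 2 powr \<bar>\<beta> - real DIM('a)\<bar> / (1 - 2 powr (- \<beta>)) * r powr \<beta>)"
proof -
  define n where "n = real DIM('a)"
  define c where "c = 2 powr \<bar>\<beta> - n\<bar>"
  let ?g = "\<lambda>j y. indicator (ball x (r * 2 powr (- real j))) y * ennreal (c * (r * 2 powr (- real j)) powr (\<beta> - n))"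
  have pt: "indicator {y. norm (x - y) < r} y * ennreal (norm (x - y) powr (\<beta> - n)) \<le> (\<Sum>j. ?g j y)" for y
  proof (cases "norm (x - y) < r \<and> x \<noteq> y")
    case True
    define d where "d = norm (x - y)"
    have d: "0 < d" "d < r" using True by (auto simp: d_def)
    \<comment> \<open>Rounding up and subtracting 1, instead of rounding down, keeps d < r 2^(-j)
      strict when the logarithm is an integer, as the open ball requires.\<close>
    define j where "j = nat \<lceil>log 2 (r / d)\<rceil> - 1"
    have l: "0 < log 2 (r / d)" using d by simp
    then have c: "0 < \<lceil>log 2 (r / d)\<rceil>" by simp
    then have "real j = of_int \<lceil>log 2 (r / d)\<rceil> - 1" by (simp add: j_def) linarith
    then have j: "real j < log 2 (r / d)" "log 2 (r / d) \<le> real j + 1"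
      by linarith+
    have "2 powr (real j) < r / d" using j(1) d less_log_iff[of 2 "r / d" "real j"] by simp
    then have 1: "d < r * 2 powr (- real j)" using d by (simp add: powr_minus field_simps)
    have "r / d \<le> 2 powr (real j + 1)" using j(2) d log_le_iff[of 2 "r / d" "real j + 1"] by simp
    then have 2: "r * 2 powr (- real j) \<le> 2 * d" using d by (simp add: powr_minus powr_add field_simps)
    have "d powr (\<beta> - n) \<le> c * (r * 2 powr (- real j)) powr (\<beta> - n)"
    proof (cases "\<beta> \<ge> n")
      case True
      have "1 \<le> c" by (simp add: c_def ge_one_powr_ge_zero)
      moreover have "d powr (\<beta> - n) \<le> (r * 2 powr (- real j)) powr (\<beta> - n)"
        using 1 d True by (intro powr_mono2) auto
      ultimately show ?thesis
        by (metis mult_left_mono mult_1 mult_right_mono order_trans powr_ge_zero)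
    next
      case False
      have "d powr (\<beta> - n) \<le> (r * 2 powr (- real j) / 2) powr (\<beta> - n)"
        using 2 d False by (intro powr_mono2') auto
      also have "\<dots> = c * (r * 2 powr (- real j)) powr (\<beta> - n)"
        using d False by (simp add: powr_divide c_def powr_diff)
      finally show ?thesis .
    qed
    then have "ennreal (d powr (\<beta> - n)) \<le> ?g j y"
      using 1 by (auto simp: indicator_def dist_norm d_def intro: ennreal_leI)
    also have "\<dots> \<le> (\<Sum>j. ?g j y)"
      using sum_le_suminf[OF summableI, of "{j}" "\<lambda>j. ?g j y"] by (simp only: sum.insert finite.emptyI empty_iff sum.empty finite_insert not_False_eq_True add_0_right zero_le simp_thms)
    finally show ?thesis using True by (simp add: d_def)
  qed auto
  have "(\<integral>\<^sup>+y. indicator {y. norm (x - y) < r} y * ennreal (norm (x - y) powr (\<beta> - n)) \<partial>lebesgue)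
      \<le> (\<integral>\<^sup>+y. (\<Sum>j. ?g j y) \<partial>lebesgue)"
    by (intro nn_integral_mono pt)
  also have "\<dots> = (\<Sum>j. \<integral>\<^sup>+y. ?g j y \<partial>lebesgue)"
    by (intro nn_integral_suminf) measurable
  also have "\<dots> = (\<Sum>j. ennreal (unit_ball_vol n * c * r powr \<beta> * (2 powr (- \<beta>)) ^ j))"
  proof (intro suminf_cong)
    fix j :: nat
    have "(\<integral>\<^sup>+y. ?g j y \<partial>lebesgue) = ennreal (c * (r * 2 powr (- real j)) powr (\<beta> - n)) * emeasure lebesgue (ball x (r * 2 powr (- real j)))"
      by (subst mult.commute, subst nn_integral_cmult_indicator) auto
    also have "\<dots> = ennreal (c * (r * 2 powr (- real j)) powr (\<beta> - n) * (unit_ball_vol n * (r * 2 powr (- real j)) ^ DIM('a)))"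
      using assms by (simp add: emeasure_ball n_def ennreal_mult c_def)
    also have "c * (r * 2 powr (- real j)) powr (\<beta> - n) * (unit_ball_vol n * (r * 2 powr (- real j)) ^ DIM('a))
       = unit_ball_vol n * c * (r * 2 powr (- real j)) powr \<beta>"
      using assms by (simp add: powr_realpow[symmetric] powr_diff n_def)
    also have "(r * 2 powr (- real j)) powr \<beta> = r powr \<beta> * (2 powr (- \<beta>)) ^ j"
      using assms by (simp add: powr_mult powr_powr powr_realpow[symmetric] mult.commute)
    finally show "(\<integral>\<^sup>+y. ?g j y \<partial>lebesgue) = ennreal (unit_ball_vol n * c * r powr \<beta> * (2 powr (- \<beta>)) ^ j)"
      by (simp add: mult_ac)
  qed
  also have "\<dots> = ennreal (\<Sum>j. unit_ball_vol n * c * r powr \<beta> * (2 powr (- \<beta>)) ^ j)"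
    using assms by (intro suminf_ennreal2 summable_mult summable_geometric) (auto simp: n_def c_def powr_less_one)
  also have "(\<Sum>j. unit_ball_vol n * c * r powr \<beta> * (2 powr (- \<beta>)) ^ j) = unit_ball_vol n * c * r powr \<beta> * (1 / (1 - 2 powr (- \<beta>)))"
    using powr_less_one[of 2 "- \<beta>"] assms by (subst suminf_mult) (auto simp: suminf_geometric intro!: summable_geometric)
  finally show ?thesis by (simp add: n_def c_def mult_ac)
qed

section \<open>Pointwise inequalities for truncations\<close>

text \<open>The tangent of the convex function x^m at an interior point \<open>b\<close>, evaluated
  at \<open>a\<close>; at zero both sides are compared directly.\<close>

lemma powr_tangent_le:
  fixes a b m :: real
  assumes "0 \<le> a" "0 \<le> b" "1 \<le> m"
  shows "b powr m - a powr m \<le> m * b powr (m - 1) * (b - a)"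
proof (cases "a = 0 \<or> b = 0")
  case True
  have "b * b powr (m - 1) = b powr m"
    using assms by (cases "b = 0") (auto simp: powr_mult_base)
  then show ?thesis using True assms mult_right_mono[of 1 m "b powr m"]
    by (auto simp: mult_ac)
next
  case False
  then have "a powr m - b powr m \<ge> m * b powr (m - 1) * (a - b)"
    using assms
    by (intro convex_on_imp_above_tangent[OF powr_convex])
       (auto intro!: derivative_eq_intros simp: interior_open)
  then show ?thesis by (simp add: algebra_simps)
qed

lemma powr_add_le_powr:
  fixes a b m :: real
  assumes "0 \<le> a" "0 \<le> b" "1 \<le> m"
  shows "a powr m + b powr m \<le> (a + b) powr m"
proof -
  have *: "c powr m \<le> c * (a + b) powr (m - 1)" if "0 \<le> c" "c \<le> a + b" for c
  proof -
    have "c powr m = c * c powr (m - 1)" using that by (simp add: powr_mult_base)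
    also have "\<dots> \<le> c * (a + b) powr (m - 1)"
      using that assms by (intro mult_left_mono powr_mono2) auto
    finally show ?thesis .
  qed
  have "a powr m + b powr m \<le> (a + b) * (a + b) powr (m - 1)"
    using *[of a] *[of b] assms by (simp add: algebra_simps)
  then show ?thesis using assms by (cases "a + b = 0") (auto simp: powr_mult_base)
qed

text \<open>Zero arguments, on the boundary of the half line, are settled by (s c)^m <= s c^m for 0
  <= s <= 1.\<close>

lemma abs_powr_convex:
  fixes a b t m :: real
  assumes "0 \<le> t" "t \<le> 1" "1 \<le> m"
  shows "\<bar>(1 - t) * a + t * b\<bar> powr m \<le> (1 - t) * \<bar>a\<bar> powr m + t * \<bar>b\<bar> powr m"
proof -
  have sc: "(s * c) powr m \<le> s * c powr m" if "0 \<le> s" "s \<le> 1" "0 \<le> c" for s c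
    using that assms powr_mono'[of 1 m s] by (auto simp: powr_mult intro!: mult_right_mono)
  have "\<bar>(1 - t) * a + t * b\<bar> \<le> \<bar>(1 - t) * a\<bar> + \<bar>t * b\<bar>" by (rule abs_triangle_ineq)
  then have "\<bar>(1 - t) * a + t * b\<bar> powr m \<le> ((1 - t) * \<bar>a\<bar> + t * \<bar>b\<bar>) powr m"
    using assms by (intro powr_mono2) (auto simp: abs_mult)
  also have "\<dots> \<le> (1 - t) * \<bar>a\<bar> powr m + t * \<bar>b\<bar> powr m"
  proof (cases "a = 0 \<or> b = 0")
    case True
    then show ?thesis using sc[of t "\<bar>b\<bar>"] sc[of "1 - t" "\<bar>a\<bar>"] assms by auto
  next
    case False
    then show ?thesis
      using convex_onD[OF powr_convex[OF assms(3)], of t "\<bar>a\<bar>" "\<bar>b\<bar>"] assms by simp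
  qed
  finally show ?thesis .
qed

text \<open>With \<open>\<phi> = \<eta>\<^sup>q\<close> the increment on the left is the convex combination, with weights \<open>1 - \<phi> x\<close> and \<open>\<phi> x\<close>, of
  \<open>w x - w y\<close> and \<open>- (\<phi> x - \<phi> y) w y / \<phi> x\<close>; the power \<open>q\<close> compensates the division by \<open>\<phi> x\<close>.\<close>
lemma cutoff_difference_le:
  fixes wx wy ex ey m q :: real
  assumes "0 \<le> ey" "ey \<le> ex" "ex \<le> 1" "0 \<le> wx" "0 \<le> wy" "1 \<le> m" "m \<le> q"
  shows "\<bar>(1 - ex powr q) * wx - (1 - ey powr q) * wy\<bar> powr m + ex powr q * \<bar>wx - wy\<bar> powr m
    \<le> \<bar>wx - wy\<bar> powr m + q powr m * \<bar>ex - ey\<bar> powr m * wy powr m"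
proof (cases "ex = 0")
  case True
  then show ?thesis using assms by auto
next
  case False
  define t where "t = ex powr q"
  define d where "d = ex powr q - ey powr q"
  have ex: "0 < ex" using False assms by auto
  have t: "0 < t" "t \<le> 1" using assms ex by (auto simp: t_def powr_le1)
  have d0: "0 \<le> d" using assms by (auto simp: d_def intro!: powr_mono2)
  have d: "d \<le> q * ex powr (q - 1) * (ex - ey)"
    using powr_tangent_le[of ey ex q] assms by (simp add: d_def)
  have "\<bar>(1 - ex powr q) * wx - (1 - ey powr q) * wy\<bar> = \<bar>(1 - t) * (wx - wy) + t * (- (d / t * wy))\<bar>"
  proof -
    have "t * (d / t * wy) = d * wy" using t by simp
    then show ?thesis by (simp add: t_def[symmetric] d_def algebra_simps)
  qed
  also have "\<dots> powr m \<le> (1 - t) * \<bar>wx - wy\<bar> powr m + t * \<bar>- (d / t * wy)\<bar> powr m"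
    using t assms by (intro abs_powr_convex) auto
  also have "t * \<bar>- (d / t * wy)\<bar> powr m \<le> q powr m * \<bar>ex - ey\<bar> powr m * wy powr m"
  proof -
    have "d / t \<le> q * (ex - ey) / ex"
      using d t ex by (simp add: t_def powr_diff field_simps)
    then have "(d / t) powr m \<le> (q * (ex - ey) / ex) powr m"
      using d0 t assms by (intro powr_mono2) auto
    also have "\<dots> = q powr m * (ex - ey) powr m / ex powr m"
      using assms by (simp add: powr_mult powr_divide)
    finally have "t * (d / t) powr m \<le> t * (q powr m * (ex - ey) powr m / ex powr m)"
      using t by (intro mult_left_mono) auto
    also have "\<dots> = ex powr (q - m) * (q powr m * (ex - ey) powr m)"
      using ex by (simp add: t_def powr_diff)
    also have "\<dots> \<le> 1 * (q powr m * (ex - ey) powr m)"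
      using ex assms by (intro mult_right_mono powr_le1) auto
    finally have "t * (d / t) powr m * wy powr m \<le> q powr m * (ex - ey) powr m * wy powr m"
      by (intro mult_right_mono) auto
    moreover have "\<bar>- (d / t * wy)\<bar> = d / t * wy" using assms d0 t by simp
    moreover have "\<bar>ex - ey\<bar> = ex - ey" using assms by simp
    ultimately show ?thesis by (simp only: powr_mult mult.assoc)
  qed
  finally show ?thesis by (simp add: t_def algebra_simps)
qed

text \<open>The case of one point above the level \<open>k\<close> and one below, with
  \<open>U\<close> the increment of \<open>u\<close>. Lowering by t w moves \<open>U\<close> towards
  U - w with weight t, and superadditivity, (U - w)^m + w^m <= U^m, leaves t w^m as surplus. No
  error term arises.\<close>

lemma truncation_crossing_le:
  fixes U w t m :: real
  assumes "0 \<le> w" "w \<le> U" "0 \<le> t" "t \<le> 1" "1 \<le> m"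
  shows "\<bar>U - t * w\<bar> powr m + t * w powr m \<le> U powr m"
proof -
  have "\<bar>U - t * w\<bar> powr m = \<bar>(1 - t) * U + t * (U - w)\<bar> powr m" by (simp add: algebra_simps)
  also have "\<dots> \<le> (1 - t) * \<bar>U\<bar> powr m + t * \<bar>U - w\<bar> powr m"
    using assms by (intro abs_powr_convex) auto
  finally have "\<bar>U - t * w\<bar> powr m + t * w powr m \<le> (1 - t) * U powr m + t * ((U - w) powr m + w powr m)"
    using assms by (simp add: algebra_simps)
  also have "\<dots> \<le> (1 - t) * U powr m + t * U powr m"
    using powr_add_le_powr[of "U - w" w m] assms by (intro add_left_mono mult_left_mono) auto
  finally show ?thesis by (simp add: algebra_simps)
qed

text \<open>Source of the gain: where both cutoff values are 1, the full increment of
  \<open>w\<close> appears on the left. An error arises only if both points lie above the level;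
  \<open>cutoff_difference_le\<close> is then based at the point with the larger cutoff value, and
  the minimum and the sum make the result symmetric.\<close>

lemma truncation_pair_le:
  fixes ux uy k ex ey m q :: real
  defines "wx \<equiv> max (ux - k) 0" and "wy \<equiv> max (uy - k) 0"
  assumes e: "0 \<le> ex" "ex \<le> 1" "0 \<le> ey" "ey \<le> 1" and m: "1 \<le> m" "m \<le> q"
  shows "\<bar>(ux - ex powr q * wx) - (uy - ey powr q * wy)\<bar> powr m + min (ex powr q) (ey powr q) * \<bar>wx - wy\<bar> powr m
    \<le> \<bar>ux - uy\<bar> powr m + q powr m * \<bar>ex - ey\<bar> powr m * (wx powr m + wy powr m)"
proof -
  have e1: "ex powr q \<le> 1" "ey powr q \<le> 1" using e m by (auto intro!: powr_le1)
  have nn: "0 \<le> q powr m * \<bar>ex - ey\<bar> powr m * wx powr m" "0 \<le> q powr m * \<bar>ex - ey\<bar> powr m * wy powr m"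
    by auto
  consider "ux > k" "uy > k" | "ux > k" "uy \<le> k" | "ux \<le> k" "uy > k" | "ux \<le> k" "uy \<le> k" by linarith
  then show ?thesis
  proof cases
    case 1
    then have w: "wx = ux - k" "wy = uy - k" by (auto simp: wx_def wy_def)
    have eq: "(ux - ex powr q * wx) - (uy - ey powr q * wy) = (1 - ex powr q) * wx - (1 - ey powr q) * wy"
      "ux - uy = wx - wy"
      by (auto simp: w algebra_simps)
    have wnn: "0 \<le> wx" "0 \<le> wy" by (auto simp: wx_def wy_def)
    show ?thesis unfolding eq
    proof (cases "ey \<le> ex")
      case True
      have "min (ex powr q) (ey powr q) * \<bar>wx - wy\<bar> powr m \<le> ex powr q * \<bar>wx - wy\<bar> powr m"
        by (intro mult_right_mono) auto
      with nn show "\<bar>(1 - ex powr q) * wx - (1 - ey powr q) * wy\<bar> powr m + min (ex powr q) (ey powr q) * \<bar>wx - wy\<bar> powr m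
        \<le> \<bar>wx - wy\<bar> powr m + q powr m * \<bar>ex - ey\<bar> powr m * (wx powr m + wy powr m)"
        using cutoff_difference_le[of ey ex wx wy m q] True e m wnn unfolding distrib_left by linarith
    next
      case False
      have "min (ex powr q) (ey powr q) * \<bar>wx - wy\<bar> powr m \<le> ey powr q * \<bar>wx - wy\<bar> powr m"
        by (intro mult_right_mono) auto
      with nn show "\<bar>(1 - ex powr q) * wx - (1 - ey powr q) * wy\<bar> powr m + min (ex powr q) (ey powr q) * \<bar>wx - wy\<bar> powr m
        \<le> \<bar>wx - wy\<bar> powr m + q powr m * \<bar>ex - ey\<bar> powr m * (wx powr m + wy powr m)"
        using cutoff_difference_le[of ex ey wy wx m q] False e m wnn
        unfolding distrib_left abs_minus_commute[of "(1 - ey powr q) * wy"] abs_minus_commute[of wy wx] abs_minus_commute[of ey ex]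
        by linarith
    qed
  next
    case 2
    then have w: "wx = ux - k" "wy = 0" by (auto simp: wx_def wy_def)
    have "\<bar>(ux - uy) - ex powr q * wx\<bar> powr m + ex powr q * wx powr m \<le> (ux - uy) powr m"
      using 2 w e1 m by (intro truncation_crossing_le) auto
    moreover have "min (ex powr q) (ey powr q) * wx powr m \<le> ex powr q * wx powr m"
      by (intro mult_right_mono) auto
    moreover have eq: "\<bar>wx - wy\<bar> = wx" "\<bar>ux - uy\<bar> = ux - uy" "(ux - ex powr q * wx) - (uy - ey powr q * wy) = (ux - uy) - ex powr q * wx" using 2 w by auto
    ultimately show ?thesis using nn unfolding eq distrib_left by linarith
  next
    case 3
    then have w: "wx = 0" "wy = uy - k" by (auto simp: wx_def wy_def)
    have "\<bar>(uy - ux) - ey powr q * wy\<bar> powr m + ey powr q * wy powr m \<le> (uy - ux) powr m"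
      using 3 w e1 m by (intro truncation_crossing_le) auto
    moreover have "min (ex powr q) (ey powr q) * wy powr m \<le> ey powr q * wy powr m"
      by (intro mult_right_mono) auto
    moreover have eq: "\<bar>wx - wy\<bar> = wy" "\<bar>ux - uy\<bar> = uy - ux" "(ux - ex powr q * wx) - (uy - ey powr q * wy) = - ((uy - ux) - ey powr q * wy)"
      using 3 w by auto
    ultimately show ?thesis using nn unfolding eq distrib_left abs_minus_cancel by linarith
  next
    case 4
    then have "wx = 0" "wy = 0" by (auto simp: wx_def wy_def)
    then show ?thesis by simp
  qed
qed

text \<open>Here the cutoff vanishes at the second point. Lowering the value at the first point
  enlarges the increment only if it ends up below \<open>uy\<close>, and then by an amount linear in
  \<open>wx\<close>. This linearity is why the tail is later multiplied by the integral of
  \<open>w\<close> itself.\<close>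

lemma truncation_outer_le:
  fixes ux uy k t m :: real
  defines "wx \<equiv> max (ux - k) 0" and "wy \<equiv> max (uy - k) 0"
  assumes t: "0 \<le> t" "t \<le> 1" and m: "1 \<le> m"
  shows "\<bar>(ux - t * wx) - uy\<bar> powr m \<le> \<bar>ux - uy\<bar> powr m + m * wx * wy powr (m - 1)"
proof -
  have nn: "0 \<le> m * wx * wy powr (m - 1)" using m by (auto simp: wx_def)
  have wnn: "0 \<le> wx" "0 \<le> wy" by (auto simp: wx_def wy_def)
  have txw: "0 \<le> t * wx" "t * wx \<le> wx" using t wnn mult_right_mono[of t 1 wx] by auto
  have mono: ?thesis if "\<bar>(ux - t * wx) - uy\<bar> \<le> \<bar>ux - uy\<bar>"
  proof -
    have "\<bar>(ux - t * wx) - uy\<bar> powr m \<le> \<bar>ux - uy\<bar> powr m" using that m by (intro powr_mono2) auto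
    then show ?thesis using nn by linarith
  qed
  consider "ux \<le> k" | "uy \<le> k" "ux > k" | "ux > k" "uy > k" by linarith
  then show ?thesis
  proof cases
    case 1
    then have "wx = 0" by (simp add: wx_def)
    then show ?thesis by simp
  next
    case 2
    then have "wx = ux - k" by (simp add: wx_def)
    then have "\<bar>(ux - t * wx) - uy\<bar> \<le> \<bar>ux - uy\<bar>" using 2 txw by linarith
    then show ?thesis by (rule mono)
  next
    case 3
    then have w: "wx = ux - k" "wy = uy - k" by (auto simp: wx_def wy_def)
    \<comment> \<open>\<open>b\<close> is the height of \<open>uy\<close> above the lowered value at
      the first point; for b <= 0 the increment has only shrunk.\<close>
    define b where "b = wy - (wx - t * wx)"
    have V: "(ux - t * wx) - uy = - b" by (simp add: b_def w)
    show ?thesis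
    proof (cases "b \<le> 0")
      case True
      then have "\<bar>(ux - t * wx) - uy\<bar> \<le> \<bar>ux - uy\<bar>" using txw w V b_def by linarith
      then show ?thesis by (rule mono)
    next
      case b: False
      have bw: "b \<le> wy" using txw by (simp add: b_def)
      show ?thesis
      proof (cases "wx \<le> wy")
        case True
        have "b powr m - (wy - wx) powr m \<le> m * b powr (m - 1) * (b - (wy - wx))"
          using True b m by (intro powr_tangent_le) auto
        also have "\<dots> = m * b powr (m - 1) * (t * wx)" by (simp add: b_def)
        also have "\<dots> \<le> m * wy powr (m - 1) * wx"
          using b bw m txw by (intro mult_mono powr_mono2) auto
        finally have "b powr m \<le> (wy - wx) powr m + m * wx * wy powr (m - 1)" by (simp add: mult_ac)
        moreover have "\<bar>ux - uy\<bar> = wy - wx" "\<bar>(ux - t * wx) - uy\<bar> = b" using True b V w by auto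
        ultimately show ?thesis by simp
      next
        case False
        have "b powr m = b * b powr (m - 1)" using b by (simp add: powr_mult_base)
        also have "\<dots> \<le> wx * wy powr (m - 1)"
          using b bw m False by (intro mult_mono powr_mono2) auto
        also have "\<dots> \<le> m * (wx * wy powr (m - 1))"
          using m wnn mult_right_mono[of 1 m "wx * wy powr (m - 1)"] by simp
        finally have "b powr m \<le> m * wx * wy powr (m - 1)" by (simp add: mult_ac)
        moreover have "\<bar>(ux - t * wx) - uy\<bar> = b" using b V by auto
        ultimately show ?thesis by (simp add: add_increasing)
      qed
    qed
  qed
qed

section \<open>The Gagliardo seminorm of functions with small support\<close>

text \<open>For \<open>x\<close> in a ball \<open>B\<close>, the homothetic copy of \<open>B\<close> with centre \<open>x\<close> and twice the measure of
  \<open>A\<close> has at least half of its points outside \<open>A\<close>; there \<open>f\<close> vanishes, so \<open>\<bar>f x\<bar>\<close> is an increment of \<open>f\<close>.\<close>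
lemma small_support_pointwise:
  fixes f :: "'a::euclidean_space \<Rightarrow> real" and x0 :: 'a
  assumes r: "0 < r" and \<sigma>: "0 < \<sigma>" and m: "0 < m" and x: "x \<in> ball x0 r"
    and A: "A \<in> sets lebesgue" "A \<subseteq> ball x0 r" "2 * measure lebesgue A \<le> measure lebesgue (ball x0 r)"
    and f0: "\<And>y. y \<in> ball x0 r \<Longrightarrow> y \<notin> A \<Longrightarrow> f y = 0"
    and [measurable]: "f \<in> borel_measurable lebesgue"
    and pos: "0 < measure lebesgue A"
  shows "ennreal (\<bar>f x\<bar> powr m * measure lebesgue A)
    \<le> ennreal ((2 * r) powr (real DIM('a) + \<sigma>) * (2 * measure lebesgue A / measure lebesgue (ball x0 r)) powr (1 + \<sigma> / real DIM('a)))
      * (\<integral>\<^sup>+y. indicator (ball x0 r) y * ennreal (\<bar>f x - f y\<bar> powr m / norm (x - y) powr (real DIM('a) + \<sigma>)) \<partial>lebesgue)"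
proof -
  let ?n = "real DIM('a)" and ?B = "ball x0 r" and ?\<mu> = "measure (lebesgue :: 'a measure)"
  define b where "b = 2 * ?\<mu> A / ?\<mu> ?B"
  have B: "0 < ?\<mu> ?B" using r by simp
  have b: "0 < b" "b \<le> 1" using pos B A by (auto simp: b_def)
  \<comment> \<open>The ratio of the homothety: th^n = b gives the image twice the measure of
    \<open>A\<close>. That th <= 1, so that the image stays in the ball, is the half-measure
    hypothesis.\<close>
  define th where "th = b powr (1 / ?n)"
  have th: "0 < th" "th \<le> 1" using b by (auto simp: th_def powr_le1)
  have thn: "th ^ DIM('a) = b" using b by (simp add: th_def powr_realpow[symmetric] powr_powr)
  define E where "E = (\<lambda>y. th *\<^sub>R y + (1 - th) *\<^sub>R x) ` ?B"
  have EB: "E \<subseteq> ?B"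
  proof
    fix y assume "y \<in> E"
    then obtain z where "z \<in> ?B" "y = (1 - th) *\<^sub>R x + th *\<^sub>R z" by (auto simp: E_def add.commute)
    then show "y \<in> ?B"
      using convexD_alt[OF convex_ball x, of z th] th by simp
  qed
  have Ed: "norm (x - y) \<le> th * (2 * r)" if y: "y \<in> E" for y
  proof -
    obtain z where z: "z \<in> ?B" "y = th *\<^sub>R z + (1 - th) *\<^sub>R x" using y unfolding E_def by blast
    then have "x - y = th *\<^sub>R (x - z)" by (simp add: algebra_simps)
    moreover have "norm (x - z) \<le> 2 * r"
      using x z(1) dist_triangle[of x z x0] by (simp add: dist_norm norm_minus_commute)
    ultimately show ?thesis using th by simp
  qed
  have Em: "E \<in> sets lebesgue"
    unfolding E_def using open_affinity[OF open_ball, of th "(1 - th) *\<^sub>R x" x0 r] th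
    by (simp add: add.commute)
  have "emeasure lebesgue E = ennreal (th ^ DIM('a)) * emeasure lebesgue ?B"
    unfolding E_def using th by (subst emeasure_lebesgue_affine) (simp add: ennreal_power[symmetric])
  also have "\<dots> = ennreal (2 * ?\<mu> A)"
    using B b unfolding thn by (subst emeasure_eq_measure2) (auto simp: b_def ennreal_mult[symmetric])
  finally have Eeq: "emeasure lebesgue E = ennreal (2 * ?\<mu> A)" .
  have Aeq: "emeasure lebesgue A = ennreal (?\<mu> A)"
    using pos by (intro emeasure_eq_ennreal_measure) (auto simp: measure_def)
  have "emeasure lebesgue E \<le> emeasure lebesgue ((E - A) \<union> A)"
    using Em A by (intro emeasure_mono) auto
  also have "\<dots> \<le> emeasure lebesgue (E - A) + emeasure lebesgue A"
    using Em A by (intro emeasure_subadditive) auto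
  finally have "ennreal (2 * ?\<mu> A) \<le> emeasure lebesgue (E - A) + ennreal (?\<mu> A)"
    unfolding Eeq Aeq .
  then have "ennreal (?\<mu> A) \<le> emeasure lebesgue (E - A)"
    by (cases "emeasure lebesgue (E - A)") (auto simp: ennreal_plus[symmetric] simp del: ennreal_plus)
  then have "ennreal (\<bar>f x\<bar> powr m * ?\<mu> A) \<le> (\<integral>\<^sup>+y. ennreal (\<bar>f x\<bar> powr m) * indicator (E - A) y \<partial>lebesgue)"
    using A Em by (subst nn_integral_cmult_indicator) (auto simp: ennreal_mult intro: mult_left_mono)
  also have "\<dots> \<le> (\<integral>\<^sup>+y. ennreal ((th * (2 * r)) powr (?n + \<sigma>)) * (indicator ?B y * ennreal (\<bar>f x - f y\<bar> powr m / norm (x - y) powr (?n + \<sigma>))) \<partial>lebesgue)"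
  proof (intro nn_integral_mono)
    fix y
    show "ennreal (\<bar>f x\<bar> powr m) * indicator (E - A) y \<le> ennreal ((th * (2 * r)) powr (?n + \<sigma>)) * (indicator ?B y * ennreal (\<bar>f x - f y\<bar> powr m / norm (x - y) powr (?n + \<sigma>)))"
    proof (cases "y \<in> E - A")
      case True
      then have y: "y \<in> ?B" "f y = 0" using EB f0 by auto
      have "\<bar>f x\<bar> powr m \<le> (th * (2 * r)) powr (?n + \<sigma>) * (\<bar>f x - f y\<bar> powr m / norm (x - y) powr (?n + \<sigma>))"
      proof (cases "x = y")
        case False
        have "norm (x - y) powr (?n + \<sigma>) \<le> (th * (2 * r)) powr (?n + \<sigma>)"
          using Ed[of y] True \<sigma> by (intro powr_mono2) auto
        then show ?thesis using y(2) False by (simp add: field_simps mult_left_mono)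
      qed (use y m in auto)
      then show ?thesis
        using y True by (simp add: ennreal_mult[symmetric] ennreal_leI)
    qed auto
  qed
  also have "\<dots> = ennreal ((th * (2 * r)) powr (?n + \<sigma>)) * (\<integral>\<^sup>+y. indicator ?B y * ennreal (\<bar>f x - f y\<bar> powr m / norm (x - y) powr (?n + \<sigma>)) \<partial>lebesgue)"
    by (intro nn_integral_cmult) measurable
  also have "(th * (2 * r)) powr (?n + \<sigma>) = (2 * r) powr (?n + \<sigma>) * b powr (1 + \<sigma> / ?n)"
    using th r b by (simp add: powr_mult th_def powr_powr add_divide_distrib)
  finally show ?thesis unfolding b_def .
qed

text \<open>The m-th power of the W^(\<sigma>/m, m) seminorm. Taking \<sigma> as parameter treats
  the orders s p and t q alike; on the diagonal the quotient is 0 by the convention for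
  division.\<close>

definition gagliardo :: "real \<Rightarrow> real \<Rightarrow> 'a::euclidean_space set \<Rightarrow> ('a \<Rightarrow> real) \<Rightarrow> ennreal" where
  "gagliardo m \<sigma> B f = (\<integral>\<^sup>+z. indicator (B \<times> B) z *
     ennreal (\<bar>f (fst z) - f (snd z)\<bar> powr m / norm (fst z - snd z) powr (real DIM('a) + \<sigma>)) \<partial>lebesgue)"

text \<open>The pointwise bound is integrated over the ball and divided by the measure of
  \<open>A\<close>, which lowers the exponent 1 + \<sigma>/n to \<sigma>/n; r^(n + \<sigma>) over
  the volume of the ball leaves r^\<sigma>. The remaining positive power of the relative measure of
  the support drives both iterations. If \<open>A\<close> is null, \<open>f\<close> vanishes almost
  everywhere on the ball.\<close>

lemma small_support_integral:
  fixes f :: "'a::euclidean_space \<Rightarrow> real" and x0 :: 'a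
  assumes r: "0 < r" and \<sigma>: "0 < \<sigma>" and m: "0 < m"
    and A: "A \<in> sets lebesgue" "A \<subseteq> ball x0 r" "2 * measure lebesgue A \<le> measure lebesgue (ball x0 r)"
    and f0: "\<And>y. y \<in> ball x0 r \<Longrightarrow> y \<notin> A \<Longrightarrow> f y = 0"
    and f[measurable]: "f \<in> borel_measurable lebesgue"
  shows "(\<integral>\<^sup>+x. indicator (ball x0 r) x * ennreal (\<bar>f x\<bar> powr m) \<partial>lebesgue)
    \<le> ennreal (2 powr (real DIM('a) + \<sigma> + 1 + \<sigma> / real DIM('a)) / unit_ball_vol (real DIM('a)) * r powr \<sigma>
        * (measure lebesgue A / measure lebesgue (ball x0 r)) powr (\<sigma> / real DIM('a))) * gagliardo m \<sigma> (ball x0 r) f"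
proof -
  let ?n = "real DIM('a)" and ?B = "ball x0 r" and ?\<mu> = "measure (lebesgue :: 'a measure)"
  let ?c = "2 powr (?n + \<sigma> + 1 + \<sigma> / ?n) / unit_ball_vol ?n * r powr \<sigma> * (?\<mu> A / ?\<mu> ?B) powr (\<sigma> / ?n)"
  let ?F = "\<lambda>z. \<bar>f (fst z) - f (snd z)\<bar> powr m / norm (fst z - snd z) powr (?n + \<sigma>)"
  have v: "0 < unit_ball_vol ?n" by simp
  have B: "?\<mu> ?B = unit_ball_vol ?n * r powr ?n"
    using r by (simp add: content_ball powr_realpow)
  have em_A: "emeasure lebesgue A \<noteq> \<infinity>"
  proof -
    have "emeasure lebesgue A \<le> emeasure lebesgue ?B" using A(2) by (intro emeasure_mono) auto
    also have "\<dots> < \<infinity>" using r by (simp add: emeasure_ball)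
    finally show ?thesis by simp
  qed
  show ?thesis
  proof (cases "?\<mu> A = 0")
    case True
    have "emeasure lebesgue A = ennreal (?\<mu> A)"
      using em_A by (intro emeasure_eq_ennreal_measure) simp
    then have "A \<in> null_sets lebesgue"
      unfolding True by (intro null_setsI A(1)) simp
    then have "AE x in lebesgue. x \<notin> A" by (rule AE_not_in)
    then have "AE x in lebesgue. indicator ?B x * ennreal (\<bar>f x\<bar> powr m) = 0"
      by eventually_elim (use f0 m in \<open>auto simp: indicator_def\<close>)
    then have "(\<integral>\<^sup>+x. indicator ?B x * ennreal (\<bar>f x\<bar> powr m) \<partial>lebesgue) = (\<integral>\<^sup>+x. 0 \<partial>(lebesgue :: 'a measure))"
      by (rule nn_integral_cong_AE)
    then show ?thesis by simp
  next
    case False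
    then have pos: "0 < ?\<mu> A" by (simp add: zero_less_measure_iff)
    define c1 where "c1 = (2 * r) powr (?n + \<sigma>) * (2 * ?\<mu> A / ?\<mu> ?B) powr (1 + \<sigma> / ?n)"
    have c1: "c1 / ?\<mu> A = ?c"
    proof -
      define e where "e = \<sigma> / ?n"
      have "?\<mu> ?B > 0" using r by simp
      then have \<beta>: "0 < ?\<mu> A / ?\<mu> ?B" using pos by simp
      have "(2 * ?\<mu> A / ?\<mu> ?B) powr (1 + e) = (2 * (?\<mu> A / ?\<mu> ?B)) powr (1 + e)" by simp
      also have "\<dots> = 2 * (?\<mu> A / ?\<mu> ?B) * (2 powr e * (?\<mu> A / ?\<mu> ?B) powr e)"
        unfolding powr_add powr_mult using \<beta> by simp
      finally have "c1 / ?\<mu> A = (2 * r) powr (?n + \<sigma>) * (2 * (?\<mu> A / ?\<mu> ?B) * (2 powr e * (?\<mu> A / ?\<mu> ?B) powr e)) / ?\<mu> A"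
        by (simp add: c1_def e_def)
      also have "\<dots> = (2 * r) powr (?n + \<sigma>) * 2 / ?\<mu> ?B * 2 powr e * (?\<mu> A / ?\<mu> ?B) powr e"
        using pos by simp
      also have "(2 * r) powr (?n + \<sigma>) * 2 / ?\<mu> ?B * 2 powr e = 2 powr (?n + \<sigma> + 1 + e) / unit_ball_vol ?n * r powr \<sigma>"
        using r v unfolding B by (simp add: powr_mult powr_add field_simps)
      finally show ?thesis by (simp add: e_def)
    qed
    have pt: "indicator ?B x * ennreal (\<bar>f x\<bar> powr m) \<le> (\<integral>\<^sup>+y. ennreal ?c * (indicator (?B \<times> ?B) (x, y) * ennreal (?F (x, y))) \<partial>lebesgue)" for x
    proof (cases "x \<in> ?B")
      case True
      have "ennreal (\<bar>f x\<bar> powr m) = ennreal (1 / ?\<mu> A) * ennreal (\<bar>f x\<bar> powr m * ?\<mu> A)"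
        using pos by (simp add: ennreal_mult[symmetric])
      also have "\<dots> \<le> ennreal (1 / ?\<mu> A) * (ennreal c1 * (\<integral>\<^sup>+y. indicator ?B y * ennreal (\<bar>f x - f y\<bar> powr m / norm (x - y) powr (?n + \<sigma>)) \<partial>lebesgue))"
        unfolding c1_def by (intro mult_left_mono small_support_pointwise[OF r \<sigma> m True A f0 f pos]) auto
      also have "\<dots> = ennreal ?c * (\<integral>\<^sup>+y. indicator ?B y * ennreal (\<bar>f x - f y\<bar> powr m / norm (x - y) powr (?n + \<sigma>)) \<partial>lebesgue)"
        unfolding c1[symmetric] using pos by (simp add: mult.assoc[symmetric] ennreal_mult[symmetric] c1_def)
      also have "\<dots> = (\<integral>\<^sup>+y. ennreal ?c * (indicator (?B \<times> ?B) (x, y) * ennreal (?F (x, y))) \<partial>lebesgue)"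
        using True by (subst nn_integral_cmult[symmetric]) (auto simp: indicator_def intro!: nn_integral_cong)
      finally show ?thesis using True by simp
    qed auto
    have [measurable]: "Measurable.pred lebesgue (\<lambda>z. z \<in> ?B \<times> ?B)"
      unfolding mem_Times_iff by measurable
    have "(\<integral>\<^sup>+x. indicator ?B x * ennreal (\<bar>f x\<bar> powr m) \<partial>lebesgue)
        \<le> (\<integral>\<^sup>+x. \<integral>\<^sup>+y. ennreal ?c * (indicator (?B \<times> ?B) (x, y) * ennreal (?F (x, y))) \<partial>lebesgue \<partial>lebesgue)"
      by (intro nn_integral_mono pt)
    also have "\<dots> = (\<integral>\<^sup>+z. ennreal ?c * (indicator (?B \<times> ?B) z * ennreal (?F z)) \<partial>lebesgue)"
      by (rule nn_integral_lebesgue_iterated(1)[symmetric]) measurable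
    also have "\<dots> = ennreal ?c * gagliardo m \<sigma> ?B f"
      unfolding gagliardo_def by (intro nn_integral_cmult) measurable
    finally show ?thesis .
  qed
qed

text \<open>If \<open>A\<close> fills more than half of the ball the second term on the right suffices.\<close>
lemma small_support_integral_any:
  fixes f :: "'a::euclidean_space \<Rightarrow> real" and x0 :: 'a
  assumes r: "0 < r" and \<sigma>: "0 < \<sigma>" and m: "0 < m" and \<delta>: "0 \<le> \<delta>" "\<delta> \<le> \<sigma> / real DIM('a)"
    and A: "A \<in> sets lebesgue" "A \<subseteq> ball x0 r"
    and f0: "\<And>y. y \<in> ball x0 r \<Longrightarrow> y \<notin> A \<Longrightarrow> f y = 0"
    and f[measurable]: "f \<in> borel_measurable lebesgue"
  shows "(\<integral>\<^sup>+x. indicator (ball x0 r) x * ennreal (\<bar>f x\<bar> powr m) \<partial>lebesgue)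
    \<le> ennreal ((2 powr (real DIM('a) + \<sigma> + 1 + \<sigma> / real DIM('a)) / unit_ball_vol (real DIM('a)) + 2 powr \<delta>)
        * (measure lebesgue A / measure lebesgue (ball x0 r)) powr \<delta>)
      * (ennreal (r powr \<sigma>) * gagliardo m \<sigma> (ball x0 r) f
          + (\<integral>\<^sup>+x. indicator (ball x0 r) x * ennreal (\<bar>f x\<bar> powr m) \<partial>lebesgue))"
    (is "?I \<le> ennreal ((?c + ?d) * ?\<beta> powr \<delta>) * (ennreal ?R * ?G + ?I)")
proof (cases "2 * measure lebesgue A \<le> measure lebesgue (ball x0 r)")
  case True
  have v: "0 < unit_ball_vol (real DIM('a))" by simp
  have B: "0 < measure lebesgue (ball x0 r)" using r by simp
  have \<beta>: "0 \<le> ?\<beta>" "?\<beta> \<le> 1"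
    using order_trans[OF _ True, of "measure lebesgue A"] B by (auto simp: divide_le_eq)
  have "?c * r powr \<sigma> * ?\<beta> powr (\<sigma> / real DIM('a)) \<le> (?c + ?d) * ?\<beta> powr \<delta> * ?R"
  proof -
    have "?c * ?\<beta> powr (\<sigma> / real DIM('a)) \<le> (?c + ?d) * ?\<beta> powr \<delta>"
      using v by (intro mult_mono powr_mono'[OF \<delta>(2) \<beta>]) auto
    then have "?c * ?\<beta> powr (\<sigma> / real DIM('a)) * ?R \<le> (?c + ?d) * ?\<beta> powr \<delta> * ?R"
      by (rule mult_right_mono) simp
    then show ?thesis by (simp only: mult_ac)
  qed
  then have "ennreal (?c * r powr \<sigma> * ?\<beta> powr (\<sigma> / real DIM('a))) * ?G \<le> ennreal ((?c + ?d) * ?\<beta> powr \<delta>) * (ennreal ?R * ?G)"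
    by (subst mult.assoc[symmetric], subst ennreal_mult[symmetric]) (auto intro!: mult_right_mono ennreal_leI simp: less_imp_le[OF v])
  also have "\<dots> \<le> ennreal ((?c + ?d) * ?\<beta> powr \<delta>) * (ennreal ?R * ?G + ?I)"
    by (intro mult_left_mono) auto
  finally show ?thesis
    using small_support_integral[OF r \<sigma> m A(1,2) True f0 f] by (rule order_trans[rotated])
next
  case False
  have v: "0 < unit_ball_vol (real DIM('a))" by simp
  have B: "0 < measure lebesgue (ball x0 r)" using r by simp
  have "1 \<le> (2 * ?\<beta>) powr \<delta>"
    using False B \<delta> by (intro ge_one_powr_ge_zero) (auto simp: field_simps)
  also have "\<dots> = ?d * ?\<beta> powr \<delta>" by (simp only: powr_mult)
  also have "\<dots> \<le> (?c + ?d) * ?\<beta> powr \<delta>" using v by (intro mult_right_mono) auto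
  finally have "1 \<le> ennreal ((?c + ?d) * ?\<beta> powr \<delta>)" by simp
  then have "1 * ?I \<le> ennreal ((?c + ?d) * ?\<beta> powr \<delta>) * (ennreal ?R * ?G + ?I)"
    by (intro mult_mono) auto
  then show ?thesis by simp
qed

section \<open>The Caccioppoli inequality\<close>

locale double_phase =
  fixes s t p q \<Lambda> A :: real and \<Omega> :: "(real^'n::finite) set"
    and Ksp Ktq a :: "real^'n \<Rightarrow> real^'n \<Rightarrow> real" and x0 :: "real^'n" and R :: real and u :: "real^'n \<Rightarrow> real"
  assumes st: "0 < s" "s < 1" "0 < t" "t < 1" and pq: "1 < p" "p \<le> q" and \<Lambda>: "1 \<le> \<Lambda>"
    and A: "0 \<le> A" and \<Omega>: "open \<Omega>" "ball x0 R \<subseteq> \<Omega>" and R: "0 < R"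
    and Ksp: "sym_kernel \<Lambda> (s * p) Ksp" and Ktq: "sym_kernel \<Lambda> (t * q) Ktq"
    and a_meas: "(\<lambda>z. a (fst z) (snd z)) \<in> borel_measurable lebesgue"
    and a_nonneg: "\<And>x y. 0 \<le> a x y"
    and a_sym: "AE z in lebesgue. a (fst z) (snd z) = a (snd z) (fst z)"
    and a_inf_nonneg: "0 \<le> a_inf a x0 R"
    and \<comment> \<open>The Hoelder case and the bounded case enter only through this bound.\<close>
      a_osc: "\<And>x y. x \<in> ball x0 R \<Longrightarrow> y \<in> ball x0 R \<Longrightarrow>
      a_inf a x0 R \<le> a x y \<and> a x y \<le> a_inf a x0 R + 4 * A * R powr (t * q - s * p)"
    and u_min: "minimizer s t p q Ksp Ktq a \<Omega> u"
begin

abbreviation "a0 \<equiv> a_inf a x0 R"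
abbreviation "H \<equiv> H_fun s t p q a x0 R"
abbreviation "T \<equiv> tail s t p q a (R / 2) R (pos_part u) x0"

lemma u_space: "u \<in> space_A s t p q a \<Omega>"
  using u_min by (simp add: minimizer_def)

lemma u_meas [measurable]: "u \<in> borel_measurable lebesgue"
  using u_space by (simp add: space_A_def)

lemma Ksp_meas [measurable]: "(\<lambda>z. Ksp (fst z) (snd z)) \<in> borel_measurable lebesgue"
  and Ktq_meas [measurable]: "(\<lambda>z. Ktq (fst z) (snd z)) \<in> borel_measurable lebesgue"
  using Ksp Ktq by (simp_all add: sym_kernel_def)

lemmas a_meas' [measurable] = a_meas

lemma sq_pos: "0 < s * p" "0 < t * q" "s * p < p" "t * q < q" "s * p \<le> q" "1 < q"
  using st pq by (auto intro: order_trans[of _ "1 * p"] mult_right_mono)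

lemma sym_kernelD:
  fixes K :: "real^'n \<Rightarrow> real^'n \<Rightarrow> real"
  assumes "sym_kernel \<Lambda> \<sigma> K"
  shows "K x y = K y x"
    and "x \<noteq> y \<Longrightarrow> 0 \<le> K x y"
    and "x \<noteq> y \<Longrightarrow> K x y \<le> \<Lambda> * norm (x - y) powr (- real CARD('n) - \<sigma>)"
    and "x \<noteq> y \<Longrightarrow> 1 / norm (x - y) powr (real CARD('n) + \<sigma>) \<le> \<Lambda> * K x y"
proof -
  show "K x y = K y x" using assms by (simp add: sym_kernel_def)
  assume xy: "x \<noteq> y"
  have 1: "inverse \<Lambda> * norm (x - y) powr (- real CARD('n) - \<sigma>) \<le> K x y" and 2: "K x y \<le> \<Lambda> * norm (x - y) powr (- real CARD('n) - \<sigma>)"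
    using assms xy by (auto simp: sym_kernel_def)
  show "K x y \<le> \<Lambda> * norm (x - y) powr (- real CARD('n) - \<sigma>)" by (rule 2)
  show "0 \<le> K x y" by (rule order_trans[OF _ 1]) (use \<Lambda> in auto)
  have "- real CARD('n) - \<sigma> = - (real CARD('n) + \<sigma>)" by simp
  then have "norm (x - y) powr (- real CARD('n) - \<sigma>) = 1 / norm (x - y) powr (real CARD('n) + \<sigma>)"
    by (simp only: powr_minus_divide)
  then show "1 / norm (x - y) powr (real CARD('n) + \<sigma>) \<le> \<Lambda> * K x y"
    using mult_left_mono[OF 1, of \<Lambda>] \<Lambda> by (simp add: mult.assoc[symmetric])
qed

lemmas KspD = sym_kernelD[OF Ksp] and KtqD = sym_kernelD[OF Ktq]

definition energy_density :: "(real^'n \<Rightarrow> real) \<Rightarrow> (real^'n) \<times> (real^'n) \<Rightarrow> real" where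
  "energy_density v z = \<bar>v (fst z) - v (snd z)\<bar> powr p * Ksp (fst z) (snd z)
     + a (fst z) (snd z) * \<bar>v (fst z) - v (snd z)\<bar> powr q * Ktq (fst z) (snd z)"

lemma energy_density_nonneg: "0 \<le> energy_density v z"
  using KspD(2)[of "fst z" "snd z"] KtqD(2)[of "fst z" "snd z"] a_nonneg pq
  by (cases "fst z = snd z") (auto simp: energy_density_def)

lemma energy_density_measurable [measurable]:
  assumes [measurable]: "v \<in> borel_measurable lebesgue"
  shows "energy_density v \<in> borel_measurable lebesgue"
  unfolding energy_density_def[abs_def] by measurable

lemma cross_dom_measurable [measurable]: "Measurable.pred lebesgue (\<lambda>z. z \<in> cross_dom \<Omega>)"
proof -
  have "(UNIV - \<Omega>) \<times> (UNIV - \<Omega>) \<in> sets borel"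
    using \<Omega>(1) by (intro borel_closed closed_Times) (auto simp: Compl_eq_Diff_UNIV[symmetric])
  then have "cross_dom \<Omega> \<in> sets borel" unfolding cross_dom_def by (intro sets.Diff) auto
  then show ?thesis by simp
qed

lemma energy_eq: "energy p q Ksp Ktq a \<Omega> v = (\<integral>\<^sup>+z. ennreal (indicator (cross_dom \<Omega>) z * energy_density v z) \<partial>lebesgue)"
  unfolding energy_def
  by (intro nn_integral_cong) (auto simp: energy_density_def indicator_def)

lemma space_A_double_eq:
  "(\<integral>\<^sup>+z\<in>cross_dom \<Omega>. (case z of (x, y) \<Rightarrow> ennreal (
          \<bar>v x - v y\<bar> powr p / norm (x - y) powr (real CARD('n) + s * p)
        + a x y * (\<bar>v x - v y\<bar> powr q / norm (x - y) powr (real CARD('n) + t * q)))) \<partial>lebesgue)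
   = (\<integral>\<^sup>+z. ennreal (indicator (cross_dom \<Omega>) z * (\<bar>v (fst z) - v (snd z)\<bar> powr p / norm (fst z - snd z) powr (real CARD('n) + s * p)
        + a (fst z) (snd z) * (\<bar>v (fst z) - v (snd z)\<bar> powr q / norm (fst z - snd z) powr (real CARD('n) + t * q)))) \<partial>lebesgue)"
  by (intro nn_integral_cong) (auto simp: indicator_def)

text \<open>On the diagonal, where the kernel bounds say nothing, both sides vanish together with
  the increment.\<close>

lemma energy_density_comparable:
  shows "energy_density v (x, y) \<le> \<Lambda> * (\<bar>v x - v y\<bar> powr p / norm (x - y) powr (real CARD('n) + s * p)
        + a x y * (\<bar>v x - v y\<bar> powr q / norm (x - y) powr (real CARD('n) + t * q)))" (is "_ \<le> \<Lambda> * (?P + a x y * ?Q)")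
    and "\<bar>v x - v y\<bar> powr p / norm (x - y) powr (real CARD('n) + s * p)
        + a x y * (\<bar>v x - v y\<bar> powr q / norm (x - y) powr (real CARD('n) + t * q)) \<le> \<Lambda> * energy_density v (x, y)"
proof -
  have *: "d powr (- real CARD('n) - \<sigma>) = 1 / d powr (real CARD('n) + \<sigma>)" for d \<sigma> :: real
    using powr_minus_divide[of d "real CARD('n) + \<sigma>"] by simp
  show "energy_density v (x, y) \<le> \<Lambda> * (?P + a x y * ?Q)"
  proof (cases "x = y")
    case False
    have "\<bar>v x - v y\<bar> powr p * Ksp x y \<le> \<bar>v x - v y\<bar> powr p * (\<Lambda> * (1 / norm (x - y) powr (real CARD('n) + s * p)))"
      using KspD(3)[OF False] unfolding * by (intro mult_left_mono) auto
    moreover have "a x y * \<bar>v x - v y\<bar> powr q * Ktq x y \<le> a x y * \<bar>v x - v y\<bar> powr q * (\<Lambda> * (1 / norm (x - y) powr (real CARD('n) + t * q)))"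
      using KtqD(3)[OF False] a_nonneg unfolding * by (intro mult_left_mono) auto
    ultimately show ?thesis by (simp add: energy_density_def algebra_simps)
  qed (use pq in \<open>simp add: energy_density_def\<close>)
  show "?P + a x y * ?Q \<le> \<Lambda> * energy_density v (x, y)"
  proof (cases "x = y")
    case False
    have "\<bar>v x - v y\<bar> powr p * (1 / norm (x - y) powr (real CARD('n) + s * p)) \<le> \<bar>v x - v y\<bar> powr p * (\<Lambda> * Ksp x y)"
      using KspD(4)[OF False] by (intro mult_left_mono) auto
    moreover have "a x y * \<bar>v x - v y\<bar> powr q * (1 / norm (x - y) powr (real CARD('n) + t * q)) \<le> a x y * \<bar>v x - v y\<bar> powr q * (\<Lambda> * Ktq x y)"
      using KtqD(4)[OF False] a_nonneg by (intro mult_left_mono) auto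
    ultimately show ?thesis by (simp add: energy_density_def algebra_simps)
  qed (use pq in \<open>simp add: energy_density_def\<close>)
qed

lemma energy_u_finite: "energy p q Ksp Ktq a \<Omega> u < \<infinity>"
proof -
  let ?f = "\<lambda>z. indicator (cross_dom \<Omega>) z * (\<bar>u (fst z) - u (snd z)\<bar> powr p / norm (fst z - snd z) powr (real CARD('n) + s * p)
        + a (fst z) (snd z) * (\<bar>u (fst z) - u (snd z)\<bar> powr q / norm (fst z - snd z) powr (real CARD('n) + t * q)))"
  have "energy p q Ksp Ktq a \<Omega> u \<le> (\<integral>\<^sup>+z. ennreal \<Lambda> * ennreal (?f z) \<partial>lebesgue)"
    unfolding energy_eq
  proof (intro nn_integral_mono)
    fix z
    show "ennreal (indicator (cross_dom \<Omega>) z * energy_density u z) \<le> ennreal \<Lambda> * ennreal (?f z)"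
      using energy_density_comparable(1)[of u "fst z" "snd z"] \<Lambda> a_nonneg
      by (subst ennreal_mult'[symmetric]) (auto simp: indicator_def intro!: ennreal_leI)
  qed
  also have "\<dots> = ennreal \<Lambda> * (\<integral>\<^sup>+z. ennreal (?f z) \<partial>lebesgue)"
    by (intro nn_integral_cmult) measurable
  also have "\<dots> < \<infinity>"
    using u_space unfolding space_A_def space_A_double_eq by (auto simp: ennreal_mult_less_top)
  finally show ?thesis .
qed

text \<open>Admissibility of a competitor from finiteness of its energy alone. For the test function
  this finiteness is a by-product of the comparison with \<open>u\<close>, so its double integral
  never has to be estimated separately.\<close>

lemma energy_finite_imp_space_A:
  assumes v[measurable]: "v \<in> borel_measurable lebesgue" and "\<And>x. \<bar>v x\<bar> \<le> \<bar>u x\<bar>"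
    and "energy p q Ksp Ktq a \<Omega> v < \<infinity>"
  shows "v \<in> space_A s t p q a \<Omega>"
proof -
  let ?f = "\<lambda>z. indicator (cross_dom \<Omega>) z * (\<bar>v (fst z) - v (snd z)\<bar> powr p / norm (fst z - snd z) powr (real CARD('n) + s * p)
        + a (fst z) (snd z) * (\<bar>v (fst z) - v (snd z)\<bar> powr q / norm (fst z - snd z) powr (real CARD('n) + t * q)))"
  have "(\<integral>\<^sup>+z. ennreal (?f z) \<partial>lebesgue) \<le> (\<integral>\<^sup>+z. ennreal \<Lambda> * ennreal (indicator (cross_dom \<Omega>) z * energy_density v z) \<partial>lebesgue)"
  proof (intro nn_integral_mono)
    fix z
    show "ennreal (?f z) \<le> ennreal \<Lambda> * ennreal (indicator (cross_dom \<Omega>) z * energy_density v z)"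
      using energy_density_comparable(2)[of v "fst z" "snd z"] \<Lambda>
      by (subst ennreal_mult'[symmetric]) (auto simp: indicator_def intro!: ennreal_leI)
  qed
  also have "\<dots> = ennreal \<Lambda> * (\<integral>\<^sup>+z. ennreal (indicator (cross_dom \<Omega>) z * energy_density v z) \<partial>lebesgue)"
    by (intro nn_integral_cmult) measurable
  also have "\<dots> < \<infinity>"
    using assms(3) unfolding energy_eq by (auto simp: ennreal_mult_less_top)
  finally have "(\<integral>\<^sup>+z. ennreal (?f z) \<partial>lebesgue) < \<infinity>" .
  moreover have "(\<integral>\<^sup>+x\<in>\<Omega>. ennreal (\<bar>v x\<bar> powr p) \<partial>lebesgue) \<le> (\<integral>\<^sup>+x\<in>\<Omega>. ennreal (\<bar>u x\<bar> powr p) \<partial>lebesgue)"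
    using assms(2) pq by (intro nn_integral_mono mult_right_mono ennreal_leI powr_mono2) auto
  ultimately show ?thesis
    using u_space v unfolding space_A_def space_A_double_eq by (auto intro: le_less_trans)
qed

end

section \<open>The test function and the pointwise comparison of energy densities\<close>

locale double_phase_cutoff = double_phase s t p q \<Lambda> A \<Omega> Ksp Ktq a x0 R u
  for s t p q \<Lambda> A :: real and \<Omega> :: "(real^'n::finite) set"
    and Ksp Ktq a :: "real^'n \<Rightarrow> real^'n \<Rightarrow> real" and x0 :: "real^'n" and R :: real and u :: "real^'n \<Rightarrow> real" +
  fixes k \<sigma> \<tau> N :: real
  assumes k: "0 \<le> k" and radii: "R / 2 \<le> \<sigma>" "\<sigma> < \<tau>" "\<tau> \<le> R"
    and bound: "AE x in lebesgue. x \<in> ball x0 \<tau> \<longrightarrow> max (u x - k) 0 \<le> N"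
    and N: "0 \<le> N" and T_fin: "T < \<infinity>"
begin

definition "w x = max (u x - k) 0"
text \<open>The cutoff falls from 1 to 0 between \<sigma> and the intermediate radius
  \<open>\<sigma>'\<close>, with slope \<open>L\<close>. The gap left between
  \<open>\<sigma>'\<close> and \<tau> keeps the kernels bounded on the pairs counted by
  \<open>far\<close>.\<close>

definition "\<sigma>' = (\<sigma> + \<tau>) / 2"
definition "L = 2 / (\<tau> - \<sigma>)"
definition "Q = R / (\<tau> - \<sigma>)"
definition "\<eta> x = max 0 (min 1 ((\<sigma>' - dist x0 x) * L))"
definition "v x = u x - \<eta> x powr q * w x"

lemma w_meas [measurable]: "w \<in> borel_measurable lebesgue"
  unfolding w_def[abs_def] by measurable

lemma \<eta>_meas [measurable]: "\<eta> \<in> borel_measurable lebesgue"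
proof -
  have "\<eta> \<in> borel_measurable borel" unfolding \<eta>_def[abs_def] by measurable
  then show ?thesis by (intro measurable_completion) simp
qed

lemma v_meas [measurable]: "v \<in> borel_measurable lebesgue"
  unfolding v_def[abs_def] by measurable

lemma w_nonneg: "0 \<le> w x" by (simp add: w_def)

lemma w_le_pos_part: "w x \<le> pos_part u x" using k by (simp add: w_def pos_part_def)

lemma \<sigma>': "\<sigma> < \<sigma>'" "\<sigma>' < \<tau>" "0 < \<sigma>" "0 < L" "1 \<le> Q" "\<sigma>' - \<sigma> = 1 / L" "R * L = 2 * Q"
  using radii R by (auto simp: \<sigma>'_def L_def Q_def field_simps)

lemma \<eta>_range: "0 \<le> \<eta> x" "\<eta> x \<le> 1" by (auto simp: \<eta>_def)

lemma \<eta>_one: "x \<in> ball x0 \<sigma> \<Longrightarrow> \<eta> x = 1"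
  using \<sigma>' mult_right_mono[of "1 / L" "\<sigma>' - dist x0 x" L] by (auto simp: \<eta>_def)

lemma \<eta>_zero: "x \<notin> ball x0 \<sigma>' \<Longrightarrow> \<eta> x = 0"
  using \<sigma>' mult_nonpos_nonneg[of "\<sigma>' - dist x0 x" L] by (auto simp: \<eta>_def)

lemma \<eta>_lipschitz: "\<bar>\<eta> x - \<eta> y\<bar> \<le> L * norm (x - y)"
proof -
  have "\<bar>\<eta> x - \<eta> y\<bar> \<le> \<bar>(\<sigma>' - dist x0 x) * L - (\<sigma>' - dist x0 y) * L\<bar>"
    unfolding \<eta>_def by linarith
  also have "\<dots> = L * \<bar>dist x0 y - dist x0 x\<bar>"
    using \<sigma>'(4) by (simp add: left_diff_distrib[symmetric] abs_mult)
  also have "\<dots> \<le> L * norm (x - y)"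
    using \<sigma>'(4) abs_dist_diff_le[of y x0 x] by (intro mult_left_mono) (auto simp: dist_commute dist_norm)
  finally show ?thesis .
qed

lemma v_abs_le: "\<bar>v x\<bar> \<le> \<bar>u x\<bar>"
proof (cases "u x \<le> k")
  case False
  have "\<eta> x powr q \<le> 1" using \<eta>_range sq_pos by (intro powr_le1) auto
  then have "0 \<le> \<eta> x powr q * w x" "\<eta> x powr q * w x \<le> w x"
    using w_nonneg[of x] mult_right_mono[of "\<eta> x powr q" 1 "w x"] by auto
  moreover have "w x = u x - k" using False by (simp add: w_def)
  ultimately show ?thesis using False k unfolding v_def by linarith
qed (simp add: v_def w_def)

text \<open>The upper bound for \<open>a\<close> on pairs in the ball of radius \<open>R\<close>
  that \<open>a_osc\<close> grants.\<close>

definition "aplus = a0 + 4 * A * R powr (t * q - s * p)"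

text \<open>Testing minimality with \<open>v\<close> bounds the integral of \<open>gain\<close> by those of \<open>near\<close> and \<open>far\<close>, each taken with
  both orders of the variables: \<open>near\<close> collects the pairs inside the larger ball, \<open>far\<close> those with one
  point outside it.\<close>
definition near :: "(real^'n) \<times> (real^'n) \<Rightarrow> real" where
  "near z = indicator (ball x0 \<tau>) (fst z) * indicator (ball x0 \<tau>) (snd z) *
    (q powr p * L powr p * \<Lambda> * w (fst z) powr p * norm (fst z - snd z) powr ((p - s * p) - real CARD('n))
     + aplus * (q powr q * L powr q * \<Lambda> * w (fst z) powr q * norm (fst z - snd z) powr ((q - t * q) - real CARD('n))))"

definition far :: "(real^'n) \<times> (real^'n) \<Rightarrow> real" where
  "far z = indicator (ball x0 \<sigma>') (fst z) * indicator (- ball x0 \<tau>) (snd z) *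
    (p * w (fst z) * w (snd z) powr (p - 1) * Ksp (fst z) (snd z)
     + a (fst z) (snd z) * (q * w (fst z) * w (snd z) powr (q - 1)) * Ktq (fst z) (snd z))"

definition gain :: "(real^'n) \<times> (real^'n) \<Rightarrow> real" where
  "gain z = indicator (ball x0 \<sigma>) (fst z) * indicator (ball x0 \<sigma>) (snd z) * energy_density w z"

lemma aplus_nonneg: "0 \<le> aplus" using a_inf_nonneg A by (simp add: aplus_def)

lemma near_nonneg: "0 \<le> near z"
  unfolding near_def using aplus_nonneg \<Lambda> by (auto simp: indicator_def)

lemma far_nonneg: "0 \<le> far z"
proof (cases "fst z \<in> ball x0 \<sigma>' \<and> snd z \<notin> ball x0 \<tau>")
  case True
  then have "fst z \<noteq> snd z" using \<sigma>'(2) by auto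
  then show ?thesis
    unfolding far_def using KspD(2)[of "fst z" "snd z"] KtqD(2)[of "fst z" "snd z"] a_nonneg pq w_nonneg
    by (intro mult_nonneg_nonneg add_nonneg_nonneg) (auto simp: indicator_def)
qed (auto simp: far_def indicator_def)

lemma gain_nonneg: "0 \<le> gain z" by (auto simp: gain_def energy_density_nonneg indicator_def)

lemma ball_subset: "ball x0 \<tau> \<subseteq> \<Omega>" "ball x0 \<sigma> \<subseteq> ball x0 \<sigma>'" "ball x0 \<sigma>' \<subseteq> ball x0 \<tau>" "ball x0 \<tau> \<subseteq> ball x0 R"
  using \<Omega>(2) radii \<sigma>' by auto

text \<open>Pairs inside the ball of radius \<tau> are covered by \<open>truncation_pair_le\<close>,
  pairs with one point within \<open>\<sigma>'\<close> and the other beyond \<tau> by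
  \<open>truncation_outer_le\<close>. At any other pair the cutoff vanishes at both points, also
  when one of them lies between \<open>\<sigma>'\<close> and \<tau>, and \<open>v\<close> agrees
  with \<open>u\<close>.\<close>

lemma energy_density_v_le:
  assumes sym: "a x y = a y x"
  shows "indicator (cross_dom \<Omega>) (x, y) * energy_density v (x, y) + gain (x, y)
     \<le> indicator (cross_dom \<Omega>) (x, y) * energy_density u (x, y) + (near (x, y) + near (y, x) + (far (x, y) + far (y, x)))"
proof (cases "x = y")
  case True
  then show ?thesis
    using pq near_nonneg[of "(x, y)"] near_nonneg[of "(y, x)"] far_nonneg[of "(x, y)"] far_nonneg[of "(y, x)"]
    by (simp add: energy_density_def gain_def)
next
  case xy: False
  have Kp: "0 \<le> Ksp x y" and Kq: "0 \<le> a x y * Ktq x y" using KspD(2) KtqD(2) xy a_nonneg by auto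
  have nn: "0 \<le> near (x, y) + near (y, x)" "0 \<le> far (x, y)" "0 \<le> far (y, x)"
    using near_nonneg far_nonneg by (auto intro: add_nonneg_nonneg)
  have \<eta>q: "0 \<le> \<eta> z powr q" "\<eta> z powr q \<le> 1" for z using \<eta>_range sq_pos by (auto intro: powr_le1)
  consider "x \<in> ball x0 \<tau>" "y \<in> ball x0 \<tau>" | "x \<in> ball x0 \<sigma>'" "y \<notin> ball x0 \<tau>" | "x \<notin> ball x0 \<tau>" "y \<in> ball x0 \<sigma>'"
    | "x \<notin> ball x0 \<sigma>'" "y \<notin> ball x0 \<sigma>'" "x \<notin> ball x0 \<tau> \<or> y \<notin> ball x0 \<tau>"
    using ball_subset by blast
  then show ?thesis
  proof cases
    case 1
    have dom: "(x, y) \<in> cross_dom \<Omega>" using 1 ball_subset(1) by (auto simp: cross_dom_def)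
    define i :: real where "i = indicator (ball x0 \<sigma>) x * indicator (ball x0 \<sigma>) y"
    have i: "i \<le> min (\<eta> x powr q) (\<eta> y powr q)" using \<eta>_one by (auto simp: i_def indicator_def)
    \<comment> \<open>Both phases at once: \<kappa> is \<open>Ksp x y\<close> with c = 1, or
      \<open>a x y * Ktq x y\<close> with c = \<open>aplus\<close>. The Lipschitz bound on the
      cutoff weakens the singularity |x - y|^(-n - \<theta>) by the power m.\<close>
    have phase: "(\<bar>v x - v y\<bar> powr m + i * \<bar>w x - w y\<bar> powr m) * \<kappa>
       \<le> (\<bar>u x - u y\<bar> powr m) * \<kappa> + c * (q powr m * L powr m * \<Lambda> * w x powr m * norm (x - y) powr (m - \<theta> - real CARD('n)))
          + c * (q powr m * L powr m * \<Lambda> * w y powr m * norm (x - y) powr (m - \<theta> - real CARD('n)))"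
      if m: "1 \<le> m" "m \<le> q" and \<kappa>: "0 \<le> \<kappa>" "\<kappa> \<le> c * (\<Lambda> * norm (x - y) powr (- real CARD('n) - \<theta>))" for m \<kappa> c \<theta>
    proof -
      have "i * \<bar>w x - w y\<bar> powr m \<le> min (\<eta> x powr q) (\<eta> y powr q) * \<bar>w x - w y\<bar> powr m"
        using i by (intro mult_right_mono) auto
      with truncation_pair_le[of "\<eta> x" "\<eta> y" m q "u x" k "u y"] \<eta>_range m
      have "\<bar>v x - v y\<bar> powr m + i * \<bar>w x - w y\<bar> powr m
        \<le> \<bar>u x - u y\<bar> powr m + q powr m * \<bar>\<eta> x - \<eta> y\<bar> powr m * (w x powr m + w y powr m)"
        by (simp add: v_def w_def)
      then have "(\<bar>v x - v y\<bar> powr m + i * \<bar>w x - w y\<bar> powr m) * \<kappa> 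
        \<le> (\<bar>u x - u y\<bar> powr m + q powr m * \<bar>\<eta> x - \<eta> y\<bar> powr m * (w x powr m + w y powr m)) * \<kappa>"
        by (rule mult_right_mono) fact
      moreover have "\<dots> = \<bar>u x - u y\<bar> powr m * \<kappa> + (q powr m * (w x powr m + w y powr m)) * (\<bar>\<eta> x - \<eta> y\<bar> powr m * \<kappa>)"
        by (simp add: algebra_simps)
      moreover have XY: "\<bar>\<eta> x - \<eta> y\<bar> powr m * \<kappa> \<le> c * (L powr m * \<Lambda> * norm (x - y) powr (m - \<theta> - real CARD('n)))"
      proof -
        have "\<bar>\<eta> x - \<eta> y\<bar> powr m * \<kappa> \<le> (L * norm (x - y)) powr m * (c * (\<Lambda> * norm (x - y) powr (- real CARD('n) - \<theta>)))"
        using \<eta>_lipschitz[of x y] \<kappa> m by (intro mult_mono powr_mono2) auto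
        moreover have "norm (x - y) powr (m - \<theta> - real CARD('n)) = norm (x - y) powr (m + (- real CARD('n) - \<theta>))" by (simp add: algebra_simps)
        ultimately show ?thesis unfolding powr_add by (simp add: powr_mult mult_ac)
      qed
      moreover have "0 \<le> q powr m * (w x powr m + w y powr m)" by simp
      note mult_left_mono[OF XY this]
      ultimately show ?thesis by (simp add: algebra_simps)
    qed
    have P: "(\<bar>v x - v y\<bar> powr p + i * \<bar>w x - w y\<bar> powr p) * Ksp x y
       \<le> (\<bar>u x - u y\<bar> powr p) * Ksp x y + 1 * (q powr p * L powr p * \<Lambda> * w x powr p * norm (x - y) powr (p - s * p - real CARD('n)))
          + 1 * (q powr p * L powr p * \<Lambda> * w y powr p * norm (x - y) powr (p - s * p - real CARD('n)))"
      using pq Kp KspD(3)[OF xy] by (intro phase) auto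
    have "a x y * Ktq x y \<le> aplus * (\<Lambda> * norm (x - y) powr (- real CARD('n) - t * q))"
      using KtqD(2)[OF xy] KtqD(3)[OF xy] a_osc[of x y] 1 ball_subset(4) aplus_nonneg
      by (intro mult_mono) (auto simp: aplus_def subset_iff)
    then have Q: "(\<bar>v x - v y\<bar> powr q + i * \<bar>w x - w y\<bar> powr q) * (a x y * Ktq x y)
       \<le> (\<bar>u x - u y\<bar> powr q) * (a x y * Ktq x y) + aplus * (q powr q * L powr q * \<Lambda> * w x powr q * norm (x - y) powr (q - t * q - real CARD('n)))
          + aplus * (q powr q * L powr q * \<Lambda> * w y powr q * norm (x - y) powr (q - t * q - real CARD('n)))"
      using sq_pos Kq by (intro phase) auto
    have near: "near (x, y) + near (y, x) = 
       1 * (q powr p * L powr p * \<Lambda> * w x powr p * norm (x - y) powr (p - s * p - real CARD('n)))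
       + 1 * (q powr p * L powr p * \<Lambda> * w y powr p * norm (x - y) powr (p - s * p - real CARD('n)))
       + (aplus * (q powr q * L powr q * \<Lambda> * w x powr q * norm (x - y) powr (q - t * q - real CARD('n)))
          + aplus * (q powr q * L powr q * \<Lambda> * w y powr q * norm (x - y) powr (q - t * q - real CARD('n))))"
      using 1 by (simp add: near_def norm_minus_commute[of y x])
    have lhs: "indicator (cross_dom \<Omega>) (x, y) * energy_density v (x, y) + gain (x, y) =
       (\<bar>v x - v y\<bar> powr p + i * \<bar>w x - w y\<bar> powr p) * Ksp x y + (\<bar>v x - v y\<bar> powr q + i * \<bar>w x - w y\<bar> powr q) * (a x y * Ktq x y)"
      using dom by (simp add: energy_density_def gain_def i_def algebra_simps)
    have rhs: "indicator (cross_dom \<Omega>) (x, y) * energy_density u (x, y) = (\<bar>u x - u y\<bar> powr p) * Ksp x y + (\<bar>u x - u y\<bar> powr q) * (a x y * Ktq x y)"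
      using dom by (simp add: energy_density_def)
    show ?thesis unfolding lhs rhs near using P Q nn by linarith
  next
    case 2
    then have dom: "(x, y) \<in> cross_dom \<Omega>" using ball_subset by (auto simp: cross_dom_def)
    have "y \<notin> ball x0 \<sigma>'" using 2 ball_subset by blast
    then have y: "\<eta> y = 0" "y \<notin> ball x0 \<sigma>" using ball_subset(2) by (blast intro: \<eta>_zero)+
    then have vy: "v y = u y" by (simp add: v_def)
    have phase: "\<bar>v x - v y\<bar> powr m \<le> \<bar>u x - u y\<bar> powr m + m * w x * w y powr (m - 1)" if "1 \<le> m" for m
      using truncation_outer_le[where ux = "u x" and uy = "u y" and k = k, OF \<eta>q that, of x] unfolding vy by (simp add: v_def w_def)
    have "energy_density v (x, y) \<le> energy_density u (x, y) + far (x, y)"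
      using mult_right_mono[OF phase[of p] Kp] mult_right_mono[OF phase[of q] Kq] pq 2
      by (simp add: energy_density_def far_def algebra_simps)
    then show ?thesis using dom y nn by (simp add: gain_def)
  next
    case 3
    then have dom: "(x, y) \<in> cross_dom \<Omega>" using ball_subset by (auto simp: cross_dom_def)
    have "x \<notin> ball x0 \<sigma>'" using 3 ball_subset by blast
    then have y: "\<eta> x = 0" "x \<notin> ball x0 \<sigma>" using ball_subset(2) by (blast intro: \<eta>_zero)+
    then have vx: "v x = u x" by (simp add: v_def)
    have phase: "\<bar>v x - v y\<bar> powr m \<le> \<bar>u x - u y\<bar> powr m + m * w y * w x powr (m - 1)" if "1 \<le> m" for m
      using truncation_outer_le[where ux = "u y" and uy = "u x" and k = k, OF \<eta>q that, of y] unfolding vx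
      by (simp add: v_def w_def abs_minus_commute[of "u x"])
    have "energy_density v (x, y) \<le> energy_density u (x, y) + far (y, x)"
      using mult_right_mono[OF phase[of p] Kp] mult_right_mono[OF phase[of q] Kq] pq 3 sym
      by (simp add: energy_density_def far_def algebra_simps KspD(1)[of y x] KtqD(1)[of y x])
    then show ?thesis using dom y nn by (simp add: gain_def)
  next
    case 4
    then have "v x = u x" "v y = u y" "x \<notin> ball x0 \<sigma>" using ball_subset by (auto simp: v_def \<eta>_zero)
    then show ?thesis using nn by (simp add: gain_def energy_density_def)
  qed
qed

end

section \<open>Integration of the pointwise comparison\<close>

definition kernel_const :: "real \<Rightarrow> real \<Rightarrow> real" where
  "kernel_const d \<beta> = unit_ball_vol d * 2 powr \<bar>\<beta> - d\<bar> / (1 - 2 powr (- \<beta>))"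

text \<open>The two summands are the constants for \<open>near\<close> and \<open>far\<close>;
  \<open>kernel_const\<close> is the constant of \<open>nn_integral_norm_powr_ball_le\<close>. In
  the prefactor, 2 counts the two orders of the variables and \<Lambda> is the price for passing
  from \<open>gain\<close> to seminorms. \<open>N\<close> enters only through w^q <= N^(q - p)
  w^p.\<close>

definition caccioppoli_const :: "real \<Rightarrow> real \<Rightarrow> real \<Rightarrow> real \<Rightarrow> real \<Rightarrow> real \<Rightarrow> real \<Rightarrow> real \<Rightarrow> real" where
  "caccioppoli_const d s t p q \<Lambda> A N = 2 * \<Lambda> *
     (\<Lambda> * q powr q * 4 powr q * (kernel_const d (p - s * p) + kernel_const d (q - t * q)) * (1 + 4 * A * N powr (q - p))
      + q * \<Lambda> * 2 powr (d + q))"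

lemma kernel_const_nonneg: "0 \<le> d \<Longrightarrow> 0 < \<beta> \<Longrightarrow> 0 \<le> kernel_const d \<beta>"
  unfolding kernel_const_def using powr_less_one[of 2 "- \<beta>"] by (intro divide_nonneg_nonneg mult_nonneg_nonneg) auto

context double_phase
begin

lemma H_nonneg: "0 \<le> H \<tau>"
  using a_inf_nonneg by (simp add: H_fun_def)

lemma H_mono: "0 \<le> x \<Longrightarrow> x \<le> y \<Longrightarrow> H x \<le> H y"
  unfolding H_fun_def using a_inf_nonneg pq R
  by (intro add_mono mult_left_mono divide_right_mono powr_mono2) auto

lemma H_measurable [measurable]: "H \<in> borel_measurable borel"
  unfolding H_fun_def[abs_def] by measurable

text \<open>Only the second part of the tail depends on \<open>x\<close>, and there the supremum
  absorbs it. Measurability of the section is assumed because measurability of \<open>a\<close>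
  grants it for almost every \<open>x\<close> only.\<close>

lemma T_section_le:
  assumes x: "x \<in> ball x0 R" and [measurable]: "(\<lambda>y. a x y) \<in> borel_measurable lebesgue"
  shows "(\<integral>\<^sup>+y. indicator (- ball x0 (R / 2)) y *
      ennreal (\<bar>pos_part u y\<bar> powr (p - 1) / norm (y - x0) powr (real CARD('n) + s * p)
        + a x y * (\<bar>pos_part u y\<bar> powr (q - 1) / norm (y - x0) powr (real CARD('n) + t * q))) \<partial>lebesgue) \<le> T"
    (is "(\<integral>\<^sup>+y. ?i y * ennreal (?P y + a x y * ?Q y) \<partial>_) \<le> _")
proof -
  have [measurable]: "pos_part u \<in> borel_measurable lebesgue"
    unfolding pos_part_def[abs_def] by measurable
  have "(\<integral>\<^sup>+y. ?i y * ennreal (?P y + a x y * ?Q y) \<partial>lebesgue)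
     = (\<integral>\<^sup>+y. (ennreal (?P y) * indicator (UNIV - ball x0 (R / 2)) y + ennreal (a x y * ?Q y) * indicator (UNIV - ball x0 (R / 2)) y) \<partial>lebesgue)"
    using a_nonneg by (intro nn_integral_cong) (auto simp: indicator_def)
  also have "\<dots> = (\<integral>\<^sup>+y\<in>UNIV - ball x0 (R / 2). ennreal (?P y) \<partial>lebesgue) + (\<integral>\<^sup>+y\<in>UNIV - ball x0 (R / 2). ennreal (a x y * ?Q y) \<partial>lebesgue)"
    by (intro nn_integral_add) (auto simp: Compl_eq_Diff_UNIV[symmetric])
  also have "\<dots> \<le> T"
    unfolding tail_def using x by (intro add_left_mono SUP_upper)
  finally show ?thesis .
qed

end

context double_phase_cutoff
begin

lemma near_measurable [measurable]: "near \<in> borel_measurable lebesgue"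
  unfolding near_def[abs_def] by measurable

lemma far_measurable [measurable]: "far \<in> borel_measurable lebesgue"
  unfolding far_def[abs_def] by measurable

lemma gain_measurable [measurable]: "gain \<in> borel_measurable lebesgue"
  unfolding gain_def[abs_def] by measurable

abbreviation "mass f \<equiv> (\<integral>\<^sup>+x. indicator (ball x0 \<tau>) x * ennreal (f x) \<partial>lebesgue)"

lemma mass_finite:
  assumes "\<And>x. w x \<le> N \<Longrightarrow> f x \<le> c"
  shows "mass f < \<infinity>"
proof -
  have "mass f \<le> (\<integral>\<^sup>+x. ennreal c * indicator (ball x0 \<tau>) x \<partial>lebesgue)"
    using bound by (intro nn_integral_mono_AE, eventually_elim) (auto simp: indicator_def w_def intro!: ennreal_leI assms)
  also have "\<dots> = ennreal c * emeasure lebesgue (ball x0 \<tau>)"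
    by (intro nn_integral_cmult_indicator) simp
  also have "\<dots> < \<infinity>"
    using radii R by (simp add: emeasure_ball ennreal_mult_less_top)
  finally show ?thesis .
qed

text \<open>From R L = 2 Q the left side is q^m (4 Q)^m / (2 R)^\<theta>; since q and 4 Q are at
  least 1, the exponent m may be raised to q, which gives both phases the same factor.\<close>

lemma phase_scaling:
  assumes "0 \<le> \<theta>" "1 \<le> m" "m \<le> q"
  shows "q powr m * L powr m * (2 * R) powr (m - \<theta>) \<le> q powr q * 4 powr q * Q powr q / R powr \<theta>"
proof -
  have "L powr m * (2 * R) powr m = (4 * Q) powr m"
  proof -
    have "L * (2 * R) = 4 * Q" using \<sigma>'(7) by (simp add: mult_ac)
    then show ?thesis by (simp only: powr_mult[symmetric])
  qed
  then have "q powr m * L powr m * (2 * R) powr (m - \<theta>) = q powr m * ((4 * Q) powr m / (2 * R) powr \<theta>)"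
    by (simp add: powr_diff mult.assoc)
  also have "\<dots> \<le> q powr q * ((4 * Q) powr q / R powr \<theta>)"
    using assms \<sigma>'(5) R sq_pos
    by (intro mult_mono frac_le powr_mono powr_mono2) auto
  finally show ?thesis by (simp add: powr_mult)
qed

text \<open>Since s, t < 1, the weakened singularities have positive orders p - s p and q - t q and
  are integrable. What exceeds \<open>a0\<close> in \<open>aplus\<close> is moved to the p-phase,
  and there the bound w x <= N enters.\<close>

lemma near_inner_le:
  assumes "w x \<le> N" 
  shows "(\<integral>\<^sup>+y. ennreal (near (x, y)) \<partial>lebesgue) \<le>
    ennreal (\<Lambda> * q powr q * 4 powr q * (kernel_const (real CARD('n)) (p - s * p) + kernel_const (real CARD('n)) (q - t * q)) * (1 + 4 * A * N powr (q - p)) * Q powr q)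
    * (indicator (ball x0 \<tau>) x * ennreal (H (w x)))"
proof (cases "x \<in> ball x0 \<tau>")
  case x: True
  let ?d = "real CARD('n)"
  let ?kp = "kernel_const ?d (p - s * p)" and ?kq = "kernel_const ?d (q - t * q)"
  let ?I = "\<lambda>\<beta> y. indicator {y. norm (x - y) < 2 * R} y * ennreal (norm (x - y) powr (\<beta> - ?d))"
  define cp where "cp = q powr p * L powr p * \<Lambda> * w x powr p"
  define cq where "cq = aplus * (q powr q * L powr q * \<Lambda> * w x powr q)"
  have c: "0 \<le> cp" "0 \<le> cq" using \<Lambda> aplus_nonneg by (auto simp: cp_def cq_def)
  have K: "0 \<le> ?kp" "0 \<le> ?kq" using sq_pos by (auto intro!: kernel_const_nonneg)
  have I_meas: "?I \<beta> \<in> borel_measurable lebesgue" for \<beta>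
  proof -
    have "{y. norm (x - y) < 2 * R} = ball x (2 * R)" by (auto simp: dist_norm)
    then show ?thesis by simp
  qed
  have "(\<integral>\<^sup>+y. ennreal (near (x, y)) \<partial>lebesgue) \<le> (\<integral>\<^sup>+y. ennreal cp * ?I (p - s * p) y + ennreal cq * ?I (q - t * q) y \<partial>lebesgue)"
  proof (intro nn_integral_mono)
    fix y
    show "ennreal (near (x, y)) \<le> ennreal cp * ?I (p - s * p) y + ennreal cq * ?I (q - t * q) y"
    proof (cases "y \<in> ball x0 \<tau>")
      case True
      have "norm (x - y) < 2 * R"
        using x True radii dist_triangle[of x y x0] by (simp add: dist_norm norm_minus_commute)
      moreover have "near (x, y) = cp * norm (x - y) powr (p - s * p - ?d) + cq * norm (x - y) powr (q - t * q - ?d)"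
        using x True by (simp add: near_def cp_def cq_def)
      ultimately show ?thesis using c by (simp add: ennreal_mult)
    qed (simp add: near_def)
  qed
  also have "\<dots> = ennreal cp * (\<integral>\<^sup>+y. ?I (p - s * p) y \<partial>lebesgue) + ennreal cq * (\<integral>\<^sup>+y. ?I (q - t * q) y \<partial>lebesgue)"
    using I_meas by (subst nn_integral_add) (auto simp: nn_integral_cmult)
  also have "\<dots> \<le> ennreal cp * ennreal (?kp * (2 * R) powr (p - s * p)) + ennreal cq * ennreal (?kq * (2 * R) powr (q - t * q))"
    using nn_integral_norm_powr_ball_le[of "p - s * p" "2 * R" x] nn_integral_norm_powr_ball_le[of "q - t * q" "2 * R" x] sq_pos R
    by (intro add_mono mult_left_mono) (auto simp: kernel_const_def)
  also have "\<dots> = ennreal (cp * (?kp * (2 * R) powr (p - s * p)) + cq * (?kq * (2 * R) powr (q - t * q)))"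
    using c K by (simp add: ennreal_mult)
  also have "\<dots> \<le> ennreal (\<Lambda> * q powr q * 4 powr q * (?kp + ?kq) * (1 + 4 * A * N powr (q - p)) * Q powr q * H (w x))"
  proof (intro ennreal_leI)
    define S where "S = q powr q * 4 powr q * Q powr q"
    have S0: "0 \<le> S" by (simp add: S_def)
    have "cp * (?kp * (2 * R) powr (p - s * p)) = \<Lambda> * w x powr p * ?kp * (q powr p * L powr p * (2 * R) powr (p - s * p))"
      by (simp add: cp_def)
    also have "\<dots> \<le> \<Lambda> * w x powr p * ?kp * (S / R powr (s * p))"
      unfolding S_def using phase_scaling[of "s * p" p] sq_pos pq \<Lambda> K by (intro mult_left_mono) auto
    also have "\<dots> \<le> \<Lambda> * w x powr p * (?kp + ?kq) * (S / R powr (s * p))"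
      using \<Lambda> K S0 by (intro mult_right_mono mult_left_mono) auto
    finally have 1: "cp * (?kp * (2 * R) powr (p - s * p)) \<le> \<Lambda> * S * (?kp + ?kq) * (w x powr p / R powr (s * p))"
      by (simp add: mult_ac)
    have "cq * (?kq * (2 * R) powr (q - t * q)) = \<Lambda> * aplus * w x powr q * ?kq * (q powr q * L powr q * (2 * R) powr (q - t * q))"
      by (simp add: cq_def)
    also have "\<dots> \<le> \<Lambda> * aplus * w x powr q * ?kq * (S / R powr (t * q))"
      unfolding S_def using phase_scaling[of "t * q" q] sq_pos pq \<Lambda> K aplus_nonneg by (intro mult_left_mono) auto
    also have "\<dots> \<le> \<Lambda> * aplus * w x powr q * (?kp + ?kq) * (S / R powr (t * q))"
      using \<Lambda> K S0 aplus_nonneg by (intro mult_right_mono mult_left_mono) auto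
    finally have 2: "cq * (?kq * (2 * R) powr (q - t * q)) \<le> \<Lambda> * S * (?kp + ?kq) * (aplus * (w x powr q / R powr (t * q)))"
      by (simp add: mult_ac)
    have wq: "w x powr q \<le> N powr (q - p) * w x powr p"
    proof (cases "w x = 0")
      case False
      then have "w x powr q = w x powr (q - p) * w x powr p" by (simp add: powr_add[symmetric])
      also have "\<dots> \<le> N powr (q - p) * w x powr p"
        using assms w_nonneg pq by (intro mult_right_mono powr_mono2) auto
      finally show ?thesis .
    qed simp
    \<comment> \<open>The exponent in \<open>a_osc\<close> is exactly the one that turns the scaling
      R^(-t q) of the excess into the scaling R^(-s p) of the p-phase.\<close>
    have "R powr (t * q - s * p) / R powr (t * q) = 1 / R powr (s * p)"
      using R by (simp add: powr_diff)
    moreover have "aplus * (w x powr q / R powr (t * q)) = a0 * (w x powr q / R powr (t * q)) + 4 * A * w x powr q * (R powr (t * q - s * p) / R powr (t * q))"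
      by (simp add: aplus_def algebra_simps add_divide_distrib)
    ultimately have "aplus * (w x powr q / R powr (t * q)) = a0 * (w x powr q / R powr (t * q)) + 4 * A * (w x powr q / R powr (s * p))"
      by simp
    also have "4 * A * (w x powr q / R powr (s * p)) \<le> 4 * A * (N powr (q - p) * w x powr p / R powr (s * p))"
      using A wq by (intro mult_left_mono divide_right_mono) auto
    finally have "w x powr p / R powr (s * p) + aplus * (w x powr q / R powr (t * q)) \<le> H (w x) + 4 * A * N powr (q - p) * (w x powr p / R powr (s * p))"
      by (simp add: H_fun_def mult_ac)
    also have "\<dots> \<le> H (w x) + 4 * A * N powr (q - p) * H (w x)"
      using A a_inf_nonneg by (intro add_left_mono mult_left_mono) (auto simp: H_fun_def)
    finally have 3: "w x powr p / R powr (s * p) + aplus * (w x powr q / R powr (t * q)) \<le> (1 + 4 * A * N powr (q - p)) * H (w x)"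
      by (simp add: algebra_simps)
    have "cp * (?kp * (2 * R) powr (p - s * p)) + cq * (?kq * (2 * R) powr (q - t * q))
       \<le> \<Lambda> * S * (?kp + ?kq) * (w x powr p / R powr (s * p) + aplus * (w x powr q / R powr (t * q)))"
      using 1 2 by (simp add: distrib_left)
    also have "\<dots> \<le> \<Lambda> * S * (?kp + ?kq) * ((1 + 4 * A * N powr (q - p)) * H (w x))"
      using 3 \<Lambda> K S0 by (intro mult_left_mono) auto
    finally show "cp * (?kp * (2 * R) powr (p - s * p)) + cq * (?kq * (2 * R) powr (q - t * q))
       \<le> \<Lambda> * q powr q * 4 powr q * (?kp + ?kq) * (1 + 4 * A * N powr (q - p)) * Q powr q * H (w x)"
      by (simp add: S_def mult_ac)
  qed
  finally show ?thesis
    using x \<Lambda> K A H_nonneg by (simp add: ennreal_mult[symmetric])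
qed (simp add: near_def)

lemma near_integral_le:
  "(\<integral>\<^sup>+z. ennreal (near z) \<partial>lebesgue) \<le>
    ennreal (\<Lambda> * q powr q * 4 powr q * (kernel_const (real CARD('n)) (p - s * p) + kernel_const (real CARD('n)) (q - t * q)) * (1 + 4 * A * N powr (q - p)) * Q powr q)
    * mass (\<lambda>x. H (w x))" (is "_ \<le> ennreal ?c * _")
proof -
  have "(\<integral>\<^sup>+z. ennreal (near z) \<partial>lebesgue) = (\<integral>\<^sup>+x. \<integral>\<^sup>+y. ennreal (near (x, y)) \<partial>lebesgue \<partial>lebesgue)"
    by (intro nn_integral_lebesgue_iterated(1)) measurable
  also have "\<dots> \<le> (\<integral>\<^sup>+x. ennreal ?c * (indicator (ball x0 \<tau>) x * ennreal (H (w x))) \<partial>lebesgue)"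
  proof (intro nn_integral_mono_AE)
    show "AE x in lebesgue. (\<integral>\<^sup>+y. ennreal (near (x, y)) \<partial>lebesgue) \<le> ennreal ?c * (indicator (ball x0 \<tau>) x * ennreal (H (w x)))"
      using bound
    proof eventually_elim
      case (elim x)
      show ?case
      proof (cases "x \<in> ball x0 \<tau>")
        case True
        then show ?thesis using elim near_inner_le[of x] by (simp add: w_def)
      qed (simp add: near_def)
    qed
  qed
  also have "\<dots> = ennreal ?c * mass (\<lambda>x. H (w x))"
    by (intro nn_integral_cmult) measurable
  finally show ?thesis .
qed

text \<open>With r = |y - x0| the quotient r / (r - \<sigma>') is largest at r = \<tau>, whence r <=
  2 Q |x - y|: kernels centred at \<open>x\<close> and at \<open>x0\<close> are comparable. The
  factor Q^(n + q) of the Caccioppoli inequality originates here.\<close>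

lemma far_kernel_le:
  assumes x: "x \<in> ball x0 \<sigma>'" and y: "y \<notin> ball x0 \<tau>" and \<theta>: "0 \<le> \<theta>" "\<theta> \<le> q"
    and K: "K \<le> \<Lambda> * norm (x - y) powr (- real CARD('n) - \<theta>)"
  shows "K \<le> \<Lambda> * (2 powr (real CARD('n) + q) * Q powr (real CARD('n) + q)) / norm (y - x0) powr (real CARD('n) + \<theta>)"
proof -
  let ?d = "real CARD('n)"
  define r where "r = dist x0 y"
  have r: "\<tau> \<le> r" using y by (simp add: r_def)
  have n: "r - \<sigma>' \<le> norm (x - y)"
    using x dist_triangle[of x0 y x] by (simp add: r_def dist_norm)
  have pos: "0 < r - \<sigma>'" using r \<sigma>' by simp
  have "\<tau> * (r - \<sigma>') \<le> R * (r - \<sigma>')" using radii pos by (intro mult_right_mono) auto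
  moreover have "\<sigma>' * \<tau> \<le> \<sigma>' * r" using r \<sigma>' by (intro mult_left_mono) auto
  ultimately have "r * (\<tau> - \<sigma>') \<le> R * (r - \<sigma>')" by (simp add: algebra_simps)
  moreover have "\<tau> - \<sigma>' = (\<tau> - \<sigma>) / 2" by (simp add: \<sigma>'_def field_simps)
  ultimately have "r \<le> 2 * Q * (r - \<sigma>')"
    using radii by (simp add: Q_def field_simps)
  also have "\<dots> \<le> 2 * Q * norm (x - y)" using n \<sigma>'(5) by (intro mult_left_mono) auto
  finally have "r powr (?d + \<theta>) \<le> (2 * Q * norm (x - y)) powr (?d + \<theta>)"
    using r radii R \<theta> by (intro powr_mono2) auto
  also have "\<dots> = (2 * Q) powr (?d + \<theta>) * norm (x - y) powr (?d + \<theta>)" by (simp add: powr_mult)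
  also have "\<dots> \<le> (2 * Q) powr (?d + q) * norm (x - y) powr (?d + \<theta>)"
    using \<theta> \<sigma>'(5) by (intro mult_right_mono powr_mono) auto
  finally have *: "r powr (?d + \<theta>) \<le> (2 * Q) powr (?d + q) * norm (x - y) powr (?d + \<theta>)" .
  have xy: "0 < norm (x - y)" using n pos by linarith
  have "norm (x - y) powr (- ?d - \<theta>) = 1 / norm (x - y) powr (?d + \<theta>)"
    using powr_minus_divide[of "norm (x - y)" "?d + \<theta>"] by simp
  also have "\<dots> \<le> (2 * Q) powr (?d + q) / r powr (?d + \<theta>)"
    using * xy r radii R \<sigma>' by (simp add: field_simps)
  finally have "K \<le> \<Lambda> * ((2 * Q) powr (?d + q) / r powr (?d + \<theta>))"
    using K \<Lambda> by (meson mult_left_mono order_trans zero_le_one)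
  then show ?thesis by (simp add: r_def powr_mult dist_norm norm_minus_commute)
qed

lemma far_integral_le:
  "(\<integral>\<^sup>+z. ennreal (far z) \<partial>lebesgue) \<le> ennreal (q * \<Lambda> * 2 powr (real CARD('n) + q) * Q powr (real CARD('n) + q)) * (T * mass w)"
    (is "_ \<le> ennreal ?c * _")
proof -
  let ?d = "real CARD('n)"
  let ?P = "\<lambda>y. \<bar>pos_part u y\<bar> powr (p - 1) / norm (y - x0) powr (?d + s * p)"
  let ?Q = "\<lambda>y. \<bar>pos_part u y\<bar> powr (q - 1) / norm (y - x0) powr (?d + t * q)"
  have [measurable]: "pos_part u \<in> borel_measurable lebesgue"
    unfolding pos_part_def[abs_def] by measurable
  have "0 \<le> ?c" using pq \<Lambda> by simp
  have pt: "far (x, y) \<le> (?c * w x) * (?P y + a x y * ?Q y)"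
    if x: "x \<in> ball x0 \<sigma>'" and y: "y \<notin> ball x0 \<tau>" for x y
  proof -
    have xy: "x \<noteq> y" using x y \<sigma>'(2) by auto
    let ?b = "\<Lambda> * (2 powr (?d + q) * Q powr (?d + q))"
    have b: "0 \<le> ?b" using \<Lambda> by simp
    have "p * w x * w y powr (p - 1) * Ksp x y \<le> q * w x * \<bar>pos_part u y\<bar> powr (p - 1) * (?b / norm (y - x0) powr (?d + s * p))"
      using far_kernel_le[OF x y, of "s * p" "Ksp x y"] KspD(2,3)[OF xy] sq_pos pq w_nonneg[of x] w_nonneg[of y] w_le_pos_part[of y]
      by (intro mult_mono powr_mono2) auto
    moreover have "q * w x * w y powr (q - 1) * Ktq x y \<le> q * w x * \<bar>pos_part u y\<bar> powr (q - 1) * (?b / norm (y - x0) powr (?d + t * q))"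
      using far_kernel_le[OF x y, of "t * q" "Ktq x y"] KtqD(2,3)[OF xy] sq_pos pq w_nonneg[of x] w_nonneg[of y] w_le_pos_part[of y]
      by (intro mult_mono powr_mono2) auto
    then have "a x y * (q * w x * w y powr (q - 1) * Ktq x y) \<le> a x y * (q * w x * \<bar>pos_part u y\<bar> powr (q - 1) * (?b / norm (y - x0) powr (?d + t * q)))"
      using a_nonneg by (intro mult_left_mono)
    ultimately have "far (x, y) \<le> q * w x * \<bar>pos_part u y\<bar> powr (p - 1) * (?b / norm (y - x0) powr (?d + s * p))
       + a x y * (q * w x * \<bar>pos_part u y\<bar> powr (q - 1) * (?b / norm (y - x0) powr (?d + t * q)))"
      using x y by (simp add: far_def mult.assoc)
    also have "\<dots> = (?c * w x) * (?P y + a x y * ?Q y)" by (simp add: algebra_simps add_divide_distrib)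
    finally show ?thesis .
  qed
  have "(\<integral>\<^sup>+z. ennreal (far z) \<partial>lebesgue) = (\<integral>\<^sup>+x. \<integral>\<^sup>+y. ennreal (far (x, y)) \<partial>lebesgue \<partial>lebesgue)"
    by (intro nn_integral_lebesgue_iterated(1)) measurable
  also have "\<dots> \<le> (\<integral>\<^sup>+x. ennreal ?c * T * (indicator (ball x0 \<tau>) x * ennreal (w x)) \<partial>lebesgue)"
  proof (intro nn_integral_mono_AE)
    show "AE x in lebesgue. (\<integral>\<^sup>+y. ennreal (far (x, y)) \<partial>lebesgue) \<le> ennreal ?c * T * (indicator (ball x0 \<tau>) x * ennreal (w x))"
      \<comment> \<open>The inner integral can be split and compared with the tail only at those
        \<open>x\<close> whose section of \<open>a\<close> is measurable.\<close>
      using AE_borel_measurable_section[OF a_meas]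
    proof eventually_elim
      case (elim x)
      then have [measurable]: "(\<lambda>y. a x y) \<in> borel_measurable lebesgue" by simp
      show ?case
      proof (cases "x \<in> ball x0 \<sigma>'")
        case True
        have "(\<integral>\<^sup>+y. ennreal (far (x, y)) \<partial>lebesgue)
          \<le> (\<integral>\<^sup>+y. ennreal (?c * w x) * (indicator (- ball x0 (R / 2)) y * ennreal (?P y + a x y * ?Q y)) \<partial>lebesgue)"
        proof (intro nn_integral_mono)
          fix y
          show "ennreal (far (x, y)) \<le> ennreal (?c * w x) * (indicator (- ball x0 (R / 2)) y * ennreal (?P y + a x y * ?Q y))"
          proof (cases "y \<in> ball x0 \<tau>")
            case False
            have "indicator (- ball x0 (R / 2)) y = (1 :: ennreal)" using False radii by (auto simp: indicator_def)
            then show ?thesis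
              using ennreal_leI[OF pt[OF True False]] w_nonneg[of x] \<open>0 \<le> ?c\<close> a_nonneg
              by (simp add: ennreal_mult)
          qed (simp add: far_def)
        qed
        also have "\<dots> = ennreal (?c * w x) * (\<integral>\<^sup>+y. indicator (- ball x0 (R / 2)) y * ennreal (?P y + a x y * ?Q y) \<partial>lebesgue)"
          by (intro nn_integral_cmult) measurable
        also have "\<dots> \<le> ennreal (?c * w x) * T"
        proof -
          have "x \<in> ball x0 R" using True ball_subset by blast
          then show ?thesis by (intro mult_left_mono T_section_le) auto
        qed
        also have "\<dots> = ennreal ?c * T * (indicator (ball x0 \<tau>) x * ennreal (w x))"
        proof -
          have "indicator (ball x0 \<tau>) x = (1 :: ennreal)" using True ball_subset(3) by (intro indicator_simps) blast
          then show ?thesis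
            unfolding ennreal_mult[OF \<open>0 \<le> ?c\<close> w_nonneg] by (simp only: mult_1_left mult_ac)
        qed
        finally show ?thesis .
      qed (simp add: far_def)
    qed
  qed
  also have "\<dots> = ennreal ?c * T * mass w"
    by (intro nn_integral_cmult) measurable
  finally show ?thesis by (simp add: mult.assoc)
qed

text \<open>The comparison holds at almost every pair, namely where \<open>a\<close> is symmetric.
  Swapping the variables preserves integrals, so each error is counted twice.\<close>

lemma energy_v_le:
  "energy p q Ksp Ktq a \<Omega> v + (\<integral>\<^sup>+z. ennreal (gain z) \<partial>lebesgue)
    \<le> energy p q Ksp Ktq a \<Omega> u + 2 * ((\<integral>\<^sup>+z. ennreal (near z) \<partial>lebesgue) + (\<integral>\<^sup>+z. ennreal (far z) \<partial>lebesgue))"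
proof -
  let ?c = "indicator (cross_dom \<Omega>) :: _ \<Rightarrow> real"
  have m: "(\<lambda>z. near (snd z, fst z)) \<in> borel_measurable lebesgue" "(\<lambda>z. far (snd z, fst z)) \<in> borel_measurable lebesgue"
    by (intro borel_measurable_lebesgue_swap; measurable)+
  have "energy p q Ksp Ktq a \<Omega> v + (\<integral>\<^sup>+z. ennreal (gain z) \<partial>lebesgue)
     = (\<integral>\<^sup>+z. (ennreal (?c z * energy_density v z) + ennreal (gain z)) \<partial>lebesgue)"
    unfolding energy_eq by (intro nn_integral_add[symmetric]) measurable
  also have "\<dots> \<le> (\<integral>\<^sup>+z. (ennreal (?c z * energy_density u z) + ((ennreal (near z) + ennreal (near (snd z, fst z))) + (ennreal (far z) + ennreal (far (snd z, fst z))))) \<partial>lebesgue)"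
  proof (intro nn_integral_mono_AE)
    show "AE z in lebesgue. ennreal (?c z * energy_density v z) + ennreal (gain z) \<le>
       ennreal (?c z * energy_density u z) + ((ennreal (near z) + ennreal (near (snd z, fst z))) + (ennreal (far z) + ennreal (far (snd z, fst z))))"
      using a_sym
    proof eventually_elim
      case (elim z)
      have c: "0 \<le> ?c z * energy_density v z" "0 \<le> ?c z * energy_density u z" by (auto simp: energy_density_nonneg)
      show ?case
        using energy_density_v_le[of "fst z" "snd z"] elim c gain_nonneg[of z] near_nonneg far_nonneg
        by (simp add: ennreal_plus[symmetric] ennreal_leI del: ennreal_plus)
    qed
  qed
  also have "\<dots> = energy p q Ksp Ktq a \<Omega> u + (((\<integral>\<^sup>+z. ennreal (near z) \<partial>lebesgue) + (\<integral>\<^sup>+z. ennreal (near z) \<partial>lebesgue))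
      + ((\<integral>\<^sup>+z. ennreal (far z) \<partial>lebesgue) + (\<integral>\<^sup>+z. ennreal (far z) \<partial>lebesgue)))"
    unfolding energy_eq using m by (simp add: nn_integral_add nn_integral_lebesgue_swap)
  finally show ?thesis by (simp add: mult_2 add_ac)
qed

text \<open>Here the lower half of \<open>a_osc\<close> is used: the infimum \<open>a0\<close> may
  replace \<open>a\<close> on pairs in the ball.\<close>

lemma gagliardo_le_gain:
  "gagliardo p (s * p) (ball x0 \<sigma>) w + ennreal a0 * gagliardo q (t * q) (ball x0 \<sigma>) w
    \<le> ennreal \<Lambda> * (\<integral>\<^sup>+z. ennreal (gain z) \<partial>lebesgue)"
proof -
  let ?B = "ball x0 \<sigma> \<times> ball x0 \<sigma>"
  let ?F = "\<lambda>m \<theta> z. \<bar>w (fst z) - w (snd z)\<bar> powr m / norm (fst z - snd z) powr (real DIM(real^'n) + \<theta>)"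
  have [measurable]: "Measurable.pred lebesgue (\<lambda>z. z \<in> ?B)"
    unfolding mem_Times_iff by measurable
  have "gagliardo p (s * p) (ball x0 \<sigma>) w + ennreal a0 * gagliardo q (t * q) (ball x0 \<sigma>) w
      = (\<integral>\<^sup>+z. (indicator ?B z * ennreal (?F p (s * p) z) + ennreal a0 * (indicator ?B z * ennreal (?F q (t * q) z))) \<partial>lebesgue)"
    unfolding gagliardo_def by (simp add: nn_integral_add nn_integral_cmult)
  also have "\<dots> \<le> (\<integral>\<^sup>+z. ennreal \<Lambda> * ennreal (gain z) \<partial>lebesgue)"
  proof (intro nn_integral_mono)
    fix z :: "(real^'n) \<times> (real^'n)"
    show "indicator ?B z * ennreal (?F p (s * p) z) + ennreal a0 * (indicator ?B z * ennreal (?F q (t * q) z)) \<le> ennreal \<Lambda> * ennreal (gain z)"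
    proof (cases "z \<in> ?B")
      case True
      then have z: "fst z \<in> ball x0 R" "snd z \<in> ball x0 R" using ball_subset unfolding mem_Times_iff by blast+
      have "a0 * ?F q (t * q) z \<le> a (fst z) (snd z) * ?F q (t * q) z"
        using a_osc[OF z] by (intro mult_right_mono) auto
      then have "?F p (s * p) z + a0 * ?F q (t * q) z \<le> \<Lambda> * energy_density w z"
        using energy_density_comparable(2)[of w "fst z" "snd z"] by simp
      moreover have "gain z = energy_density w z" using True by (auto simp: gain_def)
      ultimately show ?thesis
        using True a_inf_nonneg \<Lambda> energy_density_nonneg[of w z]
        by (simp add: ennreal_mult[symmetric] ennreal_plus[symmetric] ennreal_leI del: ennreal_plus)
    qed simp
  qed
  also have "\<dots> = ennreal \<Lambda> * (\<integral>\<^sup>+z. ennreal (gain z) \<partial>lebesgue)"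
    by (intro nn_integral_cmult) measurable
  finally show ?thesis .
qed

text \<open>Finite errors in \<open>energy_v_le\<close> first show that \<open>v\<close> has finite
  energy, hence is admissible. Minimality then replaces the energy of \<open>u\<close> by that of
  \<open>v\<close>, and this finite quantity is cancelled on both sides.\<close>

lemma caccioppoli:
  "gagliardo p (s * p) (ball x0 \<sigma>) w + ennreal a0 * gagliardo q (t * q) (ball x0 \<sigma>) w
    \<le> ennreal (caccioppoli_const (real CARD('n)) s t p q \<Lambda> A N * Q powr (real CARD('n) + q)) * (mass (\<lambda>x. H (w x)) + T * mass w)"
proof -
  let ?near = "\<integral>\<^sup>+z. ennreal (near z) \<partial>lebesgue" and ?far = "\<integral>\<^sup>+z. ennreal (far z) \<partial>lebesgue"
    and ?gain = "\<integral>\<^sup>+z. ennreal (gain z) \<partial>lebesgue" and ?E = "energy p q Ksp Ktq a \<Omega>"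
  let ?d = "real CARD('n)"
  define c1 where "c1 = \<Lambda> * q powr q * 4 powr q * (kernel_const ?d (p - s * p) + kernel_const ?d (q - t * q)) * (1 + 4 * A * N powr (q - p))"
  define c2 where "c2 = q * \<Lambda> * 2 powr (?d + q)"
  have c1: "0 \<le> c1" unfolding c1_def using \<Lambda> A sq_pos
    by (intro mult_nonneg_nonneg add_nonneg_nonneg kernel_const_nonneg) auto
  have c2: "0 \<le> c2" unfolding c2_def using \<Lambda> pq by simp
  have fin: "mass (\<lambda>x. H (w x)) < \<infinity>" "mass w < \<infinity>"
    by (rule mass_finite[of _ "H N"], erule H_mono[OF w_nonneg]) (rule mass_finite[of w N])
  have near: "?near \<le> ennreal (c1 * Q powr (?d + q)) * mass (\<lambda>x. H (w x))"
  proof -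
    have "c1 * Q powr q \<le> c1 * Q powr (?d + q)" using c1 \<sigma>'(5) by (intro mult_left_mono powr_mono) auto
    then show ?thesis using near_integral_le unfolding c1_def[symmetric]
      by (meson ennreal_leI mult_right_mono order_trans zero_le)
  qed
  have far: "?far \<le> ennreal (c2 * Q powr (?d + q)) * (T * mass w)"
    using far_integral_le by (simp add: c2_def)
  have "?near < \<infinity>" "?far < \<infinity>"
    using near far fin T_fin by (auto intro: le_less_trans simp: ennreal_mult_less_top)
  then have fin_rhs: "?E u + 2 * (?near + ?far) < \<infinity>"
    using energy_u_finite by (simp add: ennreal_mult_less_top)
  have E_v: "?E v < \<infinity>"
    by (rule le_less_trans[OF order_trans[OF _ energy_v_le] fin_rhs]) simp
  have "v \<in> space_A s t p q a \<Omega>"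
    using E_v by (intro energy_finite_imp_space_A v_abs_le) auto
  moreover have "v x = u x" if "x \<notin> \<Omega>" for x
  proof -
    have "\<eta> x = 0" using that ball_subset by (intro \<eta>_zero) blast
    then show ?thesis by (simp add: v_def)
  qed
  ultimately have "?E u \<le> ?E v"
    using u_min unfolding minimizer_def by auto
  then have "?E v + ?gain \<le> ?E v + 2 * (?near + ?far)"
    using energy_v_le by (meson add_right_mono order_trans)
  then have gain: "?gain \<le> 2 * (?near + ?far)"
    using E_v unfolding ennreal_add_left_cancel_le by auto
  have "gagliardo p (s * p) (ball x0 \<sigma>) w + ennreal a0 * gagliardo q (t * q) (ball x0 \<sigma>) w \<le> ennreal \<Lambda> * ?gain"
    by (rule gagliardo_le_gain)
  also have "\<dots> \<le> ennreal \<Lambda> * (2 * (ennreal (c1 * Q powr (?d + q)) * mass (\<lambda>x. H (w x)) + ennreal (c2 * Q powr (?d + q)) * (T * mass w)))"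
    by (intro mult_left_mono order_trans[OF gain] add_mono near far) auto
  also have "\<dots> \<le> ennreal \<Lambda> * (2 * (ennreal ((c1 + c2) * Q powr (?d + q)) * mass (\<lambda>x. H (w x)) + ennreal ((c1 + c2) * Q powr (?d + q)) * (T * mass w)))"
    using c1 c2 by (intro mult_left_mono add_mono mult_right_mono ennreal_leI) auto
  also have "\<dots> = ennreal (2 * \<Lambda> * (c1 + c2) * Q powr (?d + q)) * (mass (\<lambda>x. H (w x)) + T * mass w)"
  proof -
    have "ennreal \<Lambda> * (2 * (ennreal (c * X) * m1 + ennreal (c * X) * m2)) = ennreal (2 * \<Lambda> * c * X) * (m1 + m2)"
      if "0 \<le> c" "0 \<le> X" for c X m1 m2
      using that \<Lambda> by (simp add: ennreal_mult distrib_left mult_ac)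
    then show ?thesis using c1 c2 by simp
  qed
  also have "2 * \<Lambda> * (c1 + c2) = caccioppoli_const ?d s t p q \<Lambda> A N"
    by (simp add: caccioppoli_const_def c1_def c2_def)
  finally show ?thesis .
qed

end

section \<open>De Giorgi iteration\<close>

lemma power_powr_swap:
  fixes x z :: real
  shows "(x ^ i) powr z = (x powr z) ^ i"
  by (induction i) (auto simp: powr_mult)

text \<open>The increment of the level for which the threshold of geometric convergence, with
  \<delta> = \<sigma>/d - 1 and D = 2^p, becomes exactly 1. One division by the volume of the unit
  ball comes from \<open>small_support_integral\<close>, the other from normalising by the volume of
  the ball; M + 1 keeps the value positive for M = 0.\<close>

definition sup_excess_const :: "real \<Rightarrow> real \<Rightarrow> real \<Rightarrow> real \<Rightarrow> real" where
  "sup_excess_const d p \<sigma> M =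
     (2 powr (d + \<sigma> + 1 + \<sigma> / d) / unit_ball_vol d / unit_ball_vol d * 2 powr p) powr (1 / p) * (M + 1) * 2 powr (1 / (\<sigma> / d - 1))"

text \<open>De Giorgi iteration for the Gagliardo seminorm alone: in the supercritical range \<open>\<sigma> > d\<close> the
  measure of the superlevel sets decays superlinearly without using an equation.\<close>
lemma supercritical_excess_bound:
  fixes u :: "'a::euclidean_space \<Rightarrow> real"
  assumes r: "0 < r" "r \<le> 1" and p: "1 < p" and \<sigma>: "real DIM('a) < \<sigma>" and M: "0 \<le> M"
    and [measurable]: "u \<in> borel_measurable lebesgue"
    and G: "gagliardo p \<sigma> (ball x0 r) u \<le> ennreal (M powr p)"
    and half: "2 * measure lebesgue {x \<in> ball x0 r. u x > k0} \<le> measure lebesgue (ball x0 r)"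
  shows "AE x in lebesgue. x \<in> ball x0 r \<longrightarrow> u x \<le> k0 + sup_excess_const (real DIM('a)) p \<sigma> M"
proof -
  let ?d = "real DIM('a)" and ?B = "ball x0 r" and ?\<mu> = "measure (lebesgue :: 'a measure)"
  define N where "N = sup_excess_const ?d p \<sigma> M"
  define v where "v = unit_ball_vol ?d"
  have v: "0 < v" by (simp add: v_def)
  define c where "c = 2 powr (?d + \<sigma> + 1 + \<sigma> / ?d) / v"
  have c: "0 < c" using v by (simp add: c_def)
  define \<delta> where "\<delta> = \<sigma> / ?d - 1"
  have d: "0 < ?d" by simp
  have \<delta>: "0 < \<delta>" using \<sigma> d by (simp add: \<delta>_def field_simps)
  have N_eq: "N = (c / v * 2 powr p) powr (1 / p) * (M + 1) * 2 powr (1 / \<delta>)"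
    by (simp add: N_def sup_excess_const_def c_def v_def \<delta>_def)
  have N: "0 < N" using c v M by (simp add: N_eq)
  define K where "K = c / v * 2 powr p * (M + 1) powr p / N powr p"
  have K: "K = (2 powr p) powr (- 1 / \<delta>)" "0 < K"
  proof -
    have "N powr p = c / v * 2 powr p * (M + 1) powr p * (2 powr p) powr (1 / \<delta>)"
      using p c v M by (simp add: N_eq powr_mult powr_powr mult.commute)
    then show "K = (2 powr p) powr (- 1 / \<delta>)" using c v M by (simp add: K_def powr_minus_divide)
    show "0 < K" using c v M N by (simp add: K_def)
  qed
  have B: "?\<mu> ?B = v * r powr ?d"
    using r by (simp add: content_ball powr_realpow v_def)
  have B0: "0 < ?\<mu> ?B" using r by simp
  define k where "k i = k0 + N * (1 - 1 / 2 ^ i)" for i :: nat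
  define A where "A i = {x \<in> ?B. u x > k i}" for i
  have superlevel: "{x \<in> ?B. c < u x} \<in> sets lebesgue" for c
    by (rule superlevel_in_ball_sets) measurable
  have [measurable]: "A i \<in> sets lebesgue" for i
    unfolding A_def by (rule superlevel)
  have em_A: "emeasure lebesgue (A i) = ennreal (?\<mu> (A i))" for i
  proof -
    have "emeasure lebesgue (A i) \<le> emeasure lebesgue ?B" by (intro emeasure_mono) (auto simp: A_def)
    also have "\<dots> < \<infinity>" using r by (simp add: emeasure_ball)
    finally show ?thesis by (intro emeasure_eq_ennreal_measure) simp
  qed
  have k_mono: "k i \<le> k j" if "i \<le> j" for i j
    using that N by (simp add: k_def frac_le power_increasing)
  have A_mono: "?\<mu> (A i) \<le> ?\<mu> (A j)" if "A i \<subseteq> A j" for i j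
  proof -
    have "emeasure lebesgue (A i) \<le> emeasure lebesgue (A j)" using that by (intro emeasure_mono) auto
    then show ?thesis unfolding em_A by simp
  qed
  \<comment> \<open>The levels increase, so the half-measure condition at \<open>k0\<close> passes
    on to every step.\<close>
  have A_half: "2 * ?\<mu> (A i) \<le> ?\<mu> ?B" for i
  proof -
    have "A i \<subseteq> A 0" using k_mono[of 0 i] by (auto simp: A_def)
    then have "?\<mu> (A i) \<le> ?\<mu> (A 0)" by (rule A_mono)
    moreover have "k 0 = k0" by (simp add: k_def)
    then have "2 * ?\<mu> (A 0) \<le> ?\<mu> ?B" using half by (simp only: A_def)
    ultimately show ?thesis by linarith
  qed
  define \<beta> where "\<beta> i = ?\<mu> (A i) / ?\<mu> ?B" for i
  have \<beta>0: "0 \<le> \<beta> i" for i by (simp add: \<beta>_def)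
  have step: "\<beta> (Suc i) \<le> K * (2 powr p) ^ i * \<beta> i powr (1 + \<delta>)" for i
  proof -
    define f where "f x = max (u x - k i) 0" for x
    have [measurable]: "f \<in> borel_measurable lebesgue" unfolding f_def[abs_def] by measurable
    have "gagliardo p \<sigma> ?B f \<le> gagliardo p \<sigma> ?B u"
      unfolding gagliardo_def f_def using p
      by (intro nn_integral_mono mult_left_mono ennreal_leI divide_right_mono powr_mono2) auto
    also note G
    finally have Gf: "gagliardo p \<sigma> ?B f \<le> ennreal (M powr p)" .
    have kk: "k (Suc i) - k i = N / 2 ^ Suc i" by (simp add: k_def field_simps)
    have "ennreal ((N / 2 ^ Suc i) powr p * ?\<mu> (A (Suc i))) = (\<integral>\<^sup>+x. ennreal ((N / 2 ^ Suc i) powr p) * indicator (A (Suc i)) x \<partial>lebesgue)"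
      by (subst nn_integral_cmult_indicator) (auto simp: em_A ennreal_mult)
    also have "\<dots> \<le> (\<integral>\<^sup>+x. indicator ?B x * ennreal (\<bar>f x\<bar> powr p) \<partial>lebesgue)"
    proof (intro nn_integral_mono)
      fix x
      show "ennreal ((N / 2 ^ Suc i) powr p) * indicator (A (Suc i)) x \<le> indicator ?B x * ennreal (\<bar>f x\<bar> powr p)"
      proof (cases "x \<in> A (Suc i)")
        case True
        then have "N / 2 ^ Suc i \<le> \<bar>f x\<bar>" using kk by (auto simp: A_def f_def)
        then show ?thesis using True N p by (auto simp: A_def intro!: ennreal_leI powr_mono2)
      qed simp
    qed
    also have "\<dots> \<le> ennreal (c * r powr \<sigma> * \<beta> i powr (\<sigma> / ?d)) * gagliardo p \<sigma> ?B f"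
    proof -
      have "A i \<in> sets lebesgue" "A i \<subseteq> ?B" "f \<in> borel_measurable lebesgue"
        by (measurable, auto simp: A_def)
      moreover have "f y = 0" if "y \<in> ?B" "y \<notin> A i" for y
        using that by (simp add: A_def f_def)
      ultimately show ?thesis
        unfolding c_def v_def \<beta>_def
        by (intro small_support_integral[OF r(1) less_trans[OF d \<sigma>] less_trans[OF zero_less_one p] _ _ A_half])
    qed
    also have "\<dots> \<le> ennreal (c * r powr \<sigma> * \<beta> i powr (\<sigma> / ?d)) * ennreal (M powr p)"
      by (intro mult_left_mono Gf) simp
    also have "\<dots> = ennreal (c * r powr \<sigma> * \<beta> i powr (\<sigma> / ?d) * M powr p)"
      using c by (subst ennreal_mult) auto
    finally have "(N / 2 ^ Suc i) powr p * ?\<mu> (A (Suc i)) \<le> c * r powr \<sigma> * \<beta> i powr (\<sigma> / ?d) * M powr p"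
      using c by (subst (asm) ennreal_le_iff) auto
    \<comment> \<open>Since r <= 1 and \<sigma> exceeds the dimension, r^\<sigma> is at most r^d,
      which cancels against the volume of the ball; the constant becomes independent of the
      radius.\<close>
    also have "\<dots> \<le> c * r powr ?d * \<beta> i powr (\<sigma> / ?d) * (M + 1) powr p"
      using c r \<sigma> M p by (intro mult_mono[OF mult_right_mono[OF mult_left_mono]] powr_mono' powr_mono2) auto
    finally have *: "(N / 2 ^ Suc i) powr p * ?\<mu> (A (Suc i)) \<le> c * r powr ?d * \<beta> i powr (\<sigma> / ?d) * (M + 1) powr p" .
    have "(N / 2 ^ Suc i) powr p = N powr p / (2 powr p * (2 powr p) ^ i)"
      by (simp add: powr_divide powr_mult power_powr_swap)
    note * = *[unfolded this]
    have "m \<le> X * E / P" if "P / E * m \<le> X" "0 < P" "0 < E" for m X E P :: real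
      using that by (simp add: field_simps)
    from this[OF *] have "?\<mu> (A (Suc i)) \<le> c * r powr ?d * \<beta> i powr (\<sigma> / ?d) * (M + 1) powr p * (2 powr p * (2 powr p) ^ i) / N powr p"
      using N by simp
    then have "\<beta> (Suc i) \<le> c * r powr ?d * \<beta> i powr (\<sigma> / ?d) * (M + 1) powr p * (2 powr p * (2 powr p) ^ i) / N powr p / ?\<mu> ?B"
      unfolding \<beta>_def using B0 by (intro divide_right_mono) auto
    also have "\<dots> = K * (2 powr p) ^ i * \<beta> i powr (\<sigma> / ?d)"
      using r v unfolding B by (simp add: K_def field_simps)
    finally show ?thesis by (simp add: \<delta>_def)
  qed
  have "\<beta> \<longlonglongrightarrow> 0"
  proof (rule fast_geometric_convergence[OF \<delta> _ K(2) \<beta>0 step])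
    show "1 < 2 powr p" using p by simp
    \<comment> \<open>With threshold 1 the initial condition holds automatically, as a relative
      measure never exceeds 1.\<close>
    have "K powr (- 1 / \<delta>) * (2 powr p) powr (- 1 / \<delta>\<^sup>2) = 1"
      using \<delta> unfolding K(1) powr_powr powr_add[symmetric] by (simp add: power2_eq_square)
    moreover have "\<beta> 0 \<le> 1"
      using A_half[of 0] order_trans[OF _ A_half[of 0], of "?\<mu> (A 0)"] B0 by (simp add: \<beta>_def divide_le_eq)
    ultimately show "\<beta> 0 \<le> K powr (- 1 / \<delta>) * (2 powr p) powr (- 1 / \<delta>\<^sup>2)" by simp
  qed
  then have lim: "(\<lambda>i. \<beta> i * ?\<mu> ?B) \<longlonglongrightarrow> 0 * ?\<mu> ?B" by (intro tendsto_mult tendsto_const)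
  define S where "S = {x \<in> ?B. u x > k0 + N}"
  have [measurable]: "S \<in> sets lebesgue"
    unfolding S_def by (rule superlevel)
  have S_le: "emeasure lebesgue S \<le> ennreal (\<beta> i * ?\<mu> ?B)" for i
  proof -
    have "k i \<le> k0 + N" using N by (simp add: k_def mult_le_cancel_left1)
    then have "S \<subseteq> A i" by (auto simp: S_def A_def)
    then have "emeasure lebesgue S \<le> emeasure lebesgue (A i)" by (intro emeasure_mono) auto
    then show ?thesis using B0 by (simp add: em_A \<beta>_def)
  qed
  have "emeasure lebesgue S \<le> ennreal 0"
    using tendsto_ennrealI[OF lim] S_le by (intro LIMSEQ_le_const) auto
  then have "S \<in> null_sets lebesgue" by (intro null_setsI) auto
  then have "AE x in lebesgue. x \<notin> S" by (rule AE_not_in)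
  then show ?thesis by eventually_elim (auto simp: S_def N_def not_less)
qed

text \<open>The smaller of the gains s p / n and t q / n, so that one power of the relative measure
  serves both phases.\<close>

definition decay_exponent :: "real \<Rightarrow> real \<Rightarrow> real \<Rightarrow> real \<Rightarrow> real \<Rightarrow> real" where
  "decay_exponent d s t p q = min (s * p) (t * q) / d"

text \<open>In order: the small-support constants of the two phases; the Caccioppoli constant,
  enlarged by 1 for the integral of \<open>H\<close> itself; 2^(d \<delta>) for comparing the balls;
  and the power of 2^(i + 1) at i = 0.\<close>

definition iteration_const :: "real \<Rightarrow> real \<Rightarrow> real \<Rightarrow> real \<Rightarrow> real \<Rightarrow> real \<Rightarrow> real \<Rightarrow> real \<Rightarrow> real" where
  "iteration_const d s t p q \<Lambda> A N = (let \<delta> = decay_exponent d s t p q in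
     (2 powr (d + s * p + 1 + s * p / d) / unit_ball_vol d + 2 powr \<delta> + (2 powr (d + t * q + 1 + t * q / d) / unit_ball_vol d + 2 powr \<delta>))
     * (2 * caccioppoli_const d s t p q \<Lambda> A N + 1) * 2 powr (d * \<delta>) * 2 powr (d + 2 * q + q * \<delta>))"

text \<open>Growth per step. The factor 2^(i + 1) enters with exponent d + q through the ratio of
  radii, q through the tail term, and q \<delta> through Chebyshev's inequality.\<close>

definition iteration_base :: "real \<Rightarrow> real \<Rightarrow> real \<Rightarrow> real \<Rightarrow> real \<Rightarrow> real" where
  "iteration_base d s t p q = 2 powr (d + 2 * q + q * decay_exponent d s t p q)"

lemma iteration_const_pos:
  assumes "0 \<le> caccioppoli_const d s t p q \<Lambda> A N" "0 \<le> d"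
  shows "0 < iteration_const d s t p q \<Lambda> A N"
  unfolding iteration_const_def Let_def using assms
  by (intro mult_pos_pos add_nonneg_pos add_pos_pos) auto

section \<open>Growth of \<open>H\<close> and \<open>h\<close>, and the gain for functions of small
  support\<close>

context double_phase
begin

abbreviation "h \<equiv> h_fun s t p q a x0 R"

lemma H_eq_mult_h: "0 \<le> x \<Longrightarrow> H x = x * h x"
  using powr_mult_base[of x "p - 1"] powr_mult_base[of x "q - 1"]
  by (simp add: H_fun_def h_fun_def distrib_left mult_ac)

lemma h_mono: "0 \<le> x \<Longrightarrow> x \<le> y \<Longrightarrow> h x \<le> h y"
  unfolding h_fun_def using a_inf_nonneg pq R
  by (intro add_mono mult_left_mono divide_right_mono powr_mono2) auto

lemma h_nonneg: "0 \<le> h x"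
  using a_inf_nonneg by (simp add: h_fun_def)

lemma H_pos: "0 < x \<Longrightarrow> 0 < H x"
  using a_inf_nonneg R by (auto simp: H_fun_def intro!: add_pos_nonneg)

text \<open>The larger exponent q - 1 governs the loss when the argument is divided; this is used to
  descend from \<open>K\<close> to the gap between consecutive levels.\<close>

lemma h_divide_ge:
  assumes "0 \<le> x" "1 \<le> c"
  shows "h x \<le> c powr (q - 1) * h (x / c)"
proof -
  have *: "x powr (m - 1) = c powr (m - 1) * (x / c) powr (m - 1)" for m
    using assms by (simp add: powr_mult[symmetric])
  have "x powr (p - 1) \<le> c powr (q - 1) * (x / c) powr (p - 1)"
    unfolding *[of p] using assms pq by (intro mult_right_mono powr_mono) auto
  then have "x powr (p - 1) / R powr (s * p) \<le> c powr (q - 1) * ((x / c) powr (p - 1) / R powr (s * p))"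
    unfolding times_divide_eq_right by (rule divide_right_mono) simp
  moreover have "a0 * (x powr (q - 1) / R powr (t * q)) = c powr (q - 1) * (a0 * ((x / c) powr (q - 1) / R powr (t * q)))"
    by (subst *[of q]) (simp only: times_divide_eq_right mult_ac)
  ultimately show ?thesis unfolding h_fun_def distrib_left by linarith
qed

lemma H_divide_ge:
  assumes "0 \<le> x" "1 \<le> c"
  shows "H x \<le> c powr q * H (x / c)"
proof -
  have "H x = x * h x" using assms by (simp add: H_eq_mult_h)
  also have "\<dots> \<le> x * (c powr (q - 1) * h (x / c))" using assms by (intro mult_left_mono h_divide_ge)
  also have "\<dots> = c powr q * (x / c * h (x / c))"
    using assms powr_mult_base[of c "q - 1"] by (simp add: field_simps)
  finally show ?thesis using assms by (simp add: H_eq_mult_h)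
qed

text \<open>Growth from below is governed by the smaller exponent p.\<close>

lemma H_mult_ge:
  assumes "0 \<le> x" "1 \<le> c"
  shows "c powr p * H x \<le> H (c * x)"
proof -
  have "c powr p * x powr q \<le> c powr q * x powr q"
    using assms pq by (intro mult_right_mono powr_mono) auto
  then have "a0 * (c powr p * x powr q / R powr (t * q)) \<le> a0 * (c powr q * x powr q / R powr (t * q))"
    using a_inf_nonneg by (intro mult_left_mono divide_right_mono) auto
  then show ?thesis using assms by (simp add: H_fun_def powr_mult distrib_left mult_ac)
qed

lemma decay_exponent_bounds:
  defines "\<delta> \<equiv> decay_exponent (real CARD('n)) s t p q"
  shows "0 < \<delta>" "\<delta> \<le> s * p / real CARD('n)" "\<delta> \<le> t * q / real CARD('n)"
  using sq_pos by (auto simp: \<delta>_def decay_exponent_def divide_right_mono)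

text \<open>The p-phase has weight 1 / R^(s p) and the q-phase a0 / R^(t q). The factor r^\<theta>
  of the small-support inequality is at most R^\<theta> and cancels the denominator, so the
  seminorms occur with weights 1 and \<open>a0\<close>, just as in the Caccioppoli
  inequality.\<close>

lemma H_small_support:
  assumes r: "0 < r" "r \<le> R" and S: "S \<in> sets lebesgue" "S \<subseteq> ball x0 r"
    and f0: "\<And>y. y \<in> ball x0 r \<Longrightarrow> y \<notin> S \<Longrightarrow> f y = 0" and fnn: "\<And>y. 0 \<le> f y"
    and f[measurable]: "f \<in> borel_measurable lebesgue"
  defines "d \<equiv> real CARD('n)" and "\<delta> \<equiv> decay_exponent (real CARD('n)) s t p q"
  shows "(\<integral>\<^sup>+x. indicator (ball x0 r) x * ennreal (H (f x)) \<partial>lebesgue)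
    \<le> ennreal ((2 powr (d + s * p + 1 + s * p / d) / unit_ball_vol d + 2 powr \<delta> + (2 powr (d + t * q + 1 + t * q / d) / unit_ball_vol d + 2 powr \<delta>))
        * (measure lebesgue S / measure lebesgue (ball x0 r)) powr \<delta>)
      * (gagliardo p (s * p) (ball x0 r) f + ennreal a0 * gagliardo q (t * q) (ball x0 r) f
          + (\<integral>\<^sup>+x. indicator (ball x0 r) x * ennreal (H (f x)) \<partial>lebesgue))"
proof -
  note \<delta> = decay_exponent_bounds[folded \<delta>_def]
  let ?I = "\<lambda>m. \<integral>\<^sup>+x. indicator (ball x0 r) x * ennreal (\<bar>f x\<bar> powr m) \<partial>lebesgue"
  let ?IH = "\<integral>\<^sup>+x. indicator (ball x0 r) x * ennreal (H (f x)) \<partial>lebesgue"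
  let ?\<beta> = "(measure lebesgue S / measure lebesgue (ball x0 r)) powr \<delta>"
  define cp where "cp = 2 powr (d + s * p + 1 + s * p / d) / unit_ball_vol d + 2 powr \<delta>"
  define cq where "cq = 2 powr (d + t * q + 1 + t * q / d) / unit_ball_vol d + 2 powr \<delta>"
  have v: "0 < unit_ball_vol d" by (simp add: d_def)
  have c: "0 \<le> cp" "0 \<le> cq" using v by (auto simp: cp_def cq_def)
  have IH: "?IH = ennreal (1 / R powr (s * p)) * ?I p + ennreal (a0 / R powr (t * q)) * ?I q"
  proof -
    have "?IH = (\<integral>\<^sup>+x. ennreal (1 / R powr (s * p)) * (indicator (ball x0 r) x * ennreal (\<bar>f x\<bar> powr p))
        + ennreal (a0 / R powr (t * q)) * (indicator (ball x0 r) x * ennreal (\<bar>f x\<bar> powr q)) \<partial>lebesgue)"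
      using fnn a_inf_nonneg
      by (intro nn_integral_cong) (auto simp: H_fun_def indicator_def ennreal_mult[symmetric] ennreal_plus[symmetric] simp del: ennreal_plus)
    then show ?thesis by (simp add: nn_integral_add nn_integral_cmult)
  qed
  have phase: "ennreal (b / R powr \<theta>) * ?I m \<le> ennreal ((cp + cq) * ?\<beta>) * (ennreal b * gagliardo m \<theta> (ball x0 r) f + ennreal (b / R powr \<theta>) * ?I m)"
    if m: "0 < m" "0 < \<theta>" "0 \<le> b" "\<delta> \<le> \<theta> / d" and le: "2 powr (d + \<theta> + 1 + \<theta> / d) / unit_ball_vol d + 2 powr \<delta> \<le> cp + cq" for m \<theta> b
  proof -
    have "?I m \<le> ennreal ((2 powr (d + \<theta> + 1 + \<theta> / d) / unit_ball_vol d + 2 powr \<delta>) * ?\<beta>) * (ennreal (r powr \<theta>) * gagliardo m \<theta> (ball x0 r) f + ?I m)"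
      using small_support_integral_any[of r \<theta> m \<delta> S x0 f] r m \<delta>(1) S f0 by (simp add: d_def)
    also have "\<dots> \<le> ennreal ((cp + cq) * ?\<beta>) * (ennreal (R powr \<theta>) * gagliardo m \<theta> (ball x0 r) f + ?I m)"
    proof (intro mult_mono[of "ennreal _" "ennreal _"])
      show "ennreal ((2 powr (d + \<theta> + 1 + \<theta> / d) / unit_ball_vol d + 2 powr \<delta>) * ?\<beta>) \<le> ennreal ((cp + cq) * ?\<beta>)"
        using le by (intro ennreal_leI mult_right_mono) auto
      show "ennreal (r powr \<theta>) * gagliardo m \<theta> (ball x0 r) f + ?I m \<le> ennreal (R powr \<theta>) * gagliardo m \<theta> (ball x0 r) f + ?I m"
        using r m by (intro add_mono mult_right_mono ennreal_leI powr_mono2) auto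
    qed auto
    finally have "ennreal (b / R powr \<theta>) * ?I m \<le> ennreal (b / R powr \<theta>) * (ennreal ((cp + cq) * ?\<beta>) * (ennreal (R powr \<theta>) * gagliardo m \<theta> (ball x0 r) f + ?I m))"
      by (rule mult_left_mono) simp
    also have "\<dots> = ennreal ((cp + cq) * ?\<beta>) * ((ennreal (b / R powr \<theta>) * ennreal (R powr \<theta>)) * gagliardo m \<theta> (ball x0 r) f + ennreal (b / R powr \<theta>) * ?I m)"
      by (simp only: distrib_left mult_ac)
    also have "ennreal (b / R powr \<theta>) * ennreal (R powr \<theta>) = ennreal b"
      using R m by (simp add: ennreal_mult[symmetric])
    finally show ?thesis .
  qed
  have "?IH \<le> ennreal ((cp + cq) * ?\<beta>) * (ennreal 1 * gagliardo p (s * p) (ball x0 r) f + ennreal (1 / R powr (s * p)) * ?I p)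
     + ennreal ((cp + cq) * ?\<beta>) * (ennreal a0 * gagliardo q (t * q) (ball x0 r) f + ennreal (a0 / R powr (t * q)) * ?I q)"
    unfolding IH using sq_pos pq \<delta> a_inf_nonneg c
    by (intro add_mono[OF phase phase]) (auto simp: cp_def[symmetric] cq_def[symmetric] d_def[symmetric])
  also have "\<dots> = ennreal ((cp + cq) * ?\<beta>) * (gagliardo p (s * p) (ball x0 r) f + ennreal a0 * gagliardo q (t * q) (ball x0 r) f + ?IH)"
    unfolding IH by (simp add: distrib_left add_ac)
  finally show ?thesis by (simp add: cp_def cq_def)
qed

lemma chebyshev_H:
  assumes [measurable]: "f \<in> borel_measurable lebesgue" and c: "0 \<le> c"
    and S: "S \<in> sets lebesgue" "S \<subseteq> B" "\<And>x. x \<in> S \<Longrightarrow> c \<le> f x"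
  shows "ennreal (H c) * emeasure lebesgue S \<le> (\<integral>\<^sup>+x. indicator B x * ennreal (H (f x)) \<partial>lebesgue)"
proof -
  have "ennreal (H c) * emeasure lebesgue S = (\<integral>\<^sup>+x. ennreal (H c) * indicator S x \<partial>lebesgue)"
    using S by (subst nn_integral_cmult_indicator) auto
  also have "\<dots> \<le> (\<integral>\<^sup>+x. indicator B x * ennreal (H (f x)) \<partial>lebesgue)"
    using S c by (intro nn_integral_mono) (auto simp: indicator_def intro!: ennreal_leI H_mono)
  finally show ?thesis .
qed

lemma caccioppoli_const_nonneg: "0 \<le> caccioppoli_const (real CARD('n)) s t p q \<Lambda> A N"
  unfolding caccioppoli_const_def using \<Lambda> A sq_pos
  by (intro mult_nonneg_nonneg add_nonneg_nonneg kernel_const_nonneg) auto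

text \<open>The small-support inequality on the smaller ball is fed with the Caccioppoli inequality
  between the two radii, which is linear in \<open>Y i\<close>. The extra power of
  \<open>Y i\<close> comes from Chebyshev's inequality for the support of the new truncation, where
  the old one is at least the gap of the levels.\<close>

lemma de_giorgi_step:
  fixes k0 K \<rho> r N :: real and i :: nat
  assumes radii: "R / 2 \<le> \<rho>" "\<rho> < r" "r \<le> R" and k0: "0 \<le> k0" and K: "0 < K" and N: "0 \<le> N"
    and bound: "AE x in lebesgue. x \<in> ball x0 r \<longrightarrow> max (u x - k0) 0 \<le> N"
    and T: "T \<le> ennreal (h K)"
  defines "\<delta> \<equiv> decay_exponent (real CARD('n)) s t p q"
    and "Y \<equiv> \<lambda>i. \<integral>\<^sup>+x. indicator (ball x0 (\<rho> + (r - \<rho>) / 2 ^ i)) x * ennreal (H (max (u x - (k0 + K * (1 - 1 / 2 ^ i))) 0)) \<partial>lebesgue"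
  assumes fin: "Y i < \<infinity>"
  shows "Y (Suc i) \<le> ennreal (iteration_const (real CARD('n)) s t p q \<Lambda> A N * (R / (r - \<rho>)) powr (real CARD('n) + q)
      * iteration_base (real CARD('n)) s t p q ^ i * (enn2real (Y i) / (H K * measure lebesgue (ball x0 R))) powr \<delta>) * Y i"
proof -
  note \<delta> = decay_exponent_bounds[folded \<delta>_def]
  let ?d = "real CARD('n)"
  define \<sigma> where "\<sigma> = \<rho> + (r - \<rho>) / 2 ^ Suc i"
  define \<tau> where "\<tau> = \<rho> + (r - \<rho>) / 2 ^ i"
  define k where "k = k0 + K * (1 - 1 / 2 ^ Suc i)"
  define k' where "k' = k0 + K * (1 - 1 / 2 ^ i)"
  define f where "f x = max (u x - k) 0" for x
  define f' where "f' x = max (u x - k') 0" for x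
  \<comment> \<open>\<open>c\<close> measures both gaps: the levels differ by K / c and the radii by
    (r - \<rho>) / c.\<close>
  define c where "c = (2::real) ^ Suc i"
  have c1: "1 \<le> c" unfolding c_def by (rule one_le_power) simp
  have c_powr: "c powr z = 2 powr z * (2 powr z) ^ i" for z
    by (simp add: c_def powr_mult power_powr_swap)
  have kk: "k - k' = K / c" by (simp add: k_def k'_def c_def field_simps)
  have kk': "k' \<le> k" using kk divide_nonneg_nonneg[of K c] K c1 by linarith
  have k'0: "k0 \<le> k'" using K by (simp add: k'_def)
  have [measurable]: "f \<in> borel_measurable lebesgue" "f' \<in> borel_measurable lebesgue"
    unfolding f_def[abs_def] f'_def[abs_def] by measurable
  have \<tau>\<sigma>: "\<tau> - \<sigma> = (r - \<rho>) / c" by (simp add: \<tau>_def \<sigma>_def c_def field_simps)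
  have "0 < \<tau> - \<sigma>" unfolding \<tau>\<sigma> using radii c1 by (intro divide_pos_pos) auto
  have \<sigma>: "\<rho> \<le> \<sigma>" using radii by (simp add: \<sigma>_def)
  have \<tau>: "\<tau> \<le> r" using radii mult_left_mono[of 1 "2 ^ i" "r - \<rho>"] by (simp add: \<tau>_def field_simps)
  interpret cut: double_phase_cutoff s t p q \<Lambda> A \<Omega> Ksp Ktq a x0 R u k \<sigma> \<tau> N
  proof unfold_locales
    show "0 \<le> k" using k0 k'0 kk' by simp
    show "R / 2 \<le> \<sigma>" "\<sigma> < \<tau>" "\<tau> \<le> R" using radii \<sigma> \<tau> \<open>0 < \<tau> - \<sigma>\<close> by auto
    show "0 \<le> N" by (rule N)
    show "T < \<infinity>" using T by (rule le_less_trans) simp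
    show "AE x in lebesgue. x \<in> ball x0 \<tau> \<longrightarrow> max (u x - k) 0 \<le> N"
      using bound by eventually_elim (use \<tau> k'0 kk' in auto)
  qed
  have f_w: "cut.w = f" by (simp add: cut.w_def f_def fun_eq_iff)
  have Y: "Y i = (\<integral>\<^sup>+x. indicator (ball x0 \<tau>) x * ennreal (H (f' x)) \<partial>lebesgue)"
     "Y (Suc i) = (\<integral>\<^sup>+x. indicator (ball x0 \<sigma>) x * ennreal (H (f x)) \<partial>lebesgue)"
    by (simp_all add: Y_def \<tau>_def \<sigma>_def k_def k'_def f_def f'_def)
  have ff': "f x \<le> f' x" "0 \<le> f x" "0 \<le> f' x" for x using kk' by (auto simp: f_def f'_def)
  have f'_ge: "K / c \<le> f' x" if "0 < f x" for x using that kk by (auto simp: f_def f'_def)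
  define S where "S = {x \<in> ball x0 \<sigma>. 0 < f x}"
  have S[measurable]: "S \<in> sets lebesgue"
    unfolding S_def by (rule superlevel_in_ball_sets) measurable
  have mass1: "cut.mass (\<lambda>x. H (f x)) \<le> Y i"
    unfolding Y using ff' by (intro nn_integral_mono mult_left_mono ennreal_leI H_mono) auto
  \<comment> \<open>Where f > 0 the older truncation \<open>f'\<close> is at least K / c, so
    \<open>h K\<close> is at most a power of \<open>c\<close> times \<open>h (f' x)\<close>. With f
    <= f' and H x = x h x, the linear tail term becomes an integral of \<open>H\<close>.\<close>
  have mass2: "T * cut.mass f \<le> ennreal (c powr q) * Y i"
  proof -
    have "T * cut.mass f \<le> ennreal (h K) * cut.mass f" by (intro mult_right_mono T) simp
    also have "\<dots> = (\<integral>\<^sup>+x. ennreal (h K) * (indicator (ball x0 \<tau>) x * ennreal (f x)) \<partial>lebesgue)"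
      by (intro nn_integral_cmult[symmetric]) measurable
    also have "\<dots> \<le> (\<integral>\<^sup>+x. ennreal (c powr q) * (indicator (ball x0 \<tau>) x * ennreal (H (f' x))) \<partial>lebesgue)"
    proof (intro nn_integral_mono)
      fix x
      have "h K * f x \<le> c powr q * H (f' x)"
      proof (cases "0 < f x")
        case True
        have "h K \<le> c powr (q - 1) * h (K / c)" using K c1 by (intro h_divide_ge) auto
        also have "\<dots> \<le> c powr q * h (f' x)"
          using K c1 f'_ge[OF True] h_nonneg by (intro mult_mono powr_mono h_mono) auto
        finally have "h K * f x \<le> c powr q * h (f' x) * f' x"
          using ff'[of x] h_nonneg by (intro mult_mono) auto
        then show ?thesis using ff'[of x] by (simp add: H_eq_mult_h mult_ac)
      next
        case False
        then have "f x = 0" using ff'(2)[of x] by simp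
        then show ?thesis using H_nonneg by simp
      qed
      then show "ennreal (h K) * (indicator (ball x0 \<tau>) x * ennreal (f x)) \<le> ennreal (c powr q) * (indicator (ball x0 \<tau>) x * ennreal (H (f' x)))"
        using h_nonneg ff' H_nonneg by (auto simp: indicator_def ennreal_mult[symmetric] intro!: ennreal_leI)
    qed
    also have "\<dots> = ennreal (c powr q) * Y i"
      unfolding Y by (intro nn_integral_cmult) measurable
    finally show ?thesis .
  qed
  define cc where "cc = caccioppoli_const ?d s t p q \<Lambda> A N"
  have cc: "0 \<le> cc" unfolding cc_def by (rule caccioppoli_const_nonneg)
  define Q0 where "Q0 = R / (r - \<rho>)"
  have Q0: "1 \<le> Q0" using radii R by (simp add: Q0_def)
  have Q: "cut.Q = Q0 * c" by (simp add: cut.Q_def \<tau>\<sigma> Q0_def)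
  define gag where "gag = gagliardo p (s * p) (ball x0 \<sigma>) f + ennreal a0 * gagliardo q (t * q) (ball x0 \<sigma>) f"
  have "gag \<le> ennreal (cc * cut.Q powr (?d + q)) * (cut.mass (\<lambda>x. H (f x)) + T * cut.mass f)"
    using cut.caccioppoli unfolding f_w gag_def cc_def .
  also have "\<dots> \<le> ennreal (cc * cut.Q powr (?d + q)) * (ennreal (c powr q) * Y i + ennreal (c powr q) * Y i)"
  proof -
    have "1 * Y i \<le> ennreal (c powr q) * Y i"
      using c1 sq_pos by (intro mult_right_mono) (auto intro: ge_one_powr_ge_zero)
    then show ?thesis using mass1 mass2 by (intro mult_left_mono add_mono) auto
  qed
  also have "\<dots> = ennreal (2 * cc * cut.Q powr (?d + q) * c powr q) * Y i"
    using cc by (simp add: ennreal_mult distrib_left[symmetric] mult_ac mult_2[symmetric])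
  finally have gag: "gag \<le> ennreal (2 * cc * cut.Q powr (?d + q) * c powr q) * Y i" .
  define z where "z = Q0 powr (?d + q) * c powr (?d + 2 * q)"
  have z: "cut.Q powr (?d + q) * c powr q = z"
    unfolding Q z_def powr_mult using powr_add[of c "?d + q" q] by (simp add: add_ac)
  have z1: "1 \<le> z" unfolding z_def using Q0 c1 sq_pos
    by (intro mult_ge1_I ge_one_powr_ge_zero) auto
  have YS: "Y (Suc i) \<le> Y i"
    unfolding Y using ff' \<open>0 < \<tau> - \<sigma>\<close>
    by (intro nn_integral_mono mult_mono ennreal_leI H_mono) (auto simp: indicator_def)
  \<comment> \<open>\<open>Y (Suc i)\<close> occurs on the right of the small-support inequality as
    well; being at most \<open>Y i\<close>, it does no harm.\<close>
  have sum: "gag + Y (Suc i) \<le> ennreal ((2 * cc + 1) * z) * Y i"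
  proof -
    have "gag + Y (Suc i) \<le> ennreal (2 * cc * z) * Y i + ennreal z * Y i"
      using gag YS z z1 mult_right_mono[of 1 "ennreal z" "Y i"] by (intro add_mono) (auto simp: mult.assoc)
    also have "\<dots> = ennreal (2 * cc * z + z) * Y i"
      using cc z1 by (simp add: distrib_right)
    also have "2 * cc * z + z = (2 * cc + 1) * z" by (simp add: algebra_simps)
    finally show ?thesis .
  qed
  define \<beta> where "\<beta> = measure lebesgue S / measure lebesgue (ball x0 \<sigma>)"
  define y where "y = enn2real (Y i) / (H K * measure lebesgue (ball x0 R))"
  have \<beta>: "\<beta> \<le> 2 powr ?d * c powr q * y"
  proof -
    have em_S: "emeasure lebesgue S = ennreal (measure lebesgue S)"
    proof -
      have "S \<subseteq> ball x0 \<sigma>" by (auto simp: S_def)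
      then have "emeasure lebesgue S \<le> emeasure lebesgue (ball x0 \<sigma>)" by (intro emeasure_mono) auto
      also have "\<dots> < \<infinity>" using cut.\<sigma>'(3) by (simp add: emeasure_ball)
      finally show ?thesis by (intro emeasure_eq_ennreal_measure) simp
    qed
    have "ennreal (H (K / c) * measure lebesgue S) \<le> Y i"
    proof -
      have "S \<subseteq> ball x0 \<tau>" using \<open>0 < \<tau> - \<sigma>\<close> by (auto simp: S_def)
      moreover have "K / c \<le> f' x" if "x \<in> S" for x using that f'_ge by (simp add: S_def)
      moreover have "0 \<le> K / c" using K c1 by simp
      moreover have "f' \<in> borel_measurable lebesgue" by measurable
      ultimately show ?thesis
        unfolding Y ennreal_mult[OF H_nonneg measure_nonneg] em_S[symmetric]
        by (intro chebyshev_H S)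
    qed
    also have "Y i = ennreal (enn2real (Y i))" using fin by simp
    finally have "H (K / c) * measure lebesgue S \<le> enn2real (Y i)" by simp
    then have "c powr q * (H (K / c) * measure lebesgue S) \<le> c powr q * enn2real (Y i)" by (intro mult_left_mono) auto
    moreover have "H K * measure lebesgue S \<le> c powr q * H (K / c) * measure lebesgue S"
      using K c1 by (intro mult_right_mono H_divide_ge) auto
    ultimately have "H K * measure lebesgue S \<le> c powr q * enn2real (Y i)" by simp
    then have 1: "measure lebesgue S \<le> c powr q * enn2real (Y i) / H K" using H_pos[OF K] by (simp add: field_simps)
    have vol: "measure lebesgue (ball x0 z) = unit_ball_vol ?d * z powr ?d" if "0 < z" for z
      using that by (simp add: content_ball powr_realpow)
    have v: "0 < unit_ball_vol ?d" by simp
    \<comment> \<open>As \<sigma> is at least R / 2, the ball of radius \<open>R\<close> replaces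
      that of radius \<sigma> at the price 2^n, and the normalisation of \<open>Y i\<close> no
      longer depends on \<open>i\<close>.\<close>
    have "measure lebesgue (ball x0 R) = 2 powr ?d * (unit_ball_vol ?d * (R / 2) powr ?d)"
      unfolding vol[OF R] by (simp add: powr_divide)
    also have "\<dots> \<le> 2 powr ?d * measure lebesgue (ball x0 \<sigma>)"
      using cut.radii cut.\<sigma>' R v by (subst vol) (auto intro!: mult_left_mono powr_mono2 less_imp_le[OF v])
    finally have 2: "measure lebesgue (ball x0 R) \<le> 2 powr ?d * measure lebesgue (ball x0 \<sigma>)" .
    have pos: "0 < measure lebesgue (ball x0 R)" "0 < measure lebesgue (ball x0 \<sigma>)" using R cut.\<sigma>' by auto
    have "\<beta> \<le> c powr q * enn2real (Y i) / H K / measure lebesgue (ball x0 \<sigma>)"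
      unfolding \<beta>_def using 1 by (intro divide_right_mono) auto
    also have "\<dots> \<le> c powr q * enn2real (Y i) / H K * (2 powr ?d / measure lebesgue (ball x0 R))"
    proof -
      have "1 / measure lebesgue (ball x0 \<sigma>) \<le> 2 powr ?d / measure lebesgue (ball x0 R)"
        using 2 pos by (simp add: field_simps)
      then have "c powr q * enn2real (Y i) / H K * (1 / measure lebesgue (ball x0 \<sigma>)) \<le> c powr q * enn2real (Y i) / H K * (2 powr ?d / measure lebesgue (ball x0 R))"
        using H_pos[OF K] by (intro mult_left_mono) auto
      then show ?thesis by simp
    qed
    finally show ?thesis by (simp add: y_def mult_ac)
  qed
  define fk where "fk = 2 powr (?d + s * p + 1 + s * p / ?d) / unit_ball_vol ?d + 2 powr \<delta> + (2 powr (?d + t * q + 1 + t * q / ?d) / unit_ball_vol ?d + 2 powr \<delta>)"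
  have fk: "0 \<le> fk" unfolding fk_def by (auto intro!: add_nonneg_nonneg divide_nonneg_nonneg)
  have y0: "0 \<le> y" using H_pos[OF K] by (simp add: y_def)
  have "Y (Suc i) \<le> ennreal (fk * \<beta> powr \<delta>) * (gag + Y (Suc i))"
  proof -
    have S0: "S \<subseteq> ball x0 \<sigma>" "\<And>y. y \<in> ball x0 \<sigma> \<Longrightarrow> y \<notin> S \<Longrightarrow> f y = 0"
      using ff'(2) by (auto simp: S_def le_less)
    have "\<sigma> \<le> R" using cut.radii by simp
    then show ?thesis
      unfolding Y fk_def \<beta>_def gag_def \<delta>_def
      by (intro H_small_support[OF cut.\<sigma>'(3) _ S S0 ff'(2)]) measurable
  qed
  also have "\<dots> \<le> ennreal (fk * \<beta> powr \<delta>) * (ennreal ((2 * cc + 1) * z) * Y i)"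
    by (intro mult_left_mono sum) simp
  also have "\<dots> = ennreal (fk * \<beta> powr \<delta> * ((2 * cc + 1) * z)) * Y i"
    using fk cc z1 by (simp add: ennreal_mult mult.assoc)
  also have "\<dots> \<le> ennreal (fk * (2 * cc + 1) * 2 powr (?d * \<delta>) * 2 powr (?d + 2 * q + q * \<delta>) * Q0 powr (?d + q)
      * (2 powr (?d + 2 * q + q * \<delta>)) ^ i * y powr \<delta>) * Y i"
  proof (intro mult_right_mono ennreal_leI)
    have "\<beta> powr \<delta> \<le> (2 powr ?d * c powr q * y) powr \<delta>"
      using \<beta> \<delta>(1) by (intro powr_mono2) (auto simp: \<beta>_def)
    also have "\<dots> = 2 powr (?d * \<delta>) * c powr (q * \<delta>) * y powr \<delta>"
      by (simp add: powr_mult powr_powr)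
    finally have "fk * \<beta> powr \<delta> * ((2 * cc + 1) * z) \<le> fk * (2 powr (?d * \<delta>) * c powr (q * \<delta>) * y powr \<delta>) * ((2 * cc + 1) * z)"
      using fk cc z1 by (intro mult_right_mono mult_left_mono) auto
    also have "\<dots> = fk * (2 * cc + 1) * 2 powr (?d * \<delta>) * (c powr (?d + 2 * q) * c powr (q * \<delta>)) * Q0 powr (?d + q) * y powr \<delta>"
      by (simp add: z_def mult_ac)
    also have "c powr (?d + 2 * q) * c powr (q * \<delta>) = 2 powr (?d + 2 * q + q * \<delta>) * (2 powr (?d + 2 * q + q * \<delta>)) ^ i"
      unfolding powr_add[symmetric] by (rule c_powr)
    finally show "fk * \<beta> powr \<delta> * ((2 * cc + 1) * z) \<le> fk * (2 * cc + 1) * 2 powr (?d * \<delta>) * 2 powr (?d + 2 * q + q * \<delta>) * Q0 powr (?d + q)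
      * (2 powr (?d + 2 * q + q * \<delta>)) ^ i * y powr \<delta>"
      by (simp only: mult_ac)
  qed simp
  finally show ?thesis
    by (simp only: iteration_const_def Let_def iteration_base_def fk_def cc_def Q0_def y_def \<delta>_def)
qed

text \<open>Dividing \<open>Y\<close> by H K times the volume of the ball of radius \<open>R\<close>
  yields the recursion of \<open>fast_geometric_convergence\<close>. All radii exceed \<rho> and all
  levels stay below k0 + K, so the integral for \<rho> and k0 + K vanishes, and \<open>H\<close> is
  positive on positive arguments.\<close>

lemma de_giorgi_bound:
  fixes k0 K \<rho> r N :: real
  defines "\<delta> \<equiv> decay_exponent (real CARD('n)) s t p q"
  assumes radii: "R / 2 \<le> \<rho>" "\<rho> < r" "r \<le> R" and k0: "0 \<le> k0" and K: "0 < K" and N: "0 \<le> N"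
    and bound: "AE x in lebesgue. x \<in> ball x0 r \<longrightarrow> max (u x - k0) 0 \<le> N"
    and T: "T \<le> ennreal (h K)"
    and init: "(\<integral>\<^sup>+x. indicator (ball x0 r) x * ennreal (H (max (u x - k0) 0)) \<partial>lebesgue)
      \<le> ennreal ((iteration_const (real CARD('n)) s t p q \<Lambda> A N * (R / (r - \<rho>)) powr (real CARD('n) + q)) powr (- 1 / \<delta>)
          * iteration_base (real CARD('n)) s t p q powr (- 1 / \<delta>\<^sup>2) * (H K * measure lebesgue (ball x0 R)))"
  shows "AE x in lebesgue. x \<in> ball x0 \<rho> \<longrightarrow> u x \<le> k0 + K"
proof -
  note \<delta> = decay_exponent_bounds[folded \<delta>_def]
  let ?d = "real CARD('n)"
  define Y where "Y = (\<lambda>i. \<integral>\<^sup>+x. indicator (ball x0 (\<rho> + (r - \<rho>) / 2 ^ i)) x * ennreal (H (max (u x - (k0 + K * (1 - 1 / 2 ^ i))) 0)) \<partial>lebesgue)"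
  define W where "W = H K * measure lebesgue (ball x0 R)"
  have W: "0 < W" using H_pos[OF K] R by (simp add: W_def)
  define C where "C = iteration_const ?d s t p q \<Lambda> A N * (R / (r - \<rho>)) powr (?d + q)"
  define D where "D = iteration_base ?d s t p q"
  have C: "0 < C" unfolding C_def
    using radii R caccioppoli_const_nonneg[of N] by (intro mult_pos_pos iteration_const_pos) auto
  have D: "1 < D" unfolding D_def iteration_base_def \<delta>_def[symmetric] using \<delta>(1) sq_pos powr_less_mono[of 0 "?d + 2 * q + q * \<delta>" 2] by (simp add: add_pos_pos)
  have step: "Y (Suc i) \<le> ennreal (C * D ^ i * (enn2real (Y i) / W) powr \<delta>) * Y i" if "Y i < \<infinity>" for i
    using de_giorgi_step[OF radii k0 K N bound T, of i] that unfolding Y_def C_def D_def W_def \<delta>_def .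
  have Y0: "Y 0 \<le> ennreal (C powr (- 1 / \<delta>) * D powr (- 1 / \<delta>\<^sup>2) * W)"
    using init by (simp add: Y_def C_def D_def W_def)
  \<comment> \<open>\<open>enn2real\<close> would turn an infinite \<open>Y i\<close> into 0, so
    finiteness is carried through the induction before passing to reals.\<close>
  have fin: "Y i < \<infinity>" for i
  proof (induction i)
    case 0
    show ?case using Y0 by (rule le_less_trans) simp
  next
    case (Suc i)
    show ?case using step[OF Suc] by (rule le_less_trans) (use Suc in \<open>simp add: ennreal_mult_less_top\<close>)
  qed
  define y where "y i = enn2real (Y i) / W" for i
  have Yy: "Y i = ennreal (y i * W)" for i using fin[of i] W by (simp add: y_def)
  have y0: "0 \<le> y i" for i using W by (simp add: y_def)
  have "y \<longlonglongrightarrow> 0"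
  proof (rule fast_geometric_convergence[OF \<delta>(1) D C y0])
    fix i
    have "ennreal (y (Suc i) * W) \<le> ennreal (C * D ^ i * y i powr \<delta>) * ennreal (y i * W)"
      using step[OF fin, of i] unfolding Yy[symmetric] y_def[symmetric] .
    also have "\<dots> = ennreal (C * D ^ i * y i powr \<delta> * (y i * W))"
      using C D y0[of i] W by (intro ennreal_mult[symmetric]) auto
    finally have "y (Suc i) * W \<le> C * D ^ i * y i powr \<delta> * (y i * W)"
      using C D y0[of i] W by (subst (asm) ennreal_le_iff) auto
    then have "y (Suc i) \<le> C * D ^ i * (y i powr \<delta> * y i)" using W by (simp add: mult.assoc[symmetric])
    also have "y i powr \<delta> * y i = y i powr (1 + \<delta>)" using y0[of i] by (simp add: powr_mult_base[symmetric] mult.commute)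
    finally show "y (Suc i) \<le> C * D ^ i * y i powr (1 + \<delta>)" .
  next
    have "y 0 * W \<le> C powr (- 1 / \<delta>) * D powr (- 1 / \<delta>\<^sup>2) * W"
      using Y0 unfolding Yy using W by (subst (asm) ennreal_le_iff) auto
    then show "y 0 \<le> C powr (- 1 / \<delta>) * D powr (- 1 / \<delta>\<^sup>2)" using W by simp
  qed
  then have lim: "(\<lambda>i. y i * W) \<longlonglongrightarrow> 0 * W" by (intro tendsto_mult tendsto_const)
  define I where "I = (\<integral>\<^sup>+x. indicator (ball x0 \<rho>) x * ennreal (H (max (u x - (k0 + K)) 0)) \<partial>lebesgue)"
  have "I \<le> ennreal (y i * W)" for i
  proof -
    have "K * (1 - 1 / 2 ^ i) \<le> K * 1" using K by (intro mult_left_mono) auto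
    then have "max (u x - (k0 + K)) 0 \<le> max (u x - (k0 + K * (1 - 1 / 2 ^ i))) 0" for x by simp
    moreover have "ball x0 \<rho> \<subseteq> ball x0 (\<rho> + (r - \<rho>) / 2 ^ i)" using radii by (intro subset_ball) simp
    ultimately show ?thesis
      unfolding I_def Yy[symmetric] Y_def
      by (intro nn_integral_mono mult_mono ennreal_leI H_mono) (auto simp: indicator_def)
  qed
  then have "I \<le> ennreal 0"
    using tendsto_ennrealI[OF lim] by (intro LIMSEQ_le_const) auto
  then have "I = 0" by simp
  then have "AE x in lebesgue. indicator (ball x0 \<rho>) x * ennreal (H (max (u x - (k0 + K)) 0)) = 0"
    unfolding I_def by (subst (asm) nn_integral_0_iff_AE) measurable
  then show ?thesis
  proof eventually_elim
    case (elim x)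
    show ?case
    proof (intro impI, rule ccontr)
      assume "x \<in> ball x0 \<rho>" "\<not> u x \<le> k0 + K"
      then have "0 < H (max (u x - (k0 + K)) 0)" by (intro H_pos) auto
      then show False using elim \<open>x \<in> ball x0 \<rho>\<close> by auto
    qed
  qed
qed

end

section \<open>The sup estimate\<close>

text \<open>Surjectivity makes \<open>inv_into\<close> a right inverse of \<open>H\<close> and
  \<open>h\<close>. It follows from the intermediate value theorem on [0, X], where X is chosen so
  that the first summand alone reaches \<open>V\<close>.\<close>

lemma double_power_surj:
  fixes m l b c e V :: real
  assumes "0 < m" "0 < l" "0 < b" "0 \<le> c" "0 \<le> e" "0 \<le> V"
  shows "V \<in> (\<lambda>x. x powr m / b + c * (x powr l / e)) ` {0..}"
proof -
  let ?f = "\<lambda>x. x powr m / b + c * (x powr l / e)"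
  have cont: "continuous_on {0..} ?f"
    unfolding divide_inverse using assms
    by (intro continuous_intros continuous_on_powr') auto
  define X where "X = (V * b) powr (1 / m)"
  have "X powr m = V * b" using assms by (simp add: X_def powr_powr)
  then have "V \<le> ?f X" using assms by (simp add: mult_nonneg_nonneg)
  moreover have "?f 0 \<le> V" using assms by simp
  moreover have "0 \<le> X" by (simp add: X_def)
  ultimately obtain x where "0 \<le> x" "?f x = V"
    using IVT'[of ?f 0 V X] continuous_on_subset[OF cont, of "{0..X}"] by auto
  then show ?thesis by (auto intro!: image_eqI[of _ _ x])
qed

context double_phase
begin

lemma H_inverse:
  assumes "0 \<le> V"
  shows "0 \<le> inv_into {0..} H V" "H (inv_into {0..} H V) = V"
proof -
  have "V \<in> H ` {0..}"
    using double_power_surj[of p q "R powr (s * p)" a0 "R powr (t * q)" V] assms pq R a_inf_nonneg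
    by (simp add: H_fun_def[abs_def])
  then show "H (inv_into {0..} H V) = V" "0 \<le> inv_into {0..} H V"
    using inv_into_into[of V H "{0..}"] by (auto intro: f_inv_into_f)
qed

lemma h_inverse:
  assumes "0 \<le> V"
  shows "0 \<le> inv_into {0..} h V" "h (inv_into {0..} h V) = V"
proof -
  have "V \<in> h ` {0..}"
    using double_power_surj[of "p - 1" "q - 1" "R powr (s * p)" a0 "R powr (t * q)" V] assms pq R a_inf_nonneg
    by (simp add: h_fun_def[abs_def])
  then show "h (inv_into {0..} h V) = V" "0 \<le> inv_into {0..} h V"
    using inv_into_into[of V h "{0..}"] by (auto intro: f_inv_into_f)
qed

text \<open>De Giorgi's bound with starting level 2 Hi and increment (1 + b) Hi + hi, where
  \<open>Hi\<close> and \<open>hi\<close> are the two inverses on the right-hand side; the lemma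
  thus amounts to choosing \<open>b\<close>. The premise \<open>bound\<close> hides which of the two
  kinds of data is given.\<close>

lemma sup_bound:
  fixes \<rho> r N :: real
  defines "d \<equiv> real CARD('n)"
  defines "\<delta> \<equiv> decay_exponent d s t p q"
  assumes radii: "R / 2 \<le> \<rho>" "\<rho> < r" "r \<le> R" and N: "0 \<le> N"
    and bound: "\<And>k0. 0 \<le> k0 \<Longrightarrow> 2 * measure lebesgue {x \<in> ball x0 r. u x > k0} \<le> measure lebesgue (ball x0 r) \<Longrightarrow>
      AE x in lebesgue. x \<in> ball x0 r \<longrightarrow> max (u x - k0) 0 \<le> N"
  shows "esssup (lebesgue_on (ball x0 \<rho>)) (\<lambda>x. ennreal (pos_part u x))
     \<le> ennreal ((3 + iteration_const d s t p q \<Lambda> A N powr (1 / (\<delta> * p)) * iteration_base d s t p q powr (1 / (\<delta>\<^sup>2 * p)))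
          * (R / (r - \<rho>)) powr ((d + q) / (\<delta> * p))) *
       (inv_nonneg H (average (ball x0 r) (\<lambda>x. H (pos_part u x))) + inv_nonneg h T)"
    (is "_ \<le> ennreal ((3 + ?X) * ?Q) * (inv_nonneg H ?avg + _)")
\<comment> \<open>\<open>inv_nonneg\<close> sends \<infinity> to \<infinity> and the prefactor is
  positive, so an infinite mean or tail makes the right-hand side infinite.\<close>
proof (cases "?avg = \<infinity> \<or> T = \<infinity>")
  case True
  have "0 < (3 + ?X) * ?Q" using radii R by (intro mult_pos_pos add_pos_nonneg) auto
  moreover have "inv_nonneg H ?avg + inv_nonneg h T = \<infinity>" using True by (auto simp: inv_nonneg_def)
  moreover have "ennreal P * \<infinity> = \<infinity>" if "0 < P" for P
    using that by (simp add: ennreal_mult_top)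
  ultimately have "ennreal ((3 + ?X) * ?Q) * (inv_nonneg H ?avg + inv_nonneg h T) = \<infinity>"
    by (simp only:)
  then show ?thesis by (simp only: infinity_ennreal_def top_greatest)
next
  case False
  then have T_fin: "T \<noteq> \<infinity>" by simp
  note \<delta> = decay_exponent_bounds[folded d_def, folded \<delta>_def]
  have [measurable]: "pos_part u \<in> borel_measurable lebesgue"
    unfolding pos_part_def[abs_def] by measurable
  define V where "V = enn2real ?avg"
  define Hi where "Hi = inv_into {0..} H V"
  define hi where "hi = inv_into {0..} h (enn2real T)"
  have Hi: "0 \<le> Hi" "H Hi = V" using H_inverse[of V] by (auto simp: V_def Hi_def)
  have hi: "0 \<le> hi" "h hi = enn2real T" using h_inverse[of "enn2real T"] by (auto simp: hi_def)
  define Br where "Br = measure lebesgue (ball x0 r)"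
  have r0: "0 < r" using radii R by simp
  have Br: "0 < Br" using r0 by (simp add: Br_def)
  have em_Br: "emeasure lebesgue (ball x0 r) = ennreal Br"
    unfolding Br_def using r0 by (intro emeasure_eq_ennreal_measure) (simp add: emeasure_ball)
  define I where "I = (\<integral>\<^sup>+x. indicator (ball x0 r) x * ennreal (H (pos_part u x)) \<partial>lebesgue)"
  have avg: "?avg = I / ennreal Br" by (simp add: average_def I_def em_Br mult.commute)
  have I: "I = ennreal (V * Br)"
  proof (cases I)
    case (real i)
    then show ?thesis using Br unfolding V_def avg by (simp add: divide_ennreal)
  next
    case top
    then show ?thesis using False Br unfolding avg by (simp add: ennreal_top_divide)
  qed
  define z where "z = R / (r - \<rho>)"
  have z: "1 \<le> z" using radii R by (simp add: z_def)
  \<comment> \<open>Chosen so that b^p \<theta> = 1 for the smallness threshold \<theta> of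
    \<open>de_giorgi_bound\<close>.\<close>
  define b where "b = ?X * ?Q"
  have \<kappa>: "0 < (d + q) / (\<delta> * p)" using \<delta> pq by (simp add: d_def add_nonneg_pos)
  have Q1: "1 \<le> ?Q" using z \<kappa> unfolding z_def by (intro ge_one_powr_ge_zero) auto
  have b0: "0 \<le> b" by (simp add: b_def)
  have AE_bound: "AE x in lebesgue. x \<in> ball x0 \<rho> \<longrightarrow> pos_part u x \<le> 2 * Hi + ((1 + b) * Hi + hi)"
  \<comment> \<open>The iteration requires a positive increment, which may fail here; but then the
    mean of \<open>H\<close> vanishes, and with it the positive part almost everywhere on the
    ball.\<close>
  proof (cases "Hi = 0")
    case True
    then have "V = 0" using Hi(2) pq by (simp add: H_fun_def)
    then have "I = 0" using I by simp
    then have "AE x in lebesgue. indicator (ball x0 r) x * ennreal (H (pos_part u x)) = 0"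
      unfolding I_def by (subst (asm) nn_integral_0_iff_AE) measurable
    then show ?thesis
    proof eventually_elim
      case (elim x)
      show ?case
      proof
        assume "x \<in> ball x0 \<rho>"
        then have "x \<in> ball x0 r" using radii by simp
        then have "\<not> 0 < H (pos_part u x)" using elim by (auto simp: indicator_def)
        then have "\<not> 0 < pos_part u x" using H_pos by blast
        then show "pos_part u x \<le> 2 * Hi + ((1 + b) * Hi + hi)" using True hi(1) by simp
      qed
    qed
  next
    case False
    then have Hi0: "0 < Hi" using Hi(1) by simp
    then have V: "0 < V" using H_pos Hi(2) by auto
    \<comment> \<open>The summand \<open>hi\<close> gives T <= h K, and (1 + b) Hi gives V <=
      \<theta> H K by the p-growth of \<open>H\<close>.\<close>
    define K where "K = (1 + b) * Hi + hi"
    have K: "0 < K" using Hi0 b0 hi(1) by (simp add: K_def add_pos_nonneg)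
    \<comment> \<open>Starting at level \<open>2 Hi\<close>, the superlevel set fills at most half of the ball, as the bound \<open>N\<close> requires.\<close>
    define S where "S = {x \<in> ball x0 r. u x > 2 * Hi}"
    have S: "S \<in> sets lebesgue"
      unfolding S_def by (rule superlevel_in_ball_sets) measurable
    have S_sub: "S \<subseteq> ball x0 r" by (auto simp: S_def)
    have em_S: "emeasure lebesgue S = ennreal (measure lebesgue S)"
    proof -
      have "emeasure lebesgue S \<le> emeasure lebesgue (ball x0 r)" using S_sub by (intro emeasure_mono) auto
      also have "\<dots> < \<infinity>" unfolding em_Br by simp
      finally show ?thesis by (intro emeasure_eq_ennreal_measure) simp
    qed
    have "ennreal (H (2 * Hi)) * emeasure lebesgue S \<le> I"
      unfolding I_def by (rule chebyshev_H[OF _ _ S S_sub]) (use Hi0 in \<open>auto simp: S_def pos_part_def\<close>)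
    then have "H (2 * Hi) * measure lebesgue S \<le> V * Br"
      unfolding I em_S using V Br by (subst (asm) ennreal_mult[symmetric, OF H_nonneg]) auto
    \<comment> \<open>As p > 1, doubling the argument at least doubles \<open>H\<close>; Chebyshev's
      inequality then yields the factor one half.\<close>
    moreover have "2 * V \<le> H (2 * Hi)"
    proof -
      have "2 powr 1 \<le> 2 powr p" using pq by (intro powr_mono) auto
      then have "2 * V \<le> 2 powr p * V" using V by (intro mult_right_mono) auto
      then show ?thesis using H_mult_ge[of Hi 2] Hi by simp
    qed
    ultimately have "2 * V * measure lebesgue S \<le> V * Br"
      by (meson measure_nonneg mult_right_mono order_trans)
    then have half: "2 * measure lebesgue S \<le> Br" using V by simp
    have bd: "AE x in lebesgue. x \<in> ball x0 r \<longrightarrow> max (u x - 2 * Hi) 0 \<le> N"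
      by (rule bound[OF _ half[unfolded S_def Br_def]]) (use Hi(1) in simp)
    have T_le: "T \<le> ennreal (h K)"
    proof -
      have "T < top" using T_fin by (simp only: less_top infinity_ennreal_def)
      then have "T = ennreal (h hi)" unfolding hi(2) by (rule ennreal_enn2real[symmetric])
      also have "\<dots> \<le> ennreal (h K)" using hi(1) Hi0 b0 by (intro ennreal_leI h_mono) (auto simp: K_def)
      finally show ?thesis .
    qed
    define \<theta> where "\<theta> = (iteration_const d s t p q \<Lambda> A N * z powr (d + q)) powr (- 1 / \<delta>) * iteration_base d s t p q powr (- 1 / \<delta>\<^sup>2)"
    have itc: "0 < iteration_const d s t p q \<Lambda> A N"
      using caccioppoli_const_nonneg[of N] by (intro iteration_const_pos) (auto simp: d_def)
    have itb: "0 < iteration_base d s t p q" by (simp add: iteration_base_def)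
    have \<theta>: "0 < \<theta>" using itc itb z by (simp add: \<theta>_def)
    have b\<theta>: "b powr p * \<theta> = 1"
    proof -
      have "b powr p = iteration_const d s t p q \<Lambda> A N powr (1 / \<delta>) * iteration_base d s t p q powr (1 / \<delta>\<^sup>2) * z powr ((d + q) / \<delta>)"
      proof -
        have e: "1 / (\<delta> * p) * p = 1 / \<delta>" "1 / (\<delta>\<^sup>2 * p) * p = 1 / \<delta>\<^sup>2" "(d + q) / (\<delta> * p) * p = (d + q) / \<delta>"
          using pq \<delta>(1) by simp_all
        show ?thesis unfolding b_def z_def[symmetric] powr_mult powr_powr e ..
      qed
      moreover have "\<theta> = inverse (iteration_const d s t p q \<Lambda> A N powr (1 / \<delta>)) * inverse (z powr ((d + q) / \<delta>)) * inverse (iteration_base d s t p q powr (1 / \<delta>\<^sup>2))"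
        unfolding \<theta>_def powr_mult powr_powr by (simp add: powr_minus)
      moreover have "x * y * w * (inverse x * inverse w * inverse y) = 1" if "x \<noteq> 0" "y \<noteq> 0" "w \<noteq> 0" for x y w :: real
        using that by (simp add: field_simps)
      ultimately show ?thesis using itc itb z by simp
    qed
    have "V \<le> \<theta> * H K"
    proof -
      have "b powr p * V \<le> (1 + b) powr p * V"
        using b0 V pq by (intro mult_right_mono powr_mono2) auto
      also have "\<dots> \<le> H ((1 + b) * Hi)" using H_mult_ge[of Hi "1 + b"] b0 Hi by simp
      also have "\<dots> \<le> H K" using hi(1) Hi0 b0 by (intro H_mono) (auto simp: K_def)
      finally have "\<theta> * (b powr p * V) \<le> \<theta> * H K" using \<theta> by (intro mult_left_mono) auto
      then show ?thesis using b\<theta> by (simp add: mult.commute mult.left_commute)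
    qed
    moreover have "Br \<le> measure lebesgue (ball x0 R)"
      unfolding Br_def using radii by (intro measure_mono_fmeasurable subset_ball) auto
    ultimately have "V * Br \<le> \<theta> * H K * measure lebesgue (ball x0 R)"
      using V Br \<theta> H_nonneg by (intro mult_mono) auto
    then have "I \<le> ennreal (\<theta> * (H K * measure lebesgue (ball x0 R)))"
      unfolding I by (intro ennreal_leI) (simp add: mult.assoc)
    moreover have "(\<integral>\<^sup>+x. indicator (ball x0 r) x * ennreal (H (max (u x - 2 * Hi) 0)) \<partial>lebesgue) \<le> I"
      unfolding I_def pos_part_def using Hi(1) by (intro nn_integral_mono mult_left_mono ennreal_leI H_mono) auto
    ultimately have init: "(\<integral>\<^sup>+x. indicator (ball x0 r) x * ennreal (H (max (u x - 2 * Hi) 0)) \<partial>lebesgue)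
       \<le> ennreal (\<theta> * (H K * measure lebesgue (ball x0 R)))" by (rule order_trans[rotated])
    have "AE x in lebesgue. x \<in> ball x0 \<rho> \<longrightarrow> u x \<le> 2 * Hi + K"
      by (rule de_giorgi_bound[OF radii _ K N bd T_le])
         (use Hi(1) init in \<open>simp_all add: \<theta>_def z_def \<delta>_def d_def\<close>)
    then show ?thesis
      by eventually_elim (use K Hi(1) in \<open>auto simp: pos_part_def K_def\<close>)
  qed
  \<comment> \<open>The 3 collects the starting level 2 Hi and the 1 in 1 + b, both enlarged by the
    factor \<open>?Q\<close>, which is at least 1.\<close>
  have "2 * Hi + ((1 + b) * Hi + hi) \<le> (3 + ?X) * ?Q * (Hi + hi)"
  proof -
    have "Hi * 1 \<le> Hi * ?Q" "hi * 1 \<le> hi * ?Q" using Hi(1) hi(1) Q1 by (intro mult_left_mono; simp)+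
    moreover have "0 \<le> (2 + ?X) * ?Q * hi" using hi(1) by (intro mult_nonneg_nonneg add_nonneg_nonneg) auto
    ultimately show ?thesis unfolding b_def by (simp add: algebra_simps)
  qed
  then have AE_bound': "AE x in lebesgue. x \<in> ball x0 \<rho> \<longrightarrow> pos_part u x \<le> (3 + ?X) * ?Q * (Hi + hi)"
    using AE_bound by (auto elim!: eventually_mono)
  have "esssup (lebesgue_on (ball x0 \<rho>)) (\<lambda>x. ennreal (pos_part u x)) \<le> ennreal ((3 + ?X) * ?Q * (Hi + hi))"
  proof (rule esssup_I)
    show "(\<lambda>x. ennreal (pos_part u x)) \<in> borel_measurable (lebesgue_on (ball x0 \<rho>))"
      by (intro measurable_restrict_space1) measurable
    show "AE x in lebesgue_on (ball x0 \<rho>). ennreal (pos_part u x) \<le> ennreal ((3 + ?X) * ?Q * (Hi + hi))"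
      using AE_bound' by (subst AE_restrict_space_iff) (auto elim!: eventually_mono intro!: ennreal_leI)
  qed
  also have "\<dots> = ennreal ((3 + ?X) * ?Q) * (ennreal Hi + ennreal hi)"
  proof -
    have "0 \<le> (3 + ?X) * ?Q" by (intro mult_nonneg_nonneg add_nonneg_nonneg) auto
    then show ?thesis using Hi(1) hi(1) by (subst ennreal_mult) auto
  qed
  also have "\<dots> = ennreal ((3 + ?X) * ?Q) * (inv_nonneg H ?avg + inv_nonneg h T)"
    using False by (simp add: inv_nonneg_def Hi_def hi_def V_def)
  finally show ?thesis .
qed

end

text \<open>For s <= t the distances of two pairs in the ball add up to at most 4 R, so
  \<open>a\<close> oscillates by at most 4 A R^\<alpha>, and R <= 1 with t q - s p <= \<alpha> gives
  R^\<alpha> <= R^(t q - s p). For s > t the exponent t q - s p is nonpositive, hence R^(t q - s p)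
  >= 1, and the bound a <= A suffices.\<close>

lemma double_phaseI:
  fixes \<Omega> :: "(real^'n::finite) set"
  assumes st: "0 < s" "s < 1" "0 < t" "t < 1" and pq: "1 < p" "p \<le> q" and \<Lambda>: "1 \<le> \<Lambda>" and A: "0 \<le> A"
    and \<alpha>: "s \<le> t \<Longrightarrow> 0 < \<alpha> \<and> \<alpha> \<le> 1"
    and tq: "s \<le> t \<Longrightarrow> t * q \<le> s * p + \<alpha>" "t < s \<Longrightarrow> t * q \<le> s * p"
    and \<Omega>: "open \<Omega>" and ker: "sym_kernel \<Lambda> (s * p) Ksp" "sym_kernel \<Lambda> (t * q) Ktq"
    and a: "modulating_coeff \<Omega> a" "coeff_data s t \<alpha> A a"
    and R: "0 < R" "R \<le> 1" "closure (ball x0 R) \<subseteq> \<Omega>"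
    and u_min: "minimizer s t p q Ksp Ktq a \<Omega> u"
  shows "double_phase s t p q \<Lambda> A \<Omega> Ksp Ktq a x0 R u"
proof
  let ?B = "ball x0 R"
  have a0: "0 \<le> a x y" for x y using a(1) by (simp add: modulating_coeff_def)
  then have bdd: "bdd_below ((\<lambda>z. a (fst z) (snd z)) ` (?B \<times> ?B))" by (intro bdd_belowI[of _ 0]) auto
  have ne: "?B \<times> ?B \<noteq> {}" using R by (auto simp: not_le)
  show inf0: "0 \<le> a_inf a x0 R" unfolding a_inf_def using ne a0 by (intro cINF_greatest) auto
  fix x y assume xy: "x \<in> ?B" "y \<in> ?B"
  have "a_inf a x0 R \<le> a x y"
    unfolding a_inf_def using cINF_lower[OF bdd, of "(x, y)"] xy by auto
  moreover have "a x y \<le> a_inf a x0 R + 4 * A * R powr (t * q - s * p)"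
  proof (cases "s \<le> t")
    case True
    have *: "a x y - 4 * A * R powr (t * q - s * p) \<le> a (fst z) (snd z)" if z: "z \<in> ?B \<times> ?B" for z
    proof -
      have d: "norm (v - w) \<le> 2 * R" if "v \<in> ?B" "w \<in> ?B" for v w
        using that dist_triangle[of v w x0] by (simp add: dist_norm norm_minus_commute)
      have "norm (x - fst z) \<le> 2 * R" "norm (y - snd z) \<le> 2 * R"
        using z xy unfolding mem_Times_iff by (auto intro!: d simp del: mem_ball)
      then have "(norm (x - fst z) + norm (y - snd z)) powr \<alpha> \<le> (4 * R) powr \<alpha>"
        using \<alpha>[OF True] by (intro powr_mono2) auto
      also have "\<dots> = 4 powr \<alpha> * R powr \<alpha>" by (simp add: powr_mult)
      also have "\<dots> \<le> 4 powr 1 * R powr (t * q - s * p)"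
        using \<alpha>[OF True] tq(1)[OF True] R by (intro mult_mono powr_mono powr_mono') auto
      finally have "A * (norm (x - fst z) + norm (y - snd z)) powr \<alpha> \<le> A * (4 * R powr (t * q - s * p))"
        using A by (intro mult_left_mono) auto
      moreover have "\<bar>a x y - a (fst z) (snd z)\<bar> \<le> A * (norm (x - fst z) + norm (y - snd z)) powr \<alpha>"
        using a(2) True by (simp add: coeff_data_def)
      ultimately show ?thesis by simp
    qed
    have "a x y - 4 * A * R powr (t * q - s * p) \<le> a_inf a x0 R"
      unfolding a_inf_def using ne * by (rule cINF_greatest)
    then show ?thesis by simp
  next
    case False
    have "R powr 0 \<le> R powr (t * q - s * p)" using False tq(2) R by (intro powr_mono') auto
    then have "A * 1 \<le> A * (4 * R powr (t * q - s * p))" using A R by (intro mult_left_mono) auto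
    moreover have "\<bar>a x y\<bar> \<le> A" using a(2) False by (simp add: coeff_data_def)
    ultimately show ?thesis using inf0 by simp
  qed
  ultimately show "a_inf a x0 R \<le> a x y \<and> a x y \<le> a_inf a x0 R + 4 * A * R powr (t * q - s * p)" by simp
next
  show "ball x0 R \<subseteq> \<Omega>" using R(3) closure_subset by blast
  show "0 \<le> a x y" for x y using a(1) by (simp add: modulating_coeff_def)
  show "(\<lambda>z. a (fst z) (snd z)) \<in> borel_measurable lebesgue"
    "AE z in lebesgue. a (fst z) (snd z) = a (snd z) (fst z)"
    using a(1) by (simp_all add: modulating_coeff_def)
qed (fact assms)+

lemma Wsp_seminorm_gagliardo:
  fixes u :: "real^'n::finite \<Rightarrow> real"
  assumes W: "Wsp_seminorm s p (ball x0 R) u = ennreal M" and "0 \<le> M" "1 < p" "r \<le> R"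
  shows "gagliardo p (s * p) (ball x0 r) u \<le> ennreal (M powr p)"
proof -
  define I where "I = (\<integral>\<^sup>+z\<in>ball x0 R \<times> ball x0 R. (case z of (x, y) \<Rightarrow> ennreal (
                \<bar>u x - u y\<bar> powr p / norm (x - y) powr (real CARD('n) + s * p))) \<partial>lebesgue)"
  have I: "I \<noteq> \<infinity>" "enn2real I powr (1 / p) = M"
    using W assms(2) by (auto simp: Wsp_seminorm_def I_def[symmetric] Let_def split: if_splits)
  have "M powr p = enn2real I" using assms(3) unfolding I(2)[symmetric] by (simp add: powr_powr)
  then have "I = ennreal (M powr p)" using I(1) by (simp add: less_top)
  moreover have "gagliardo p (s * p) (ball x0 r) u \<le> I"
    unfolding gagliardo_def I_def using assms(4)
    by (intro nn_integral_mono) (auto simp: indicator_def split: if_splits)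
  ultimately show ?thesis by simp
qed

text \<open>Dependence on the data alone is expressed by the order of quantifiers: the constants are
  chosen from the numerical data, with \<open>A\<close> for the coefficient and \<open>M\<close> for
  the norm of \<open>u\<close>, before the domain, kernels, coefficient, ball and minimizer.\<close>

theorem lemma3p1:
  fixes s t p q \<Lambda> \<alpha> A M :: real
  assumes "2 \<le> CARD('n::finite)"
    and "0 < s" "s < 1" "0 < t" "t < 1" "1 < p" "p \<le> q"
    and "1 \<le> \<Lambda>"
    and "s \<le> t \<Longrightarrow> 0 < \<alpha> \<and> \<alpha> \<le> 1"
    and "s * p < real CARD('n) \<Longrightarrow> q \<le> real CARD('n) * p / (real CARD('n) - s * p)"
    and "s \<le> t \<Longrightarrow> t * q \<le> s * p + \<alpha>"
    and "t < s \<Longrightarrow> t * q \<le> s * p"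
    and "0 \<le> A" "0 \<le> M"
  shows "\<exists>C \<kappa>. 1 \<le> C \<and> 0 < \<kappa> \<and>
    (\<forall>(\<Omega> :: (real^'n) set) Ksp Ktq a x0 R u.
       open \<Omega> \<and> bounded \<Omega> \<and>
       sym_kernel \<Lambda> (s * p) Ksp \<and> sym_kernel \<Lambda> (t * q) Ktq \<and>
       modulating_coeff \<Omega> a \<and> coeff_data s t \<alpha> A a \<and>
       0 < R \<and> R \<le> 1 \<and> closure (ball x0 R) \<subseteq> \<Omega> \<and>
       u \<in> space_A s t p q a \<Omega> \<inter> tail_space_p s p \<inter> tail_space_q t q a \<Omega> \<and>
       minimizer s t p q Ksp Ktq a \<Omega> u \<and>
       data_norm s p (ball x0 R) u = ennreal M \<longrightarrow>
       (\<forall>\<rho> r. R / 2 \<le> \<rho> \<and> \<rho> < r \<and> r \<le> R \<longrightarrow>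
          esssup (lebesgue_on (ball x0 \<rho>)) (\<lambda>x. ennreal (pos_part u x))
          \<le> ennreal (C * (R / (r - \<rho>)) powr \<kappa>) *
            (inv_nonneg (H_fun s t p q a x0 R)
               (average (ball x0 r) (\<lambda>x. H_fun s t p q a x0 R (pos_part u x)))
             + inv_nonneg (h_fun s t p q a x0 R) (tail s t p q a (R / 2) R (pos_part u) x0))))"
proof -
  let ?d = "real CARD('n)"
  \<comment> \<open>For s p <= n the excess over any level k0 >= 0 is at most |u|, hence at most
    \<open>M\<close>; otherwise the bound comes from the iteration for the seminorm alone.\<close>
  define N where "N = (if s * p \<le> ?d then M else sup_excess_const ?d p (s * p) M)"
  define \<delta> where "\<delta> = decay_exponent ?d s t p q"
  define C where "C = 3 + iteration_const ?d s t p q \<Lambda> A N powr (1 / (\<delta> * p)) * iteration_base ?d s t p q powr (1 / (\<delta>\<^sup>2 * p))"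
  have N: "0 \<le> N" using assms(14) by (auto simp: N_def sup_excess_const_def)
  have \<delta>: "0 < \<delta>" using assms by (simp add: \<delta>_def decay_exponent_def)
  show ?thesis
  proof (rule exI[of _ C], rule exI[of _ "(?d + q) / (\<delta> * p)"], intro conjI allI impI)
    show "1 \<le> C" by (simp add: C_def add_increasing2)
    show "0 < (?d + q) / (\<delta> * p)" using \<delta> assms by (simp add: add_nonneg_pos)
    fix \<Omega> :: "(real^'n) set" and Ksp Ktq a :: "real^'n \<Rightarrow> real^'n \<Rightarrow> real" and x0 :: "real^'n" and R and u :: "real^'n \<Rightarrow> real" and \<rho> r
    assume H: "open \<Omega> \<and> bounded \<Omega> \<and>
       sym_kernel \<Lambda> (s * p) Ksp \<and> sym_kernel \<Lambda> (t * q) Ktq \<and>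
       modulating_coeff \<Omega> a \<and> coeff_data s t \<alpha> A a \<and>
       0 < R \<and> R \<le> 1 \<and> closure (ball x0 R) \<subseteq> \<Omega> \<and>
       u \<in> space_A s t p q a \<Omega> \<inter> tail_space_p s p \<inter> tail_space_q t q a \<Omega> \<and>
       minimizer s t p q Ksp Ktq a \<Omega> u \<and>
       data_norm s p (ball x0 R) u = ennreal M"
      and radii: "R / 2 \<le> \<rho> \<and> \<rho> < r \<and> r \<le> R"
    interpret double_phase s t p q \<Lambda> A \<Omega> Ksp Ktq a x0 R u
      by (rule double_phaseI[where \<alpha> = \<alpha>]) (use assms H in auto)
    have bound: "AE x in lebesgue. x \<in> ball x0 r \<longrightarrow> max (u x - k0) 0 \<le> N"
      if k0: "0 \<le> k0" and half: "2 * measure lebesgue {x \<in> ball x0 r. u x > k0} \<le> measure lebesgue (ball x0 r)" for k0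
    proof (cases "s * p \<le> ?d")
      case True
      then have "esssup (lebesgue_on (ball x0 R)) (\<lambda>x. ennreal \<bar>u x\<bar>) = ennreal M"
        using H by (simp add: data_norm_def Linf_norm_def)
      then have "AE x in lebesgue_on (ball x0 R). ennreal \<bar>u x\<bar> \<le> ennreal M"
        using esssup_AE[of "\<lambda>x. ennreal \<bar>u x\<bar>" "lebesgue_on (ball x0 R)"] by simp
      then have "AE x in lebesgue. x \<in> ball x0 R \<longrightarrow> ennreal \<bar>u x\<bar> \<le> ennreal M"
        by (subst (asm) AE_restrict_space_iff) auto
      then show ?thesis
        by eventually_elim (use k0 True radii assms(14) in \<open>auto simp: N_def ennreal_le_iff\<close>)
    next
      case False
      then have "gagliardo p (s * p) (ball x0 r) u \<le> ennreal (M powr p)"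
        using H radii assms by (intro Wsp_seminorm_gagliardo[of s p x0 R]) (auto simp: data_norm_def)
      then have "AE x in lebesgue. x \<in> ball x0 r \<longrightarrow> u x \<le> k0 + sup_excess_const (real DIM(real^'n)) p (s * p) M"
      proof (intro supercritical_excess_bound[OF _ _ _ _ _ u_meas _ half])
        show "0 < r" "r \<le> 1" using radii H by auto
        show "real DIM(real^'n) < s * p" using False by simp
      qed (use assms in auto)
      then show ?thesis
        by eventually_elim (use False N in \<open>auto simp: N_def\<close>)
    qed
    show "esssup (lebesgue_on (ball x0 \<rho>)) (\<lambda>x. ennreal (pos_part u x))
          \<le> ennreal (C * (R / (r - \<rho>)) powr ((?d + q) / (\<delta> * p))) *
            (inv_nonneg (H_fun s t p q a x0 R)
               (average (ball x0 r) (\<lambda>x. H_fun s t p q a x0 R (pos_part u x)))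
             + inv_nonneg (h_fun s t p q a x0 R) (tail s t p q a (R / 2) R (pos_part u) x0))"
      using sup_bound[of \<rho> r N] radii N bound by (simp only: C_def \<delta>_def)
  qed
qed

end
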